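(* If $f=f_h\in\mathcal{L}^0(\mathcal{T}_h)$, then for every $v\in K$, $$\tfrac12\|\nabla v-\nabla u\|_\Omega^2+\langle-\Lambda,v-u\rangle_\Omega+\tfrac12\|z_h^{rt}-z\|_\Omega^2\le\tfrac12\|\nabla v-z_h^{rt}\|_\Omega^2+\eta_{B,h}^2(v)\le\eta_{A,h}^2(v)+\eta_{B,h}^2(v)+\eta_{C,h}^2.$$
   Context: Setting: $d\in\mathbb{N}$; $\Omega\subseteq\mathbb{R}^d$ is a bounded polyhedral Lipschitz domain whose boundary is the disjoint union of a closed Dirichlet part $\Gamma_D$ with $|\Gamma_D|>0$ (($d-1$)-dimensional Hausdorff measure) and a Neumann part $\Gamma_N$. $(\cdot,\cdot)_\omega$ and $\|\cdot\|_\omega$ are the $L^2(\omega)$ inner product and norm (scalar or vector valued). $H^1_D(\Omega)=\{v\in H^1(\Omega): v=0 \text{ a.e. on }\Gamma_D\}$ (traces); $\langle\cdot,\cdot\rangle_\Omega$ is the duality pairing of $(H^1_D(\Omega))^*$ and $H^1_D(\Omega)$. Mesh: $\mathcal{T}_h$ is a member of a shape-regular family of conforming simplicial triangulations of $\Omega$; $h_T=\mathrm{diam}(T)$ and $h_{\mathcal{T}}\in\mathcal{L}^0(\mathcal{T}_h)$ is given by $h_{\mathcal{T}}|_T=h_T$. Every boundary side is contained in $\Gamma_D$ or in $\overline{\Gamma_N}$. $x_S$ is the barycenter of a side (facet) $S$. $\mathcal{L}^k(\mathcal{T}_h)$ is the space of element-wise polynomials of degree $\le k$. $\Pi_h$ is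 the $L^2$-projection onto element-wise constant functions (or vector fields). $\nabla_h$ is the element-wise gradient. $\mathcal{S}^{1,cr}_D(\mathcal{T}_h)$ is the Crouzeix--Raviart space of $v_h\in\mathcal{L}^1(\mathcal{T}_h)$ continuous at $x_S$ for all interior sides $S$ and with $v_h(x_S)=0$ for all sides $S\subseteq\Gamma_D$. Obstacle problem: $f\in L^2(\Omega)$, $\chi\in H^1(\Omega)$ with $\chi\le0$ a.e. on $\Gamma_D$, $K=\{v\in H^1_D(\Omega): v\ge\chi\text{ a.e. in }\Omega\}$; $u\in K$ is the unique minimizer of $\frac12\|\nabla v\|_\Omega^2-(f,v)_\Omega$ over $v\in K$; $z=\nabla u$ is the dual solution; the Lagrange multiplier $\Lambda\in(H^1_D(\Omega))^*$ is given by $\langle\Lambda,v\rangle_\Omega=(f,v)_\Omega-(\nabla u,\nabla v)_\Omega$ for all $v\in H^1_D(\Omega)$. Discrete obstacle problem: $f_h=\Pi_hf$, $\chi_h\in\mathcal{L}^0(\mathcal{T}_h)$ is an approximation of $\chi$, $K_h^{cr}=\{v_h\in\mathcal{S}^{1,cr}_D(\mathcal{T}_h):\Pi_hv_h\ge\chi_h\text{ a.e. in }\Omega\}$; $u_h^{cr}\in K_h^{cr}$ is the unique minimizer of $\frac12\|\nabla_hv_h\|_\Omega^2-(f_h,\Pi_hv_h)_\Omega$ over $v_h\in K_h^{cr}$. The discrete Lagrange multiplier $\overline{\lambda}_h^{cr}\in\Pi_h(\mathcal{S}^{1,cr}_D(\mathcal{T}_h))$ is the unique element with $\overline{\lambda}_h^{cr}\le0$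 a.e. in $\Omega$ and $(\overline{\lambda}_h^{cr},\Pi_hv_h)_\Omega=(f_h,\Pi_hv_h)_\Omega-(\nabla_hu_h^{cr},\nabla_hv_h)_\Omega$ for all $v_h\in\mathcal{S}^{1,cr}_D(\mathcal{T}_h)$. The discrete flux (discrete dual solution) is $z_h^{rt}=\nabla_hu_h^{cr}+\frac{\overline{\lambda}_h^{cr}-f_h}{d}(\mathrm{id}_{\mathbb{R}^d}-\Pi_h\mathrm{id}_{\mathbb{R}^d})$. Estimators, for $v\in H^1_D(\Omega)$: $\eta_{A,h}^2(v)=\|\nabla v-\nabla_hu_h^{cr}\|_\Omega^2$, $\eta_{B,h}^2(v)=(-\overline{\lambda}_h^{cr},\Pi_h(v-\chi))_\Omega$, $\eta_{C,h}^2=\frac1{d^2}\|h_{\mathcal{T}}(f_h-\overline{\lambda}_h^{cr})\|_\Omega^2$. *)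

theory Defs
  imports "HOL-Analysis.Analysis"
begin

text \<open>The exponent is a natural number, so that \<open>0 ^ 0 = 1\<close> and the case \<open>k = 0\<close> is the counting
  measure. Boundedness of the covering sets is required because \<^const>\<open>diameter\<close> is \<open>0\<close> on
  unbounded sets.\<close>

definition hausdorff_pre :: "real \<Rightarrow> nat \<Rightarrow> 'a::euclidean_space set \<Rightarrow> ennreal" where
  "hausdorff_pre \<delta> k A =
     (INF U\<in>{U :: nat \<Rightarrow> 'a set. A \<subseteq> (\<Union>i. U i) \<and> (\<forall>i. bounded (U i) \<and> diameter (U i) \<le> \<delta>)}.
        \<Sum>i. if U i = {} then 0 else ennreal (unit_ball_vol (real k) * (diameter (U i) / 2) ^ k))"

definition hausdorff_outer :: "nat \<Rightarrow> 'a::euclidean_space set \<Rightarrow> ennreal" where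
  "hausdorff_outer k A = (SUP \<delta>\<in>{0<..}. hausdorff_pre \<delta> k A)"

text \<open>\<^const>\<open>measure_of\<close> would return the zero measure if the outer measure were not countably
  additive on Borel sets; it is, being a metric outer measure.\<close>

definition hausdorff_measure :: "nat \<Rightarrow> 'a::euclidean_space measure" where
  "hausdorff_measure k = measure_of UNIV (sets borel) (hausdorff_outer k)"

definition surface_measure :: "'a::euclidean_space set \<Rightarrow> 'a measure" where
  "surface_measure \<Omega> = restrict_space (hausdorff_measure (DIM('a) - 1)) (frontier \<Omega>)"

text \<open>Elements of function spaces are represented by functions on the whole space, of which only the
  values almost everywhere on the domain matter.\<close>

definition L2 :: "'a::euclidean_space set \<Rightarrow> ('a \<Rightarrow> 'b::euclidean_space) set" where
  "L2 \<Omega> = {v. v \<in> borel_measurable (lebesgue_on \<Omega>) \<and>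
              integrable (lebesgue_on \<Omega>) (\<lambda>x. (norm (v x))\<^sup>2)}"

definition L2_inner :: "'a::euclidean_space set \<Rightarrow> ('a \<Rightarrow> 'b::euclidean_space) \<Rightarrow> ('a \<Rightarrow> 'b) \<Rightarrow> real" where
  "L2_inner \<Omega> v w = (LINT x|lebesgue_on \<Omega>. v x \<bullet> w x)"

definition L2_norm :: "'a::euclidean_space set \<Rightarrow> ('a \<Rightarrow> 'b::euclidean_space) \<Rightarrow> real" where
  "L2_norm \<Omega> v = sqrt (L2_inner \<Omega> v v)"

definition L2_tendsto :: "'a measure \<Rightarrow> (nat \<Rightarrow> 'a \<Rightarrow> 'b::euclidean_space) \<Rightarrow> ('a \<Rightarrow> 'b) \<Rightarrow> bool" where
  "L2_tendsto M \<phi> v \<longleftrightarrow> (\<lambda>n. \<integral>\<^sup>+x. ennreal ((norm (\<phi> n x - v x))\<^sup>2) \<partial>M) \<longlonglongrightarrow> 0"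

definition partial_deriv :: "'a::euclidean_space \<Rightarrow> ('a \<Rightarrow> real) \<Rightarrow> 'a \<Rightarrow> real" where
  "partial_deriv b v x = frechet_derivative v (at x) b"

definition grad :: "('a::euclidean_space \<Rightarrow> real) \<Rightarrow> 'a \<Rightarrow> 'a" where
  "grad v x = (\<Sum>b\<in>Basis. partial_deriv b v x *\<^sub>R b)"

fun C_k :: "nat \<Rightarrow> ('a::euclidean_space \<Rightarrow> real) \<Rightarrow> bool" where
  "C_k 0 v = continuous_on UNIV v"
| "C_k (Suc k) v = (v differentiable_on UNIV \<and> (\<forall>b\<in>Basis. C_k k (partial_deriv b v)))"

definition C_infinity :: "('a::euclidean_space \<Rightarrow> real) set" where
  "C_infinity = {v. \<forall>k. C_k k v}"

definition test_functions :: "'a::euclidean_space set \<Rightarrow> ('a \<Rightarrow> real) set" where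
  "test_functions \<Omega> =
     {\<phi> \<in> C_infinity. compact (closure {x. \<phi> x \<noteq> 0}) \<and> closure {x. \<phi> x \<noteq> 0} \<subseteq> \<Omega>}"

definition has_weak_gradient :: "'a::euclidean_space set \<Rightarrow> ('a \<Rightarrow> real) \<Rightarrow> ('a \<Rightarrow> 'a) \<Rightarrow> bool" where
  "has_weak_gradient \<Omega> v g \<longleftrightarrow>
     (\<forall>\<phi>\<in>test_functions \<Omega>. \<forall>b\<in>Basis.
        L2_inner \<Omega> v (partial_deriv b \<phi>) = - L2_inner \<Omega> (\<lambda>x. g x \<bullet> b) \<phi>)"

definition H1 :: "'a::euclidean_space set \<Rightarrow> ('a \<Rightarrow> real) set" where
  "H1 \<Omega> = {v \<in> L2 \<Omega>. \<exists>g\<in>L2 \<Omega>. has_weak_gradient \<Omega> v g}"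

definition weak_grad :: "'a::euclidean_space set \<Rightarrow> ('a \<Rightarrow> real) \<Rightarrow> 'a \<Rightarrow> 'a" where
  "weak_grad \<Omega> v = (SOME g. g \<in> L2 \<Omega> \<and> has_weak_gradient \<Omega> v g)"

definition H1_norm :: "'a::euclidean_space set \<Rightarrow> ('a \<Rightarrow> real) \<Rightarrow> real" where
  "H1_norm \<Omega> v = sqrt ((L2_norm \<Omega> v)\<^sup>2 + (L2_norm \<Omega> (weak_grad \<Omega> v))\<^sup>2)"

text \<open>The trace operator of a bounded Lipschitz domain is the continuous extension to
  \<open>H\<^sup>1(\<Omega>)\<close> of the restriction of smooth functions to the boundary, with values in
  \<open>L\<^sup>2(\<partial>\<Omega>)\<close>; we use its graph.\<close>

definition has_trace :: "'a::euclidean_space set \<Rightarrow> ('a \<Rightarrow> real) \<Rightarrow> ('a \<Rightarrow> real) \<Rightarrow> bool" where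
  "has_trace \<Omega> v g \<longleftrightarrow>
     g \<in> borel_measurable (surface_measure \<Omega>) \<and>
     integrable (surface_measure \<Omega>) (\<lambda>x. (g x)\<^sup>2) \<and>
     (\<exists>\<phi>. (\<forall>n. \<phi> n \<in> C_infinity) \<and>
          L2_tendsto (lebesgue_on \<Omega>) \<phi> v \<and>
          L2_tendsto (lebesgue_on \<Omega>) (\<lambda>n. grad (\<phi> n)) (weak_grad \<Omega> v) \<and>
          L2_tendsto (surface_measure \<Omega>) \<phi> g)"

definition H1\<^sub>D :: "'a::euclidean_space set \<Rightarrow> 'a set \<Rightarrow> ('a \<Rightarrow> real) set" where
  "H1\<^sub>D \<Omega> \<Gamma>\<^sub>D =
     {v \<in> H1 \<Omega>. \<exists>g. has_trace \<Omega> v g \<and> (AE x in surface_measure \<Omega>. x \<in> \<Gamma>\<^sub>D \<longrightarrow> g x = 0)}"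

definition dual_H1\<^sub>D :: "'a::euclidean_space set \<Rightarrow> 'a set \<Rightarrow> (('a \<Rightarrow> real) \<Rightarrow> real) set" where
  "dual_H1\<^sub>D \<Omega> \<Gamma>\<^sub>D =
     {\<Lambda>. (\<forall>v\<in>H1\<^sub>D \<Omega> \<Gamma>\<^sub>D. \<forall>w\<in>H1\<^sub>D \<Omega> \<Gamma>\<^sub>D. \<Lambda> (\<lambda>x. v x + w x) = \<Lambda> v + \<Lambda> w) \<and>
         (\<forall>v\<in>H1\<^sub>D \<Omega> \<Gamma>\<^sub>D. \<forall>c. \<Lambda> (\<lambda>x. c * v x) = c * \<Lambda> v) \<and>
         (\<exists>C. \<forall>v\<in>H1\<^sub>D \<Omega> \<Gamma>\<^sub>D. \<bar>\<Lambda> v\<bar> \<le> C * H1_norm \<Omega> v)}"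

text \<open>Near each boundary point the domain is the strict epigraph, in some direction \<open>e\<close>, of a
  Lipschitz function on the hyperplane orthogonal to \<open>e\<close>.\<close>

definition lipschitz_domain :: "'a::euclidean_space set \<Rightarrow> bool" where
  "lipschitz_domain \<Omega> \<longleftrightarrow>
     open \<Omega> \<and> connected \<Omega> \<and> \<Omega> \<noteq> {} \<and>
     (\<forall>p\<in>frontier \<Omega>. \<exists>r>0. \<exists>e. norm e = 1 \<and>
        (\<exists>\<gamma>. (\<exists>L. L-lipschitz_on {y. y \<bullet> e = 0} \<gamma>) \<and>
             \<Omega> \<inter> ball p r = {x \<in> ball p r. \<gamma> (x - (x \<bullet> e) *\<^sub>R e) < x \<bullet> e}))"

definition polyhedral :: "'a::euclidean_space set \<Rightarrow> bool" where
  "polyhedral \<Omega> \<longleftrightarrow> (\<exists>\<P>. finite \<P> \<and> (\<forall>P\<in>\<P>. polytope P) \<and> closure \<Omega> = \<Union>\<P>)"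

definition conforming_triangulation :: "'a::euclidean_space set \<Rightarrow> 'a set set \<Rightarrow> bool" where
  "conforming_triangulation \<Omega> \<T> \<longleftrightarrow>
     triangulation \<T> \<and> (\<forall>T\<in>\<T>. int DIM('a) simplex T) \<and> closure \<Omega> = \<Union>\<T>"

definition inball_diameter :: "'a::euclidean_space set \<Rightarrow> real" where
  "inball_diameter T = Sup {2 * r |r. 0 \<le> r \<and> (\<exists>x. cball x r \<subseteq> T)}"

definition shape_regular_family :: "'a::euclidean_space set \<Rightarrow> 'a set set set \<Rightarrow> bool" where
  "shape_regular_family \<Omega> \<F> \<longleftrightarrow>
     (\<forall>\<T>\<in>\<F>. conforming_triangulation \<Omega> \<T>) \<and>
     (\<exists>\<kappa>>0. \<forall>\<T>\<in>\<F>. \<forall>T\<in>\<T>. diameter T \<le> \<kappa> * inball_diameter T)"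

definition sides :: "'a::euclidean_space set set \<Rightarrow> 'a set set" where
  "sides \<T> = {S. \<exists>T\<in>\<T>. S facet_of T}"

definition boundary_sides :: "'a::euclidean_space set \<Rightarrow> 'a set set \<Rightarrow> 'a set set" where
  "boundary_sides \<Omega> \<T> = {S \<in> sides \<T>. S \<subseteq> frontier \<Omega>}"

definition interior_sides :: "'a::euclidean_space set \<Rightarrow> 'a set set \<Rightarrow> 'a set set" where
  "interior_sides \<Omega> \<T> = sides \<T> - boundary_sides \<Omega> \<T>"

definition barycenter :: "'a::euclidean_space set \<Rightarrow> 'a" where
  "barycenter S = (\<Sum>p | p extreme_point_of S. p) /\<^sub>R real (card {p. p extreme_point_of S})"

definition mesh_size :: "'a::euclidean_space set set \<Rightarrow> 'a \<Rightarrow> real" where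
  "mesh_size \<T> x = (\<Sum>T\<in>\<T>. diameter T * indicator (interior T) x)"

text \<open>An element-wise function is prescribed on the interiors of the elements only; its values on
  the skeleton are irrelevant.\<close>

definition element_interiors :: "'a::euclidean_space set set \<Rightarrow> 'a set" where
  "element_interiors \<T> = (\<Union>T\<in>\<T>. interior T)"

definition P0 :: "'a::euclidean_space set set \<Rightarrow> ('a \<Rightarrow> 'b::euclidean_space) set" where
  "P0 \<T> = {v. \<forall>T\<in>\<T>. \<exists>c. \<forall>x\<in>interior T. v x = c}"

definition P1 :: "'a::euclidean_space set set \<Rightarrow> ('a \<Rightarrow> real) set" where
  "P1 \<T> = {v. \<forall>T\<in>\<T>. \<exists>a c. \<forall>x\<in>interior T. v x = a \<bullet> x + c}"

definition L2_proj ::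
    "'a::euclidean_space set \<Rightarrow> 'a set set \<Rightarrow> ('a \<Rightarrow> 'b::euclidean_space) \<Rightarrow> 'a \<Rightarrow> 'b" where
  "L2_proj \<Omega> \<T> v =
     (SOME w. w \<in> P0 \<T> \<and> (\<forall>q\<in>P0 \<T>. L2_inner \<Omega> (\<lambda>x. v x - w x) q = 0))"

definition broken_grad :: "'a::euclidean_space set set \<Rightarrow> ('a \<Rightarrow> real) \<Rightarrow> 'a \<Rightarrow> 'a" where
  "broken_grad \<T> v x = (if x \<in> element_interiors \<T> then grad v x else 0)"

text \<open>Since values on the skeleton are irrelevant, continuity at the barycenter of a side means that
  the limit taken within the interiors of the elements exists, and the value there is this limit.\<close>

definition CR\<^sub>D :: "'a::euclidean_space set \<Rightarrow> 'a set \<Rightarrow> 'a set set \<Rightarrow> ('a \<Rightarrow> real) set" where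
  "CR\<^sub>D \<Omega> \<Gamma>\<^sub>D \<T> =
     {v \<in> P1 \<T>.
        (\<forall>S\<in>interior_sides \<Omega> \<T>. \<exists>l. (v \<longlongrightarrow> l) (at (barycenter S) within element_interiors \<T>)) \<and>
        (\<forall>S\<in>sides \<T>. S \<subseteq> \<Gamma>\<^sub>D \<longrightarrow> (v \<longlongrightarrow> 0) (at (barycenter S) within element_interiors \<T>))}"

definition proj_CR\<^sub>D :: "'a::euclidean_space set \<Rightarrow> 'a set \<Rightarrow> 'a set set \<Rightarrow> ('a \<Rightarrow> real) set" where
  "proj_CR\<^sub>D \<Omega> \<Gamma>\<^sub>D \<T> =
     {w. \<exists>v\<in>CR\<^sub>D \<Omega> \<Gamma>\<^sub>D \<T>. AE x in lebesgue_on \<Omega>. w x = L2_proj \<Omega> \<T> v x}"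

definition admissible ::
    "'a::euclidean_space set \<Rightarrow> 'a set \<Rightarrow> ('a \<Rightarrow> real) \<Rightarrow> ('a \<Rightarrow> real) set" where
  "admissible \<Omega> \<Gamma>\<^sub>D chi = {v \<in> H1\<^sub>D \<Omega> \<Gamma>\<^sub>D. AE x in lebesgue_on \<Omega>. chi x \<le> v x}"

definition energy :: "'a::euclidean_space set \<Rightarrow> ('a \<Rightarrow> real) \<Rightarrow> ('a \<Rightarrow> real) \<Rightarrow> real" where
  "energy \<Omega> f v = 1/2 * (L2_norm \<Omega> (weak_grad \<Omega> v))\<^sup>2 - L2_inner \<Omega> f v"

definition admissible_cr ::
    "'a::euclidean_space set \<Rightarrow> 'a set \<Rightarrow> 'a set set \<Rightarrow> ('a \<Rightarrow> real) \<Rightarrow> ('a \<Rightarrow> real) set" where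
  "admissible_cr \<Omega> \<Gamma>\<^sub>D \<T> chi\<^sub>h =
     {v \<in> CR\<^sub>D \<Omega> \<Gamma>\<^sub>D \<T>. AE x in lebesgue_on \<Omega>. chi\<^sub>h x \<le> L2_proj \<Omega> \<T> v x}"

definition energy_cr ::
    "'a::euclidean_space set \<Rightarrow> 'a set set \<Rightarrow> ('a \<Rightarrow> real) \<Rightarrow> ('a \<Rightarrow> real) \<Rightarrow> real" where
  "energy_cr \<Omega> \<T> f\<^sub>h v =
     1/2 * (L2_norm \<Omega> (broken_grad \<T> v))\<^sup>2 - L2_inner \<Omega> f\<^sub>h (L2_proj \<Omega> \<T> v)"

definition discrete_flux ::
    "'a::euclidean_space set \<Rightarrow> 'a set set \<Rightarrow> ('a \<Rightarrow> real) \<Rightarrow> ('a \<Rightarrow> real) \<Rightarrow> ('a \<Rightarrow> real) \<Rightarrow> 'a \<Rightarrow> 'a" where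
  "discrete_flux \<Omega> \<T> f\<^sub>h u\<^sub>h lam\<^sub>h x =
     broken_grad \<T> u\<^sub>h x + ((lam\<^sub>h x - f\<^sub>h x) / real DIM('a)) *\<^sub>R (x - L2_proj \<Omega> \<T> (\<lambda>y. y) x)"

definition eta_A_sq ::
    "'a::euclidean_space set \<Rightarrow> 'a set set \<Rightarrow> ('a \<Rightarrow> real) \<Rightarrow> ('a \<Rightarrow> real) \<Rightarrow> real" where
  "eta_A_sq \<Omega> \<T> u\<^sub>h v = (L2_norm \<Omega> (\<lambda>x. weak_grad \<Omega> v x - broken_grad \<T> u\<^sub>h x))\<^sup>2"

definition eta_B_sq ::
    "'a::euclidean_space set \<Rightarrow> 'a set set \<Rightarrow> ('a \<Rightarrow> real) \<Rightarrow> ('a \<Rightarrow> real) \<Rightarrow> ('a \<Rightarrow> real) \<Rightarrow> real" where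
  "eta_B_sq \<Omega> \<T> chi lam\<^sub>h v = L2_inner \<Omega> (\<lambda>x. - lam\<^sub>h x) (L2_proj \<Omega> \<T> (\<lambda>x. v x - chi x))"

definition eta_C_sq ::
    "'a::euclidean_space set \<Rightarrow> 'a set set \<Rightarrow> ('a \<Rightarrow> real) \<Rightarrow> ('a \<Rightarrow> real) \<Rightarrow> real" where
  "eta_C_sq \<Omega> \<T> f\<^sub>h lam\<^sub>h =
     1 / (real DIM('a))\<^sup>2 * (L2_norm \<Omega> (\<lambda>x. mesh_size \<T> x * (f\<^sub>h x - lam\<^sub>h x)))\<^sup>2"

end

theory Submission
  imports Defs
begin

text \<open>Let \<open>d\<close> be the dimension, \<open>\<lambda>\<close> the discrete multiplier and \<open>z\<^sub>h\<close> the discrete flux. Everything rests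
  on Green's formula for the flux, \<open>(z\<^sub>h, \<nabla>w) = (f\<^sub>h - \<lambda>, w)\<close> for all \<open>w \<in> H\<^sup>1\<^sub>D(\<Omega>)\<close> (lemma
  \<open>flux_Green\<close>). Given it, expanding \<open>\<nabla>v - z\<^sub>h = (\<nabla>v - \<nabla>u) - (z\<^sub>h - \<nabla>u)\<close> and inserting the definition of
  \<open>\<Lambda>\<close> shows that the right side minus the left side of the first inequality is \<open>(\<lambda>, \<chi> - u)\<close>, which is
  nonnegative because \<open>\<lambda> \<le> 0\<close> and \<open>u \<ge> \<chi>\<close>. The second inequality holds because \<open>z\<^sub>h\<close> differs from
  \<open>\<nabla>\<^sub>hu\<^sub>h\<close> on an element \<open>T\<close> by \<open>(\<lambda> - f\<^sub>h)/d\<close> times \<open>x - x\<^sub>T\<close>, where \<open>x\<^sub>T\<close> is the centroid, and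
  \<open>|x - x\<^sub>T| \<le> h\<^sub>T\<close>; it remains to use \<open>|a - b|\<^sup>2 \<le> 2 |a|\<^sup>2 + 2 |b|\<^sup>2\<close>.

  Green's formula is proved without surface integrals. The mean of a smooth \<open>\<phi>\<close> over the side of \<open>T\<close>
  opposite the vertex \<open>p\<close> is encoded as the mean over \<open>T\<close> of \<open>\<phi>\<close> composed with the radial projection from
  \<open>p\<close> onto that side (\<open>side_mean\<close>), and scaling about \<open>p\<close> shows that it equals the mean of
  \<open>\<phi> + \<nabla>\<phi> \<bullet> (x - p) / d\<close> over \<open>T\<close> (\<open>integral_proj\<close>). Three consequences are needed.
  The affine function with gradient the mean of \<open>\<nabla>\<phi>\<close> and with value the mean of
  \<open>\<phi> + \<nabla>\<phi> \<bullet> (x - x\<^sub>T) / d\<close> at \<open>x\<^sub>T\<close> takes the side means as its values at the barycenters of the sides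
  (\<open>affine_interpolant_at_barycenter\<close>). The two elements at an interior side give the same side mean
  (\<open>side_mean_adjacent\<close>), because an affine map that fixes the side and maps one opposite vertex to the other
  commutes with the projections. And a side mean is controlled by the norm of \<open>\<phi>\<close> in \<open>L\<^sup>2\<close> of the side with
  respect to Hausdorff measure (\<open>side_mean_tendsto_0\<close>), because the volume of the cone over a subset of the
  side is at most a constant times the Hausdorff measure of the subset.

  Consequently the affine functions above, corrected on the Dirichlet sides, form a Crouzeix--Raviart
  function. Testing the discrete equation with it gives Green's formula for smooth \<open>\<phi>\<close> up to a combination of
  side means over Dirichlet sides, and this combination vanishes in the limit along a sequence of smooth
  functions that converges to \<open>w\<close> together with gradients and traces.

  The weak gradient is a chosen representative. That \<open>H\<^sup>1\<^sub>D(\<Omega>)\<close> is closed under negation, and hence that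
  \<open>\<Lambda>(v - u) = \<Lambda>(v) - \<Lambda>(u)\<close>, therefore depends on the uniqueness of weak gradients almost everywhere, that is,
  on the fundamental lemma of the calculus of variations (\<open>fundamental_lemma_box\<close>).\<close>

section \<open>Smooth bump functions\<close>

lemma C_k_const: "C_k k (\<lambda>x::'a::euclidean_space. c)"
proof (induction k arbitrary: c)
  case (Suc k)
  have "partial_deriv b (\<lambda>x::'a. c) = (\<lambda>x. 0)" for b
    by (auto simp: partial_deriv_def)
  then show ?case using Suc by simp
qed simp

lemma C_k_mono: "C_k (Suc k) v \<Longrightarrow> C_k k v"
proof (induction k arbitrary: v)
  case 0
  then show ?case by (simp add: differentiable_imp_continuous_on)
next
  case (Suc k)
  then show ?case by (metis C_k.simps(2))
qed

lemma frechet_derivative_at_UNIV: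
  "v differentiable_on UNIV \<Longrightarrow> (v has_derivative frechet_derivative v (at x)) (at x)"
  by (simp add: differentiable_on_def frechet_derivative_works[symmetric])

lemma partial_deriv_eqI: "(v has_derivative D) (at x) \<Longrightarrow> partial_deriv b v x = D b"
  by (metis frechet_derivative_at partial_deriv_def)

lemma C_k_add: "C_k k v \<Longrightarrow> C_k k w \<Longrightarrow> C_k k (\<lambda>x. v x + w x)"
proof (induction k arbitrary: v w)
  case 0
  then show ?case by (auto intro: continuous_intros)
next
  case (Suc k)
  then have d: "v differentiable_on UNIV" "w differentiable_on UNIV" by auto
  have "partial_deriv b (\<lambda>x. v x + w x) = (\<lambda>x. partial_deriv b v x + partial_deriv b w x)" for b
    by (rule ext, rule partial_deriv_eqI[THEN trans])
      (rule has_derivative_add[OF frechet_derivative_at_UNIV[OF d(1)] frechet_derivative_at_UNIV[OF d(2)]],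
       simp add: partial_deriv_def)
  then show ?case using Suc d by auto
qed

lemma C_k_mult: "C_k k v \<Longrightarrow> C_k k w \<Longrightarrow> C_k k (\<lambda>x. v x * w x)"
proof (induction k arbitrary: v w)
  case 0
  then show ?case by (auto intro: continuous_intros)
next
  case (Suc k)
  then have d: "v differentiable_on UNIV" "w differentiable_on UNIV" by auto
  have "partial_deriv b (\<lambda>x. v x * w x) = (\<lambda>x. v x * partial_deriv b w x + partial_deriv b v x * w x)" for b
    by (rule ext, rule partial_deriv_eqI[THEN trans])
      (rule has_derivative_mult[OF frechet_derivative_at_UNIV[OF d(1)] frechet_derivative_at_UNIV[OF d(2)]],
       simp add: partial_deriv_def)
  moreover have "(\<lambda>x. v x * w x) differentiable_on UNIV"
    using d by (auto simp: differentiable_on_def)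
  ultimately show ?case using Suc C_k_mono[OF Suc.prems(1)] C_k_mono[OF Suc.prems(2)]
    by (auto intro!: C_k_add)
qed

lemma C_k_prod: "finite I \<Longrightarrow> (\<And>i. i \<in> I \<Longrightarrow> C_k k (v i)) \<Longrightarrow> C_k k (\<lambda>x. \<Prod>i\<in>I. v i x)"
  by (induction I rule: finite_induct) (auto intro: C_k_const C_k_mult)

lemma C_infinity_uminus:
  assumes "v \<in> C_infinity" shows "(\<lambda>x. - v x) \<in> C_infinity"
  using C_k_mult[OF C_k_const[of _ "-1"]] assms unfolding C_infinity_def by fastforce

text \<open>These functions include \<open>exp (- 1 / t)\<close>, extended by zero, and the derivative of each is a
  combination of two others, so that all of them are smooth.\<close>

definition flat_exp :: "nat \<Rightarrow> real \<Rightarrow> real" where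
  "flat_exp m t = (if t > 0 then exp (- inverse t) * inverse t ^ m else 0)"

lemma flat_exp_tendsto_0: "(flat_exp m \<longlongrightarrow> 0) (at 0)"
proof -
  have "((\<lambda>t. inverse t ^ m / exp (inverse t)) \<longlongrightarrow> 0) (at_right (0::real))"
    by (rule filterlim_compose[OF tendsto_power_div_exp_0 filterlim_inverse_at_top_right])
  then have "(flat_exp m \<longlongrightarrow> 0) (at_right 0)"
    by (rule Lim_transform_eventually)
      (auto simp: eventually_at_filter flat_exp_def exp_minus field_simps)
  moreover have "(flat_exp m \<longlongrightarrow> 0) (at_left 0)"
    by (rule Lim_transform_eventually[OF tendsto_const])
      (auto simp: eventually_at_filter flat_exp_def)
  ultimately show ?thesis
    using filterlim_split_at_real by blast
qed

lemma flat_exp_derivative: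
  "(flat_exp m has_real_derivative flat_exp (m + 2) t - real m * flat_exp (Suc m) t) (at t)"
proof -
  consider "t > 0" | "t < 0" | "t = 0" by linarith
  then show ?thesis
  proof cases
    case 1
    have "((\<lambda>t. exp (- inverse t) * inverse t ^ m) has_real_derivative
        flat_exp (m + 2) t - real m * flat_exp (Suc m) t) (at t)"
      using 1 by (auto intro!: derivative_eq_intros simp: flat_exp_def) (cases m; auto simp: field_simps power2_eq_square)
    then show ?thesis
      by (rule DERIV_cong_ev[OF refl _ refl, THEN iffD2, rotated])
        (use 1 in \<open>auto simp: flat_exp_def eventually_nhds intro!: exI[of _ "{0<..}"]\<close>)
  next
    case 2
    have "((\<lambda>t. 0) has_real_derivative
        flat_exp (m + 2) t - real m * flat_exp (Suc m) t) (at t)"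
      using 2 by (auto simp: flat_exp_def)
    then show ?thesis
      by (rule DERIV_cong_ev[OF refl _ refl, THEN iffD2, rotated])
        (use 2 in \<open>auto simp: flat_exp_def eventually_nhds intro!: exI[of _ "{..<0}"]\<close>)
  next
    case 3
    have "((\<lambda>h. (flat_exp m (0 + h) - flat_exp m 0) / h) \<longlongrightarrow> 0) (at 0)"
      using flat_exp_tendsto_0[of "Suc m"]
      by (rule Lim_transform_eventually) (auto simp: eventually_at_filter flat_exp_def field_simps)
    then have "(flat_exp m has_real_derivative 0) (at 0)"
      by (simp add: DERIV_def)
    with 3 show ?thesis by (simp add: flat_exp_def)
  qed
qed

text \<open>The induction goes through because the family of functions \<open>flat_exp m\<close> is closed under
  differentiation.\<close>

lemma C_k_flat_exp:
  fixes e :: "'a::euclidean_space"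
  shows "C_k k (\<lambda>x. flat_exp m (x \<bullet> e + c))"
proof (induction k arbitrary: m)
  case 0
  have "continuous_on UNIV (flat_exp m)"
    using DERIV_isCont[OF flat_exp_derivative] continuous_at_imp_continuous_on by blast
  then have "continuous_on UNIV (\<lambda>x::'a. flat_exp m (x \<bullet> e + c))"
    by (rule continuous_on_compose2) (intro continuous_intros, simp)
  then show ?case by simp
next
  case (Suc k)
  let ?D = "\<lambda>x. flat_exp (m + 2) (x \<bullet> e + c) + (- real m) * flat_exp (Suc m) (x \<bullet> e + c)"
  have 1: "((\<lambda>x. flat_exp m (x \<bullet> e + c)) has_derivative (\<lambda>h. ?D x * (h \<bullet> e))) (at x)" for x
  proof -
    have "((\<lambda>x. x \<bullet> e + c) has_derivative (\<lambda>h. h \<bullet> e)) (at x)"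
      by (auto intro!: derivative_eq_intros)
    from has_derivative_compose[OF this flat_exp_derivative[of m "x \<bullet> e + c", unfolded has_field_derivative_def]]
    show ?thesis by simp
  qed
  have "partial_deriv b (\<lambda>x. flat_exp m (x \<bullet> e + c)) = (\<lambda>x. ?D x * (b \<bullet> e))" for b
    using partial_deriv_eqI[OF 1] by blast
  moreover have "C_k k (\<lambda>x. ?D x * (b \<bullet> e))" for b
    by (intro C_k_mult C_k_add C_k_const Suc)
  moreover have "(\<lambda>x. flat_exp m (x \<bullet> e + c)) differentiable_on UNIV"
    using 1 by (auto simp: differentiable_on_def differentiable_def)
  ultimately show ?case by simp
qed

text \<open>Since \<open>flat_exp 0 (n t)\<close> increases to the indicator of \<open>t > 0\<close>, these smooth functions converge to
  the indicator of the open box. The factor \<open>Suc n\<close> keeps the argument from degenerating at \<open>n = 0\<close>.\<close>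

definition bump :: "'a::euclidean_space \<Rightarrow> 'a \<Rightarrow> nat \<Rightarrow> 'a \<Rightarrow> real" where
  "bump a b n x = (\<Prod>e\<in>Basis. flat_exp 0 (x \<bullet> (real (Suc n) *\<^sub>R e) + (- real (Suc n) * (a \<bullet> e)))
      * flat_exp 0 (x \<bullet> (- real (Suc n) *\<^sub>R e) + real (Suc n) * (b \<bullet> e)))"

lemma flat_exp_0_bounds: "0 \<le> flat_exp 0 t" "flat_exp 0 t \<le> 1"
  by (auto simp: flat_exp_def)

lemma bump_bounds: "0 \<le> bump a b n x" "bump a b n x \<le> 1"
  by (auto simp: bump_def intro!: prod_nonneg prod_le_1 mult_le_one flat_exp_0_bounds mult_nonneg_nonneg)

lemma bump_support:
  assumes "bump a b n x \<noteq> 0" shows "x \<in> box a b"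
proof -
  have "a \<bullet> e < x \<bullet> e \<and> x \<bullet> e < b \<bullet> e" if "e \<in> Basis" for e
  proof -
    have p: "real (Suc n) > 0" by simp
    have "flat_exp 0 (x \<bullet> (real (Suc n) *\<^sub>R e) + (- real (Suc n) * (a \<bullet> e)))
      * flat_exp 0 (x \<bullet> (- real (Suc n) *\<^sub>R e) + real (Suc n) * (b \<bullet> e)) \<noteq> 0"
      using assms that by (auto simp: bump_def)
    then have "real (Suc n) * (x \<bullet> e - a \<bullet> e) > 0" "real (Suc n) * (b \<bullet> e - x \<bullet> e) > 0"
      by (auto simp: flat_exp_def algebra_simps split: if_splits)
    with p show ?thesis by (simp add: zero_less_mult_iff)
  qed
  then show ?thesis by (simp add: mem_box)
qed

lemma bump_tendsto_indicator: "(\<lambda>n. bump a b n x) \<longlonglongrightarrow> indicator (box a b) x"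
proof (cases "x \<in> box a b")
  case True
  have f: "(\<lambda>n. flat_exp 0 (real (Suc n) * s)) \<longlonglongrightarrow> 1" if "s > 0" for s
  proof -
    have "(\<lambda>n. exp (- (inverse (real (Suc n)) * inverse s))) \<longlonglongrightarrow> exp (- (0 * inverse s))"
      by (intro tendsto_intros LIMSEQ_inverse_real_of_nat)
    moreover have "flat_exp 0 (real (Suc n) * s) = exp (- (inverse (real (Suc n)) * inverse s))" for n
      using that by (simp add: flat_exp_def)
    ultimately show ?thesis by simp
  qed
  have "(\<lambda>n. bump a b n x) \<longlonglongrightarrow> (\<Prod>e\<in>(Basis::'a set). 1 * 1)"
    unfolding bump_def
  proof (rule tendsto_prod, rule tendsto_mult)
    fix e :: 'a assume "e \<in> Basis"
    then have "x \<bullet> e - a \<bullet> e > 0" "b \<bullet> e - x \<bullet> e > 0" using True by (auto simp: mem_box)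
    from f[OF this(1)] f[OF this(2)]
    show "(\<lambda>n. flat_exp 0 (x \<bullet> (real (Suc n) *\<^sub>R e) + (- real (Suc n) * (a \<bullet> e)))) \<longlonglongrightarrow> 1"
      "(\<lambda>n. flat_exp 0 (x \<bullet> (- real (Suc n) *\<^sub>R e) + real (Suc n) * (b \<bullet> e))) \<longlonglongrightarrow> 1"
      by (simp_all only: inner_scaleR_right right_diff_distrib) (simp_all add: algebra_simps)
  qed
  then show ?thesis using True by simp
next
  case False
  then have "bump a b n x = 0" for n using bump_support by blast
  then show ?thesis using False by simp
qed

lemma bump_test_function:
  assumes "cbox a b \<subseteq> \<Omega>"
  shows "bump a b n \<in> test_functions \<Omega>"
proof -
  have "bump a b n \<in> C_infinity"
    unfolding C_infinity_def bump_def
    by (intro CollectI allI C_k_prod C_k_mult C_k_flat_exp finite_Basis)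
  moreover have "closure {x. bump a b n x \<noteq> 0} \<subseteq> cbox a b"
    using bump_support[of a b n] box_subset_cbox[of a b] by (intro closure_minimal) auto
  ultimately show ?thesis unfolding test_functions_def
    using assms compact_Int_closed[OF compact_cbox[of a b] closed_closure[of "{x. bump a b n x \<noteq> 0}"]]
    by (simp add: Int_absorb1)
qed

section \<open>The fundamental lemma of the calculus of variations\<close>

text \<open>The positive and the negative part of \<open>k\<close> are densities of two measures that agree on the
  intersection-stable generator of all open boxes, hence everywhere, and densities
  with respect to Lebesgue measure are unique almost everywhere.\<close>

lemma zero_box_integrals_AE_zero:
  fixes k :: "'a::euclidean_space \<Rightarrow> real"
  assumes k: "integrable lborel k"
    and zero: "\<And>a b. (LINT x|lborel. indicator (box a b) x * k x) = 0"
  shows "AE x in lborel. k x = 0"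
proof -
  have m[measurable]: "k \<in> borel_measurable borel" using k by auto
  define P N where "P = density lborel (\<lambda>x. ennreal (k x))" and "N = density lborel (\<lambda>x. ennreal (- k x))"
  have fin: "(\<integral>\<^sup>+x. ennreal \<bar>k x\<bar> \<partial>lborel) < \<infinity>"
    using k by (simp add: integrable_iff_bounded)
  have box: "emeasure P (box a b) = emeasure N (box a b) \<and> emeasure P (box a b) \<noteq> \<infinity>" for a b
  proof -
    let ?f = "\<lambda>x. indicator (box a b) x * k x"
    have i: "integrable lborel ?f"
      using integrable_mult_indicator[OF _ k, of "box a b"] by simp
    have "ennreal (k x) * indicator (box a b) x = ennreal (?f x)"
      "ennreal (- k x) * indicator (box a b) x = ennreal (- ?f x)" for x
      by (auto split: split_indicator)
    then have PN: "emeasure P (box a b) = (\<integral>\<^sup>+x. ennreal (?f x) \<partial>lborel)"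
      "emeasure N (box a b) = (\<integral>\<^sup>+x. ennreal (- ?f x) \<partial>lborel)"
      by (simp_all add: P_def N_def emeasure_density)
    have f: "(\<integral>\<^sup>+x. ennreal (?f x) \<partial>lborel) < \<infinity>" "(\<integral>\<^sup>+x. ennreal (- ?f x) \<partial>lborel) < \<infinity>"
      by (rule le_less_trans[OF nn_integral_mono fin]; auto split: split_indicator intro!: ennreal_leI)+
    have e: "enn2real (\<integral>\<^sup>+x. ennreal (?f x) \<partial>lborel) = enn2real (\<integral>\<^sup>+x. ennreal (- ?f x) \<partial>lborel)"
      using real_lebesgue_integral_def[OF i] zero[of a b] by simp
    have "(\<integral>\<^sup>+x. ennreal (?f x) \<partial>lborel) = ennreal (enn2real (\<integral>\<^sup>+x. ennreal (?f x) \<partial>lborel))"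
      by (rule ennreal_enn2real[symmetric]) (use f in simp)
    also have "\<dots> = (\<integral>\<^sup>+x. ennreal (- ?f x) \<partial>lborel)"
      unfolding e by (rule ennreal_enn2real) (use f in simp)
    finally have "emeasure P (box a b) = emeasure N (box a b)" unfolding PN .
    moreover have "emeasure P (box a b) \<noteq> \<infinity>" unfolding PN(1) using f(1) by (rule less_imp_neq)
    ultimately show ?thesis by (rule conjI)
  qed
  have "P = N"
  proof (rule measure_eqI_generator_eq[where \<Omega>=UNIV and E="range (\<lambda>(a, b). box a b)"
        and A="\<lambda>n. box (- (real n *\<^sub>R One)) (real n *\<^sub>R One)"])
    show "Int_stable (range (\<lambda>(a, b). box a b :: 'a set))"
      by (auto simp: Int_stable_def box_Int_box)
    show "sets P = sigma_sets UNIV (range (\<lambda>(a, b). box a b))"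
      "sets N = sigma_sets UNIV (range (\<lambda>(a, b). box a b))"
      by (simp_all add: P_def N_def borel_eq_box)
    show "(\<Union>n. box (- (real n *\<^sub>R One)) (real n *\<^sub>R One)) = (UNIV::'a set)"
      unfolding UN_box_eq_UNIV by auto
  next
    show "emeasure P (box (- (real n *\<^sub>R One)) (real n *\<^sub>R One)) \<noteq> \<infinity>" for n
      using box by blast
  qed (use box in auto)
  then have "AE x in lborel. ennreal (k x) = ennreal (- k x)"
    unfolding P_def N_def
    by (intro sigma_finite_measure.density_unique[OF lborel.sigma_finite_measure_axioms]) simp_all
  then show ?thesis
  proof eventually_elim
    case (elim x)
    then show ?case by (cases "k x > 0"; cases "k x < 0") (auto simp: ennreal_neg ennreal_eq_0_iff)
  qed
qed

text \<open>Localize to one box in \<open>\<Omega>\<close>: its intersection with any other box is again a box in \<open>\<Omega>\<close>. Countably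
  many boxes exhaust \<open>\<Omega>\<close>.\<close>

lemma fundamental_lemma_box:
  fixes h :: "'a::euclidean_space \<Rightarrow> real"
  assumes "open \<Omega>" and h: "integrable (lebesgue_on \<Omega>) h"
    and zero: "\<And>a b. cbox a b \<subseteq> \<Omega> \<Longrightarrow> (LINT x|lebesgue_on \<Omega>. indicator (box a b) x * h x) = 0"
  shows "AE x in lebesgue_on \<Omega>. h x = 0"
proof -
  have [measurable]: "\<Omega> \<in> sets borel" "\<Omega> \<in> sets lebesgue" using \<open>open \<Omega>\<close> by auto
  have i: "integrable lebesgue (\<lambda>x. indicator \<Omega> x * h x)"
    using h by (simp add: integrable_restrict_space)
  then obtain g where [measurable]: "g \<in> borel_measurable borel"
    and "AE x in lborel. indicator \<Omega> x * h x = g x"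
    using completion_ex_borel_measurable_real[of "\<lambda>x. indicator \<Omega> x * h x" lborel] by auto
  then have g: "AE x in lebesgue. indicator \<Omega> x * h x = g x" by (intro AE_completion)
  have "integrable lebesgue g"
    by (rule integrable_cong_AE_imp[OF i _ g]) (intro measurable_completion, simp)
  then have ig: "integrable lborel g" by (simp add: integrable_completion)
  have box: "AE x in lebesgue. x \<in> box c d \<longrightarrow> g x = 0" if cd: "cbox c d \<subseteq> \<Omega>" for c d
  proof -
    have "AE x in lborel. indicator (box c d) x * g x = 0"
    proof (rule zero_box_integrals_AE_zero)
      show "integrable lborel (\<lambda>x. indicator (box c d) x * g x)"
        using integrable_mult_indicator[OF _ ig, of "box c d"] by simp
      fix a b
      obtain a' b' where ab: "box a b \<inter> box c d = box a' b'" and sub: "cbox a' b' \<subseteq> \<Omega>"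
      proof (cases "box a b \<inter> box c d = {}")
        case True
        have "box One 0 = ({}::'a set)" "cbox One 0 = ({}::'a set)"
          using SOME_Basis[where 'a='a] by (auto simp: box_eq_empty)
        with True that[of One 0] show ?thesis by auto
      next
        case False
        obtain a' b' where ab: "box a b \<inter> box c d = box a' b'" by (simp add: box_Int_box)
        then have "box a' b' \<noteq> {}" "box a' b' \<subseteq> cbox c d"
          using False box_subset_cbox[of c d] by auto
        then have "cbox a' b' \<subseteq> cbox c d"
          by (metis closed_cbox closure_box closure_minimal)
        with ab cd that show ?thesis by blast
      qed
      have "(LINT x|lborel. indicator (box a b) x * (indicator (box c d) x * g x))
        = (LINT x|lborel. indicator (box a' b') x * g x)"
        unfolding ab[symmetric] by (simp add: indicator_inter_arith mult.assoc)
      also have "\<dots> = (LINT x|lebesgue. indicator (box a' b') x * g x)"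
        by (simp add: integral_completion)
      also have "\<dots> = (LINT x|lebesgue. indicator \<Omega> x * (indicator (box a' b') x * h x))"
      proof (rule integral_cong_AE)
        show "(\<lambda>x. indicator (box a' b') x * g x) \<in> borel_measurable lebesgue"
          by (intro measurable_completion) simp
        have "(\<lambda>x. indicator (box a' b') x * (indicator \<Omega> x * h x)) \<in> borel_measurable lebesgue"
          by (intro borel_measurable_times borel_measurable_integrable[OF i] measurable_completion) simp
        then show "(\<lambda>x. indicator \<Omega> x * (indicator (box a' b') x * h x)) \<in> borel_measurable lebesgue"
          by (simp add: mult.left_commute)
        show "AE x in lebesgue. indicator (box a' b') x * g x = indicator \<Omega> x * (indicator (box a' b') x * h x)"
          using g by eventually_elim (simp add: mult.left_commute)
      qed
      also have "\<dots> = 0" using zero[OF sub] by (simp add: integral_restrict_space)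
      finally show "(LINT x|lborel. indicator (box a b) x * (indicator (box c d) x * g x)) = 0" .
    qed
    then have "AE x in lebesgue. indicator (box c d) x * g x = 0" by (rule AE_completion)
    then show ?thesis by eventually_elim (auto split: split_indicator_asm)
  qed
  obtain \<D> where D: "countable \<D>" "\<And>X. X \<in> \<D> \<Longrightarrow> X \<subseteq> \<Omega>" "\<And>X. X \<in> \<D> \<Longrightarrow> \<exists>a b. X = cbox a b" "\<Union>\<D> = \<Omega>"
    using open_countable_Union_open_cbox[OF \<open>open \<Omega>\<close>] by (metis Pow_iff subsetD)
  have "AE x in lebesgue. x \<in> X \<longrightarrow> g x = 0" if X: "X \<in> \<D>" for X
  proof -
    obtain c d where c: "X = cbox c d" using D X by blast
    have "cbox c d - box c d \<in> null_sets lebesgue"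
      using negligible_frontier_interval[of c d] negligible_iff_null_sets by blast
    from AE_not_in[OF this] box[of c d] show ?thesis using D(2)[OF X] unfolding c
      by (auto elim: eventually_elim2)
  qed
  then have "AE x in lebesgue. \<forall>X\<in>\<D>. x \<in> X \<longrightarrow> g x = 0"
    by (subst AE_ball_countable[OF D(1)]) blast
  with g have "AE x in lebesgue. x \<in> \<Omega> \<longrightarrow> h x = 0"
    by eventually_elim (use D(4) in \<open>auto split: split_indicator_asm\<close>)
  then show ?thesis by (simp add: AE_restrict_space_iff)
qed

section \<open>Square-integrable functions\<close>

lemma L2_inner_integrable:
  assumes "v \<in> L2 \<Omega>" "w \<in> L2 \<Omega>"
  shows "integrable (lebesgue_on \<Omega>) (\<lambda>x. v x \<bullet> w x)"
proof (rule Bochner_Integration.integrable_bound)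
  show "integrable (lebesgue_on \<Omega>) (\<lambda>x. (norm (v x))\<^sup>2 + (norm (w x))\<^sup>2)"
    using assms by (auto simp: L2_def)
  show "(\<lambda>x. v x \<bullet> w x) \<in> borel_measurable (lebesgue_on \<Omega>)"
    using assms by (auto simp: L2_def)
  have "\<bar>a \<bullet> b\<bar> \<le> (norm a)\<^sup>2 + (norm b)\<^sup>2" for a b :: 'b
  proof -
    have "\<bar>a \<bullet> b\<bar> \<le> norm a * norm b" by (rule Cauchy_Schwarz_ineq2)
    also have "\<dots> \<le> (norm a)\<^sup>2 + (norm b)\<^sup>2"
      using sum_squares_bound[of "norm a" "norm b"]
        mult_nonneg_nonneg[OF norm_ge_zero[of a] norm_ge_zero[of b]] by linarith
    finally show ?thesis .
  qed
  then show "AE x in lebesgue_on \<Omega>. norm (v x \<bullet> w x) \<le> norm ((norm (v x))\<^sup>2 + (norm (w x))\<^sup>2)"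
    by simp
qed

lemma L2_add:
  assumes "v \<in> L2 \<Omega>" "w \<in> L2 \<Omega>" shows "(\<lambda>x. v x + w x) \<in> L2 \<Omega>"
proof -
  have "integrable (lebesgue_on \<Omega>) (\<lambda>x. (norm (v x))\<^sup>2 + (norm (w x))\<^sup>2 + 2 * (v x \<bullet> w x))"
    using assms L2_inner_integrable[OF assms] by (auto simp: L2_def)
  then show ?thesis using assms
    by (auto simp: L2_def power2_norm_eq_inner inner_add inner_commute algebra_simps)
qed

lemma L2_scaleR: "v \<in> L2 \<Omega> \<Longrightarrow> (\<lambda>x. c *\<^sub>R v x) \<in> L2 \<Omega>"
  by (auto simp: L2_def power_mult_distrib)

lemma L2_uminus: "v \<in> L2 \<Omega> \<Longrightarrow> (\<lambda>x. - v x) \<in> L2 \<Omega>"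
  using L2_scaleR[of v \<Omega> "-1"] by simp

lemma L2_diff: "v \<in> L2 \<Omega> \<Longrightarrow> w \<in> L2 \<Omega> \<Longrightarrow> (\<lambda>x. v x - w x) \<in> L2 \<Omega>"
  using L2_add[OF _ L2_uminus] by fastforce

lemma L2_bounded:
  fixes v :: "'a::euclidean_space \<Rightarrow> 'b::euclidean_space"
  assumes "\<Omega> \<in> lmeasurable" "v \<in> borel_measurable (lebesgue_on \<Omega>)"
    and "AE x in lebesgue_on \<Omega>. norm (v x) \<le> B"
  shows "v \<in> L2 \<Omega>"
proof -
  interpret finite_measure "lebesgue_on \<Omega>" by (rule finite_measure_lebesgue_on) fact
  have "AE x in lebesgue_on \<Omega>. norm ((norm (v x))\<^sup>2) \<le> B\<^sup>2"
    using assms(3) by eventually_elim (simp add: power_mono)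
  then have "integrable (lebesgue_on \<Omega>) (\<lambda>x. (norm (v x))\<^sup>2)"
    using assms(2) by (intro integrable_const_bound) auto
  then show ?thesis using assms(2) by (simp add: L2_def)
qed

lemma L2_const: "\<Omega> \<in> lmeasurable \<Longrightarrow> (\<lambda>x. c) \<in> L2 \<Omega>"
  by (rule L2_bounded[where B="norm c"]) auto

lemma continuous_bounded_on_compact:
  fixes f :: "'a::topological_space \<Rightarrow> 'b::real_normed_vector"
  assumes "compact T" "continuous_on UNIV f"
  obtains B where "\<And>x. x \<in> T \<Longrightarrow> norm (f x) \<le> B"
proof -
  have "bounded (f ` T)"
    using assms by (intro compact_imp_bounded compact_continuous_image) (auto intro: continuous_on_subset)
  then show ?thesis using that by (auto simp: bounded_iff)
qed

lemma L2_continuous: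
  fixes v :: "'a::euclidean_space \<Rightarrow> 'b::euclidean_space"
  assumes "bounded \<Omega>" "\<Omega> \<in> sets lebesgue" "continuous_on UNIV v"
  shows "v \<in> L2 \<Omega>"
proof -
  obtain B where "\<And>x. x \<in> closure \<Omega> \<Longrightarrow> norm (v x) \<le> B"
    using continuous_bounded_on_compact[of "closure \<Omega>" v] assms by (auto simp: compact_closure)
  then have "\<And>x. x \<in> \<Omega> \<Longrightarrow> norm (v x) \<le> B" using closure_subset[of \<Omega>] by blast
  moreover have "v \<in> borel_measurable (lebesgue_on \<Omega>)"
    using assms by (intro continuous_imp_measurable_on_sets_lebesgue) (auto intro: continuous_on_subset)
  moreover have "\<Omega> \<in> lmeasurable" using assms(1,2) by (rule bounded_set_imp_lmeasurable)
  ultimately show ?thesis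
    by (intro L2_bounded[where B=B] AE_I2) simp_all
qed

lemma L2_integrable:
  assumes "\<Omega> \<in> lmeasurable" "v \<in> L2 \<Omega>" shows "integrable (lebesgue_on \<Omega>) v"
proof -
  interpret finite_measure "lebesgue_on \<Omega>" by (rule finite_measure_lebesgue_on) fact
  show ?thesis
  proof (rule Bochner_Integration.integrable_bound)
    show "integrable (lebesgue_on \<Omega>) (\<lambda>x. 1 + (norm (v x))\<^sup>2)"
      using assms by (auto simp: L2_def)
    have "norm a \<le> 1 + (norm a)\<^sup>2" for a :: 'b
      using sum_squares_bound[of 1 "norm a"] norm_ge_zero[of a] by (simp only: power2_eq_square mult_1 mult_1_right)
    then show "AE x in lebesgue_on \<Omega>. norm (v x) \<le> norm (1 + (norm (v x))\<^sup>2)"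
      by (simp add: abs_of_nonneg)
  qed (use assms in \<open>simp add: L2_def\<close>)
qed

lemma L2_inner_cong_AE:
  assumes "AE x in lebesgue_on \<Omega>. v x \<bullet> w x = v' x \<bullet> w' x"
    and "v \<in> L2 \<Omega>" "w \<in> L2 \<Omega>" "v' \<in> L2 \<Omega>" "w' \<in> L2 \<Omega>"
  shows "L2_inner \<Omega> v w = L2_inner \<Omega> v' w'"
  unfolding L2_inner_def using assms
  by (intro integral_cong_AE borel_measurable_integrable L2_inner_integrable)

lemma L2_inner_commute: "L2_inner \<Omega> v w = L2_inner \<Omega> w v"
  by (simp add: L2_inner_def inner_commute)

lemma L2_inner_diff_right:
  assumes "v \<in> L2 \<Omega>" "w \<in> L2 \<Omega>" "w' \<in> L2 \<Omega>"
  shows "L2_inner \<Omega> v (\<lambda>x. w x - w' x) = L2_inner \<Omega> v w - L2_inner \<Omega> v w'"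
  using assms by (simp add: L2_inner_def inner_diff_right L2_inner_integrable)

lemma L2_inner_diff_left:
  assumes "v \<in> L2 \<Omega>" "w \<in> L2 \<Omega>" "w' \<in> L2 \<Omega>"
  shows "L2_inner \<Omega> (\<lambda>x. w x - w' x) v = L2_inner \<Omega> w v - L2_inner \<Omega> w' v"
  using L2_inner_diff_right[OF assms] by (simp add: L2_inner_commute)

lemma L2_inner_scaleR_right: "L2_inner \<Omega> v (\<lambda>x. c *\<^sub>R w x) = c * L2_inner \<Omega> v w"
  by (simp add: L2_inner_def)

lemma L2_inner_self_nonneg: "0 \<le> L2_inner \<Omega> v v"
  by (simp add: L2_inner_def)

lemma L2_norm_sq: "(L2_norm \<Omega> v)\<^sup>2 = L2_inner \<Omega> v v"
  by (simp add: L2_norm_def L2_inner_self_nonneg)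

text \<open>The usual discriminant argument for the nonnegative quadratic polynomial \<open>t \<mapsto> \<parallel>w - t v\<parallel>\<^sup>2\<close>.\<close>

lemma L2_inner_Cauchy_Schwarz:
  assumes "v \<in> L2 \<Omega>" "w \<in> L2 \<Omega>"
  shows "(L2_inner \<Omega> v w)\<^sup>2 \<le> L2_inner \<Omega> v v * L2_inner \<Omega> w w"
proof -
  have *: "0 \<le> L2_inner \<Omega> v v * t\<^sup>2 - 2 * L2_inner \<Omega> v w * t + L2_inner \<Omega> w w" for t
  proof -
    have "0 \<le> L2_inner \<Omega> (\<lambda>x. w x - t *\<^sub>R v x) (\<lambda>x. w x - t *\<^sub>R v x)"
      by (rule L2_inner_self_nonneg)
    also have "\<dots> = L2_inner \<Omega> v v * t\<^sup>2 - 2 * L2_inner \<Omega> v w * t + L2_inner \<Omega> w w"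
      using assms by (simp add: L2_inner_diff_left L2_inner_diff_right L2_diff L2_scaleR
          L2_inner_scaleR_right L2_inner_commute[of _ "\<lambda>x. t *\<^sub>R v x"] L2_inner_commute[of _ w v]
          power2_eq_square algebra_simps)
    finally show ?thesis .
  qed
  show ?thesis
  proof (cases "L2_inner \<Omega> v v = 0")
    case True
    have "L2_inner \<Omega> v w = 0"
    proof (rule ccontr)
      assume n: "L2_inner \<Omega> v w \<noteq> 0"
      from *[of "(L2_inner \<Omega> w w + 1) / (2 * L2_inner \<Omega> v w)"] True n show False
        by simp
    qed
    with True show ?thesis by simp
  next
    case False
    then have p: "L2_inner \<Omega> v v > 0" using L2_inner_self_nonneg[of \<Omega> v] by simp
    from *[of "L2_inner \<Omega> v w / L2_inner \<Omega> v v"] p show ?thesis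
      by (simp add: field_simps power2_eq_square)
  qed
qed

lemma L2_inner_tendsto:
  assumes k: "k \<in> L2 \<Omega>" and v: "v \<in> L2 \<Omega>" and \<phi>: "\<And>n. \<phi> n \<in> L2 \<Omega>"
    and lim: "L2_tendsto (lebesgue_on \<Omega>) \<phi> v"
  shows "(\<lambda>n. L2_inner \<Omega> k (\<phi> n)) \<longlonglongrightarrow> L2_inner \<Omega> k v"
proof -
  let ?d = "\<lambda>n x. \<phi> n x - v x"
  have d: "?d n \<in> L2 \<Omega>" for n by (intro L2_diff \<phi> v)
  have "(\<integral>\<^sup>+x. ennreal ((norm (?d n x))\<^sup>2) \<partial>lebesgue_on \<Omega>) = ennreal (L2_inner \<Omega> (?d n) (?d n))" for n
    using d[of n] by (simp add: L2_inner_def power2_norm_eq_inner[symmetric] nn_integral_eq_integral L2_def)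
  then have "(\<lambda>n. ennreal (L2_inner \<Omega> (?d n) (?d n))) \<longlonglongrightarrow> ennreal 0"
    using lim by (simp add: L2_tendsto_def)
  then have "(\<lambda>n. L2_inner \<Omega> (?d n) (?d n)) \<longlonglongrightarrow> 0"
    by (subst (asm) tendsto_ennreal_iff) (auto simp: L2_inner_self_nonneg)
  then have "(\<lambda>n. L2_inner \<Omega> k k * L2_inner \<Omega> (?d n) (?d n)) \<longlonglongrightarrow> 0"
    by (rule tendsto_mult_right_zero)
  then have "(\<lambda>n. (L2_inner \<Omega> k (?d n))\<^sup>2) \<longlonglongrightarrow> 0"
    by (rule tendsto_sandwich[rotated 2, OF tendsto_const])
      (auto intro!: always_eventually L2_inner_Cauchy_Schwarz k d)
  then have "(\<lambda>n. L2_inner \<Omega> k (?d n)) \<longlonglongrightarrow> 0"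
    using tendsto_real_sqrt[of "\<lambda>n. (L2_inner \<Omega> k (?d n))\<^sup>2" 0] by (simp add: tendsto_rabs_zero_iff)
  then show ?thesis
    by (simp add: L2_inner_diff_right k v \<phi> LIM_zero_iff)
qed

section \<open>Uniqueness of weak gradients\<close>

text \<open>Testing with the bump functions of a box and passing to the limit under the integral shows that the
  difference of two weak gradients has integral zero over every box.\<close>

lemma weak_gradient_AE_unique:
  fixes g g' :: "'a::euclidean_space \<Rightarrow> 'a"
  assumes "open \<Omega>" "bounded \<Omega>" and g: "g \<in> L2 \<Omega>" "g' \<in> L2 \<Omega>"
    and wg: "has_weak_gradient \<Omega> v g" "has_weak_gradient \<Omega> v g'"
  shows "AE x in lebesgue_on \<Omega>. g x = g' x"
proof -
  have \<Omega>: "\<Omega> \<in> sets lebesgue" "\<Omega> \<in> lmeasurable"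
    using assms(1,2) lmeasurable_open by auto
  have "AE x in lebesgue_on \<Omega>. (g x - g' x) \<bullet> b = 0" if b: "b \<in> Basis" for b
  proof (rule fundamental_lemma_box[OF \<open>open \<Omega>\<close>])
    let ?h = "\<lambda>x. (g x - g' x) \<bullet> b"
    show i: "integrable (lebesgue_on \<Omega>) ?h"
      by (intro integrable_inner_left L2_integrable \<Omega> L2_diff g)
    fix c d :: 'a assume cd: "cbox c d \<subseteq> \<Omega>"
    have "(LINT x|lebesgue_on \<Omega>. bump c d n x * ?h x) = 0" for n
    proof -
      have t: "bump c d n \<in> test_functions \<Omega>" by (rule bump_test_function[OF cd])
      then have bL2: "bump c d n \<in> L2 \<Omega>"
        using assms \<Omega> by (intro L2_continuous) (auto simp: test_functions_def C_infinity_def dest: spec[of _ 0])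
      have "L2_inner \<Omega> (\<lambda>x. g x \<bullet> b) (bump c d n) = L2_inner \<Omega> (\<lambda>x. g' x \<bullet> b) (bump c d n)"
        using wg t b unfolding has_weak_gradient_def by (metis neg_equal_iff_equal)
      moreover have "L2_inner \<Omega> (\<lambda>x. f x \<bullet> b) (bump c d n) = L2_inner \<Omega> f (\<lambda>x. bump c d n x *\<^sub>R b)"
        for f by (simp add: L2_inner_def mult.commute)
      moreover have "(\<lambda>x. bump c d n x *\<^sub>R b) \<in> L2 \<Omega>"
        using bL2 by (auto simp: L2_def power_mult_distrib)
      ultimately have "L2_inner \<Omega> (\<lambda>x. g x - g' x) (\<lambda>x. bump c d n x *\<^sub>R b) = 0"
        using g by (simp add: L2_inner_diff_left)
      then show ?thesis by (simp add: L2_inner_def)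
    qed
    moreover have "(\<lambda>n. LINT x|lebesgue_on \<Omega>. bump c d n x * ?h x)
      \<longlonglongrightarrow> (LINT x|lebesgue_on \<Omega>. indicator (box c d) x * ?h x)"
    proof (rule integral_dominated_convergence[where w="\<lambda>x. \<bar>?h x\<bar>"])
      have [measurable]: "?h \<in> borel_measurable (lebesgue_on \<Omega>)" using i by blast
      have "C_k 0 (bump c d n)" for n
        using bump_test_function[OF cd, of n] by (simp add: test_functions_def C_infinity_def del: C_k.simps)
      then have "bump c d n \<in> borel_measurable (lebesgue_on \<Omega>)" for n
        using \<Omega> by (intro continuous_imp_measurable_on_sets_lebesgue) (auto intro: continuous_on_subset)
      then show "(\<lambda>x. bump c d n x * ?h x) \<in> borel_measurable (lebesgue_on \<Omega>)" for n
        by measurable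
      have "indicat_real (box c d) \<in> borel_measurable (lebesgue_on \<Omega>)"
        by (intro measurable_restrict_space1 measurable_completion) simp
      then show "(\<lambda>x. indicator (box c d) x * ?h x) \<in> borel_measurable (lebesgue_on \<Omega>)"
        by measurable
      show "AE x in lebesgue_on \<Omega>. (\<lambda>n. bump c d n x * ?h x) \<longlonglongrightarrow> indicator (box c d) x * ?h x"
        by (intro AE_I2 tendsto_mult bump_tendsto_indicator tendsto_const)
      show "AE x in lebesgue_on \<Omega>. norm (bump c d n x * ?h x) \<le> \<bar>?h x\<bar>" for n
        using bump_bounds[of c d n] by (auto simp: abs_mult intro!: mult_left_le_one_le)
    qed (use i in simp)
    ultimately show "(LINT x|lebesgue_on \<Omega>. indicator (box c d) x * ?h x) = 0"
      by (simp add: LIMSEQ_const_iff)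
  qed
  then have "AE x in lebesgue_on \<Omega>. \<forall>b\<in>Basis. (g x - g' x) \<bullet> b = 0"
    by (subst AE_ball_countable[OF countable_finite[OF finite_Basis]]) blast
  then show ?thesis
    by eventually_elim (auto intro: euclidean_eqI simp: inner_diff_left)
qed

lemma weak_grad_works:
  assumes "v \<in> H1 \<Omega>"
  shows "weak_grad \<Omega> v \<in> L2 \<Omega>" "has_weak_gradient \<Omega> v (weak_grad \<Omega> v)"
  using assms someI_ex[of "\<lambda>g. g \<in> L2 \<Omega> \<and> has_weak_gradient \<Omega> v g"]
  by (auto simp: H1_def weak_grad_def)

text \<open>The trace of \<open>-v\<close> involves the chosen weak gradient of \<open>-v\<close>; by uniqueness it is minus that of \<open>v\<close>.\<close>

lemma H1\<^sub>D_uminus: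
  assumes "open \<Omega>" "bounded \<Omega>" "v \<in> H1\<^sub>D \<Omega> \<Gamma>"
  shows "(\<lambda>x. - v x) \<in> H1\<^sub>D \<Omega> \<Gamma>"
proof -
  from assms(3) obtain g where vH: "v \<in> H1 \<Omega>" and tr: "has_trace \<Omega> v g"
    and g0: "AE x in surface_measure \<Omega>. x \<in> \<Gamma> \<longrightarrow> g x = 0"
    by (auto simp: H1\<^sub>D_def)
  let ?G = "weak_grad \<Omega> v"
  have vL: "v \<in> L2 \<Omega>" using vH by (simp add: H1_def)
  have wg: "has_weak_gradient \<Omega> (\<lambda>x. - v x) (\<lambda>x. - ?G x)"
    using weak_grad_works(2)[OF vH] by (simp add: has_weak_gradient_def L2_inner_def)
  have H: "(\<lambda>x. - v x) \<in> H1 \<Omega>"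
    unfolding H1_def using L2_uminus[OF vL] L2_uminus[OF weak_grad_works(1)[OF vH]] wg by blast
  have ae: "AE x in lebesgue_on \<Omega>. weak_grad \<Omega> (\<lambda>x. - v x) x = - ?G x"
    by (rule weak_gradient_AE_unique[OF assms(1,2) weak_grad_works(1)[OF H] L2_uminus[OF weak_grad_works(1)[OF vH]]
          weak_grad_works(2)[OF H] wg])
  from tr obtain \<phi> where \<phi>: "\<And>n. \<phi> n \<in> C_infinity" "L2_tendsto (lebesgue_on \<Omega>) \<phi> v"
    "L2_tendsto (lebesgue_on \<Omega>) (\<lambda>n. grad (\<phi> n)) ?G" "L2_tendsto (surface_measure \<Omega>) \<phi> g"
    by (auto simp: has_trace_def)
  let ?\<psi> = "\<lambda>n x. - \<phi> n x"
  have gr: "grad (?\<psi> n) = (\<lambda>x. - grad (\<phi> n) x)" for n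
  proof
    fix x
    have "\<phi> n differentiable_on UNIV"
      using \<phi>(1)[of n] C_k.simps(2)[of 0 "\<phi> n"] unfolding C_infinity_def by blast
    from partial_deriv_eqI[OF has_derivative_minus[OF frechet_derivative_at_UNIV[OF this]]]
    have "partial_deriv b (?\<psi> n) x = - partial_deriv b (\<phi> n) x" for b
      by (simp add: partial_deriv_def)
    then show "grad (?\<psi> n) x = - grad (\<phi> n) x"
      by (simp add: grad_def sum_negf)
  qed
  have nm: "norm (- a - - b) = norm (a - b)" for a b :: 'a
    by (simp add: norm_minus_commute[of b a])
  have "L2_tendsto (lebesgue_on \<Omega>) (\<lambda>n. grad (?\<psi> n)) (weak_grad \<Omega> (\<lambda>x. - v x))"
  proof -
    have "(\<integral>\<^sup>+x. ennreal ((norm (grad (?\<psi> n) x - weak_grad \<Omega> (\<lambda>x. - v x) x))\<^sup>2) \<partial>lebesgue_on \<Omega>)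
      = (\<integral>\<^sup>+x. ennreal ((norm (grad (\<phi> n) x - ?G x))\<^sup>2) \<partial>lebesgue_on \<Omega>)" for n
      unfolding gr by (rule nn_integral_cong_AE, use ae in eventually_elim) (simp only: nm)
    then show ?thesis using \<phi>(3) by (simp add: L2_tendsto_def)
  qed
  moreover have "L2_tendsto (lebesgue_on \<Omega>) ?\<psi> (\<lambda>x. - v x)" "L2_tendsto (surface_measure \<Omega>) ?\<psi> (\<lambda>x. - g x)"
    using \<phi>(2,4) by (simp_all add: L2_tendsto_def power2_commute)
  ultimately have "has_trace \<Omega> (\<lambda>x. - v x) (\<lambda>x. - g x)"
    using tr C_infinity_uminus[OF \<phi>(1)] unfolding has_trace_def
    by (intro conjI exI[of _ ?\<psi>]) simp_all
  with H g0 show ?thesis unfolding H1\<^sub>D_def by fastforce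
qed

text \<open>Additivity of \<open>\<Lambda>\<close> is only available for two members of \<open>H\<^sup>1\<^sub>D(\<Omega>)\<close>, so \<open>-w\<close> has to be one.\<close>

lemma dual_H1\<^sub>D_diff:
  assumes "open \<Omega>" "bounded \<Omega>" "\<Lambda> \<in> dual_H1\<^sub>D \<Omega> \<Gamma>" "v \<in> H1\<^sub>D \<Omega> \<Gamma>" "w \<in> H1\<^sub>D \<Omega> \<Gamma>"
  shows "\<Lambda> (\<lambda>x. v x - w x) = \<Lambda> v - \<Lambda> w"
proof -
  have "\<Lambda> (\<lambda>x. v x + (- w x)) = \<Lambda> v + \<Lambda> (\<lambda>x. - w x)"
  proof -
    have "\<forall>v\<in>H1\<^sub>D \<Omega> \<Gamma>. \<forall>w\<in>H1\<^sub>D \<Omega> \<Gamma>. \<Lambda> (\<lambda>x. v x + w x) = \<Lambda> v + \<Lambda> w"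
      using assms(3) by (simp add: dual_H1\<^sub>D_def)
    from bspec[OF bspec[OF this assms(4)] H1\<^sub>D_uminus[OF assms(1,2,5)]] show ?thesis .
  qed
  moreover have "\<Lambda> (\<lambda>x. (- 1) * w x) = (- 1) * \<Lambda> w"
  proof -
    have "\<forall>v\<in>H1\<^sub>D \<Omega> \<Gamma>. \<forall>c. \<Lambda> (\<lambda>x. c * v x) = c * \<Lambda> v"
      using assms(3) by (simp add: dual_H1\<^sub>D_def)
    from spec[OF bspec[OF this assms(5)], of "- 1"] show ?thesis .
  qed
  ultimately show ?thesis by simp
qed

section \<open>Cones and their radial projection\<close>

lemma integral_lebesgue_on_borel:
  fixes f :: "'a::euclidean_space \<Rightarrow> 'b::euclidean_space"
  assumes "T \<in> sets borel" "f \<in> borel_measurable borel"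
  shows "(LINT x|lebesgue_on T. f x) = (LINT x|lborel. indicator T x *\<^sub>R f x)"
  using assms by (simp add: integral_restrict_space integral_completion)

lemma integrable_lebesgue_on_bounded:
  fixes f :: "'a::euclidean_space \<Rightarrow> 'b::euclidean_space"
  assumes "T \<in> lmeasurable" "f \<in> borel_measurable borel" "\<And>x. x \<in> T \<Longrightarrow> norm (f x) \<le> B"
  shows "integrable (lebesgue_on T) f"
proof -
  interpret finite_measure "lebesgue_on T" by (rule finite_measure_lebesgue_on) fact
  show ?thesis
    using assms by (intro integrable_const_bound[where B=B] AE_I2 measurable_restrict_space1
        measurable_completion) auto
qed

lemma integrable_continuous_compact:
  fixes f :: "'a::euclidean_space \<Rightarrow> 'b::euclidean_space"
  assumes "compact T" "continuous_on UNIV f"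
  shows "integrable (lebesgue_on T) f"
proof -
  obtain B where "\<And>x. x \<in> T \<Longrightarrow> norm (f x) \<le> B" using continuous_bounded_on_compact[OF assms] by blast
  then show ?thesis
    using assms by (intro integrable_lebesgue_on_bounded[where B=B] borel_measurable_continuous_onI)
      (auto simp: lmeasurable_compact)
qed

lemma integral_lborel_affine:
  fixes f :: "'a::euclidean_space \<Rightarrow> real"
  assumes "f \<in> borel_measurable borel" "t > 0"
  shows "(LINT x|lborel. f x) = t ^ DIM('a) * (LINT x|lborel. f (p + t *\<^sub>R (x - p)))"
proof -
  have "(LINT x|lborel. f x) = (LINT x|density (distr lborel borel (\<lambda>x. (p - t *\<^sub>R p) + t *\<^sub>R x)) (\<lambda>_. ennreal (\<bar>t\<bar> ^ DIM('a))). f x)"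
    using lborel_affine[of t "p - t *\<^sub>R p"] assms(2) by simp
  also have "\<dots> = t ^ DIM('a) * (LINT x|lborel. f ((p - t *\<^sub>R p) + t *\<^sub>R x))"
    using assms by (simp add: integral_density integral_distr)
  also have "(\<lambda>x. (p - t *\<^sub>R p) + t *\<^sub>R x) = (\<lambda>x. p + t *\<^sub>R (x - p))"
    by (simp add: algebra_simps)
  finally show ?thesis by (simp add: algebra_simps)
qed

text \<open>A cone with apex \<open>p\<close> whose base lies in the hyperplane \<open>\<beta> \<bullet> (x - p) = 1\<close>.\<close>

locale cone =
  fixes T :: "'a::euclidean_space set" and p \<beta> :: 'a
  assumes compact: "compact T" and convex: "convex T" and apex: "p \<in> T"
    and height_pos: "\<And>x. x \<in> T \<Longrightarrow> x \<noteq> p \<Longrightarrow> 0 < \<beta> \<bullet> (x - p)"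
    and height_le: "\<And>x. x \<in> T \<Longrightarrow> \<beta> \<bullet> (x - p) \<le> 1"
    and base: "\<And>x. x \<in> T \<Longrightarrow> x \<noteq> p \<Longrightarrow> p + (x - p) /\<^sub>R (\<beta> \<bullet> (x - p)) \<in> T"
begin

definition height :: "'a \<Rightarrow> real" where "height x = \<beta> \<bullet> (x - p)"
definition proj :: "'a \<Rightarrow> 'a" where "proj x = p + (x - p) /\<^sub>R height x"

lemma borel_T [measurable]: "T \<in> sets borel" using compact by (simp add: borel_compact)
lemma T_lmeasurable: "T \<in> lmeasurable" using compact by (rule lmeasurable_compact)

lemma height_measurable [measurable]: "height \<in> borel_measurable borel"
  unfolding height_def by simp

lemma proj_measurable [measurable]: "proj \<in> borel_measurable borel"
  unfolding proj_def by measurable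

lemma height_apex [simp]: "height p = 0" by (simp add: height_def)
lemma proj_apex [simp]: "proj p = p" by (simp add: proj_def)

lemma proj_in: "x \<in> T \<Longrightarrow> proj x \<in> T"
  using base[of x] apex by (cases "x = p") (auto simp: proj_def height_def)

lemma height_scaled: "height (p + t *\<^sub>R (x - p)) = t * height x"
  by (simp add: height_def)

lemma proj_scaled: "t \<noteq> 0 \<Longrightarrow> proj (p + t *\<^sub>R (x - p)) = proj x"
  by (simp add: proj_def height_scaled)

lemma height_proj: "x \<in> T \<Longrightarrow> x \<noteq> p \<Longrightarrow> height (proj x) = 1"
  using height_pos[of x] by (simp add: proj_def height_def)

lemma point_eq_proj: "x \<in> T \<Longrightarrow> x = p + height x *\<^sub>R (proj x - p)"
  using height_pos[of x] by (cases "x = p") (auto simp: proj_def height_def)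

lemma height_bounds: "x \<in> T \<Longrightarrow> 0 \<le> height x" "x \<in> T \<Longrightarrow> height x \<le> 1"
  using height_pos[of x] height_le[of x] by (cases "x = p"; simp add: height_def)+

lemma scaled_in_iff:
  assumes "0 < t" "t \<le> 1"
  shows "p + t *\<^sub>R (x - p) \<in> T \<and> height (p + t *\<^sub>R (x - p)) \<le> t \<longleftrightarrow> x \<in> T"
proof
  assume x: "x \<in> T"
  have "(1 - t) *\<^sub>R p + t *\<^sub>R x \<in> T"
    using convex apex x assms by (intro convexD) auto
  then have "p + t *\<^sub>R (x - p) \<in> T" by (simp add: algebra_simps)
  moreover have "t * height x \<le> t" using height_bounds[OF x] assms by (intro mult_right_le_one_le) auto
  ultimately show "p + t *\<^sub>R (x - p) \<in> T \<and> height (p + t *\<^sub>R (x - p)) \<le> t" by (simp add: height_scaled)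
next
  let ?y = "p + t *\<^sub>R (x - p)"
  assume "?y \<in> T \<and> height ?y \<le> t"
  then have y: "?y \<in> T" "height ?y \<le> t" by auto
  have h: "height x \<le> 1" using y(2) assms by (simp add: height_scaled)
  have "height x \<ge> 0" using height_bounds(1)[OF y(1)] assms by (simp add: height_scaled zero_le_mult_iff)
  have "proj x \<in> T" using proj_in[OF y(1)] assms by (simp add: proj_scaled)
  then have "(1 - height x) *\<^sub>R p + height x *\<^sub>R proj x \<in> T"
    using convex apex h \<open>height x \<ge> 0\<close> by (intro convexD) auto
  moreover have "x = (1 - height x) *\<^sub>R p + height x *\<^sub>R proj x"
  proof (cases "x = p")
    case False
    then have "?y \<noteq> p" using assms by simp
    then have "height ?y > 0" using height_pos[OF y(1)] by (simp add: height_def)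
    then have "height x \<noteq> 0" by (auto simp: height_scaled)
    then show ?thesis by (simp add: proj_def algebra_simps)
  qed simp
  ultimately show "x \<in> T" by simp
qed

lemma integral_scaled:
  assumes [measurable]: "f \<in> borel_measurable borel" and "0 < t" "t \<le> 1"
  shows "t ^ DIM('a) * (LINT x|lebesgue_on T. f (p + t *\<^sub>R (x - p)))
    = (LINT x|lebesgue_on T. indicator {x. height x \<le> t} x * f x :: real)"
proof -
  let ?F = "\<lambda>x. indicator T x * (indicator {x. height x \<le> t} x * f x)"
  have F: "?F (p + t *\<^sub>R (x - p)) = indicator T x * f (p + t *\<^sub>R (x - p))" for x
    using scaled_in_iff[OF assms(2,3), of x] by (auto split: split_indicator)
  have "(LINT x|lborel. ?F x) = t ^ DIM('a) * (LINT x|lborel. ?F (p + t *\<^sub>R (x - p)))"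
    by (rule integral_lborel_affine) (use assms in auto)
  then show ?thesis
    unfolding F by (simp add: integral_lebesgue_on_borel)
qed

text \<open>Write \<open>T\<^sub>t\<close> for the points of height at most \<open>t\<close>, the image of \<open>T\<close> under scaling by \<open>t\<close>
  about the apex. Scaling turns the integral of \<open>\<phi>\<close> over the shell \<open>T - T\<^sub>t\<close> into a difference of integrals over
  \<open>T\<close>, and as \<open>t\<close> tends to \<open>1\<close> its quotient by \<open>1 - t\<close> tends to the left-hand side. The function
  \<open>\<phi> \<circ> proj\<close> is constant on rays, so the corresponding quotient is \<open>(1 - t\<^sup>d) / (1 - t)\<close> times its integral
  over \<open>T\<close>, which tends to the right-hand side. In the shell a point is at distance \<open>O(1 - t)\<close> from its
  projection and the shell has volume \<open>O(1 - t)\<close>, so the difference of the two quotients is \<open>O(1 - t)\<close>.\<close>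

lemma integral_proj:
  fixes \<phi> :: "'a \<Rightarrow> real" and G :: "'a \<Rightarrow> 'a"
  assumes der: "\<And>x. (\<phi> has_derivative (\<lambda>h. G x \<bullet> h)) (at x)" and G: "continuous_on UNIV G"
  shows "(LINT x|lebesgue_on T. real DIM('a) * \<phi> x + G x \<bullet> (x - p))
    = real DIM('a) * (LINT x|lebesgue_on T. \<phi> (proj x))"
proof -
  let ?d = "real DIM('a)" and ?I = "\<lambda>f. LINT x|lebesgue_on T. f x :: real"
  interpret finite_measure "lebesgue_on T" by (rule finite_measure_lebesgue_on) (rule T_lmeasurable)
  have c\<phi>: "continuous_on UNIV \<phi>"
    by (intro continuous_at_imp_continuous_on ballI has_derivative_continuous[OF der])
  have [measurable]: "\<phi> \<in> borel_measurable borel" "G \<in> borel_measurable borel"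
    using c\<phi> G by (auto intro: borel_measurable_continuous_onI)
  obtain B where B: "\<And>x. x \<in> T \<Longrightarrow> norm (G x) \<le> B" using continuous_bounded_on_compact[OF compact G] by blast
  have B0: "0 \<le> B" using B[OF apex] norm_ge_zero[of "G p"] by linarith
  obtain D where D: "\<And>x. x \<in> T \<Longrightarrow> norm (x - p) \<le> D"
  proof -
    have "norm (x - p) \<le> diameter T" if "x \<in> T" for x
      using diameter_bounded_bound[OF compact_imp_bounded[OF compact] that apex] by (simp add: dist_norm)
    then show ?thesis using that by blast
  qed
  have D0: "0 \<le> D" using D[OF apex] by simp
  have lip: "\<bar>\<phi> x - \<phi> y\<bar> \<le> B * norm (x - y)" if "x \<in> T" "y \<in> T" for x y
  proof -
    have "norm (\<phi> x - \<phi> y) \<le> B * norm (x - y)"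
    proof (rule differentiable_bound[OF convex _ _ that])
      show "(\<phi> has_derivative (\<lambda>h. G z \<bullet> h)) (at z within T)" for z
        using der has_derivative_at_withinI by blast
      show "onorm (\<lambda>h. G z \<bullet> h) \<le> B" if "z \<in> T" for z
      proof (rule onorm_le)
        show "norm (G z \<bullet> h) \<le> B * norm h" for h
          using Cauchy_Schwarz_ineq2[of "G z" h] mult_right_mono[OF B[OF that] norm_ge_zero[of h]] by simp
      qed
    qed
    then show ?thesis by simp
  qed
  have i\<phi>: "integrable (lebesgue_on T) \<phi>"
    using integrable_continuous_compact[OF compact c\<phi>] .
  obtain M where M: "\<And>x. x \<in> T \<Longrightarrow> \<bar>\<phi> x\<bar> \<le> M" using continuous_bounded_on_compact[OF compact c\<phi>] by auto
  have i\<pi>: "integrable (lebesgue_on T) (\<lambda>x. \<phi> (proj x))"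
    using M proj_in by (intro integrable_lebesgue_on_bounded[where B=M] T_lmeasurable) auto
  define J where "J = ?I (\<lambda>x. \<phi> (proj x))"
  \<comment> \<open>\<open>1 - s n\<close> is the scaling factor; starting at \<open>1/2\<close> keeps it positive.\<close>
  define s where "s n = inverse (real (Suc (Suc n)))" for n
  have s: "0 < s n" "s n < 1" "s n \<noteq> 0" for n
    by (auto simp: s_def inverse_less_1_iff)
  have s0: "s \<longlonglongrightarrow> 0"
    unfolding s_def using LIMSEQ_Suc[OF LIMSEQ_inverse_real_of_nat] by simp
  define S where "S n x = p + (1 - s n) *\<^sub>R (x - p)" for n x
  have [measurable]: "S n \<in> borel_measurable borel" for n unfolding S_def by measurable
  have S_in: "S n x \<in> T" if "x \<in> T" for n x
    using scaled_in_iff[of "1 - s n" x] s[of n] that by (simp add: S_def)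
  have S_diff: "x - S n x = s n *\<^sub>R (x - p)" for n x by (simp add: S_def algebra_simps)
  have iS: "integrable (lebesgue_on T) (\<lambda>x. \<phi> (S n x))" for n
    using M S_in by (intro integrable_lebesgue_on_bounded[where B=M] T_lmeasurable) auto
  define q where "q n = (1 - (1 - s n) ^ DIM('a)) / s n" for n
  have ev: "filterlim s (at 0) sequentially"
    using s0 s(3) by (simp add: filterlim_at)
  have q: "q \<longlonglongrightarrow> ?d"
  proof -
    have "((\<lambda>h. (1 - h) ^ DIM('a)) has_real_derivative - ?d) (at (0::real))"
      by (auto intro!: derivative_eq_intros)
    then have "((\<lambda>h. ((1 - h) ^ DIM('a) - 1) / h) \<longlongrightarrow> - ?d) (at (0::real))"
      by (simp add: DERIV_def)
    from tendsto_minus[OF filterlim_compose[OF this ev]]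
    show ?thesis by (simp add: q_def[abs_def] minus_divide_left)
  qed
  have lim1: "(\<lambda>n. ?I (\<lambda>x. (\<phi> x - \<phi> (S n x)) / s n)) \<longlonglongrightarrow> ?I (\<lambda>x. G x \<bullet> (x - p))"
  proof (rule integral_dominated_convergence[where w="\<lambda>x. B * D"])
    show "AE x in lebesgue_on T. (\<lambda>n. (\<phi> x - \<phi> (S n x)) / s n) \<longlonglongrightarrow> G x \<bullet> (x - p)"
    proof (rule AE_I2)
      fix x
      have "((\<lambda>h. x - h *\<^sub>R (x - p)) has_derivative (\<lambda>h. - (h *\<^sub>R (x - p)))) (at 0)"
        by (auto intro!: derivative_eq_intros)
      from has_derivative_compose[OF this, of \<phi> "\<lambda>h. G x \<bullet> h"]
      have "((\<lambda>h. \<phi> (x - h *\<^sub>R (x - p))) has_derivative (\<lambda>h. - (h * (G x \<bullet> (x - p))))) (at 0)"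
        using der[of x] by simp
      then have "((\<lambda>h. \<phi> (x - h *\<^sub>R (x - p))) has_real_derivative - (G x \<bullet> (x - p))) (at 0)"
        by (rule has_derivative_imp_has_field_derivative) (simp add: mult.commute)
      then have "((\<lambda>h. (\<phi> (x - h *\<^sub>R (x - p)) - \<phi> x) / h) \<longlongrightarrow> - (G x \<bullet> (x - p))) (at 0)"
        by (simp add: DERIV_def)
      from tendsto_minus[OF filterlim_compose[OF this ev]]
      have "(\<lambda>n. - ((\<phi> (x - s n *\<^sub>R (x - p)) - \<phi> x) / s n)) \<longlonglongrightarrow> G x \<bullet> (x - p)" by simp
      moreover have "- ((\<phi> (x - s n *\<^sub>R (x - p)) - \<phi> x) / s n) = (\<phi> x - \<phi> (S n x)) / s n" for n
        using S_diff[of x n] by (simp add: minus_divide_left S_def algebra_simps)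
      ultimately show "(\<lambda>n. (\<phi> x - \<phi> (S n x)) / s n) \<longlonglongrightarrow> G x \<bullet> (x - p)" by simp
    qed
    show "AE x in lebesgue_on T. norm ((\<phi> x - \<phi> (S n x)) / s n) \<le> B * D" for n
    proof (rule AE_I2)
      fix x assume "x \<in> space (lebesgue_on T)"
      then have x: "x \<in> T" by simp
      have "\<bar>\<phi> x - \<phi> (S n x)\<bar> \<le> B * (s n * norm (x - p))"
        using lip[OF x S_in[OF x, of n]] s[of n] by (simp add: S_diff)
      also have "\<dots> \<le> (B * D) * s n"
        using mult_left_mono[OF D[OF x], of "B * s n"] B0 s[of n] by (simp add: mult_ac)
      finally show "norm ((\<phi> x - \<phi> (S n x)) / s n) \<le> B * D"
        using s[of n] by (simp add: abs_divide pos_divide_le_eq)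
    qed
  qed (auto intro!: measurable_restrict_space1 measurable_completion)
  have lim2: "(\<lambda>n. ?I (\<lambda>x. \<phi> (S n x))) \<longlonglongrightarrow> ?I \<phi>"
  proof (rule integral_dominated_convergence[where w="\<lambda>x. M"])
    show "AE x in lebesgue_on T. (\<lambda>n. \<phi> (S n x)) \<longlonglongrightarrow> \<phi> x"
    proof (rule AE_I2)
      fix x
      have "(\<lambda>n. S n x) \<longlonglongrightarrow> p + (1 - 0) *\<^sub>R (x - p)"
        unfolding S_def by (intro tendsto_intros s0)
      then show "(\<lambda>n. \<phi> (S n x)) \<longlonglongrightarrow> \<phi> x"
        using c\<phi> by (intro continuous_on_tendsto_compose[OF c\<phi>]) auto
    qed
    show "AE x in lebesgue_on T. norm (\<phi> (S n x)) \<le> M" for n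
      using M S_in by (intro AE_I2) auto
  qed (auto intro!: measurable_restrict_space1 measurable_completion)
  let ?low = "\<lambda>n x. indicat_real {x. height x \<le> 1 - s n} x"
  define R where "R n = ?I \<phi> - (1 - s n) ^ DIM('a) * ?I (\<lambda>x. \<phi> (S n x)) - (1 - (1 - s n) ^ DIM('a)) * J" for n
  define Q where "Q n = ?I (\<lambda>x. (\<phi> x - \<phi> (S n x)) / s n) + q n * ?I (\<lambda>x. \<phi> (S n x)) - q n * J" for n
  \<comment> \<open>Comparison of the shell integrals of \<open>\<phi>\<close> and of \<open>\<phi> \<circ> proj\<close>.\<close>
  have err: "\<bar>R n\<bar> \<le> (B * D * measure lebesgue T) * (s n * (1 - (1 - s n) ^ DIM('a)))" for n
  proof -
    let ?D = "\<lambda>x. (\<phi> x - ?low n x * \<phi> x) - (\<phi> (proj x) - ?low n x * \<phi> (proj x))"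
    have t: "0 < 1 - s n" "1 - s n \<le> 1" using s[of n] by auto
    have ilow: "integrable (lebesgue_on T) (\<lambda>x. ?low n x * f x)"
      if "integrable (lebesgue_on T) f" for f :: "'a \<Rightarrow> real"
      using integrable_mult_indicator[OF _ that, of "{x. height x \<le> 1 - s n} \<inter> T"]
      by (rule Bochner_Integration.integrable_cong[THEN iffD1, rotated -1])
        (auto simp: sets_restrict_space image_iff split: split_indicator
          intro!: bexI[of _ "{x. height x \<le> 1 - s n}"])
    have ilow1: "integrable (lebesgue_on T) (?low n)"
      using ilow[of "\<lambda>_. 1"] by simp
    have e1: "(1 - s n) ^ DIM('a) * ?I (\<lambda>x. \<phi> (S n x)) = ?I (\<lambda>x. ?low n x * \<phi> x)"
      using integral_scaled[OF _ t, of \<phi>] by (simp add: S_def)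
    have e2: "(1 - s n) ^ DIM('a) * J = ?I (\<lambda>x. ?low n x * \<phi> (proj x))"
      using integral_scaled[OF _ t, of "\<lambda>x. \<phi> (proj x)"] t by (simp add: J_def proj_scaled)
    have e3: "(1 - s n) ^ DIM('a) * measure lebesgue T = ?I (\<lambda>x. ?low n x * 1)"
      using integral_scaled[OF _ t, of "\<lambda>x. 1"] by (simp add: measure_restrict_space)
    have "R n = (?I \<phi> - ?I (\<lambda>x. ?low n x * \<phi> x)) - (J - ?I (\<lambda>x. ?low n x * \<phi> (proj x)))"
      by (simp add: R_def e1 e2[symmetric] left_diff_distrib)
    also have "\<dots> = ?I ?D"
      using i\<phi> i\<pi> ilow[OF i\<phi>] ilow[OF i\<pi>] by (simp add: J_def)
    finally have eq: "R n = ?I ?D" .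
    have "\<bar>R n\<bar> \<le> ?I (\<lambda>x. \<bar>?D x\<bar>)"
      unfolding eq by (rule integral_abs_bound)
    also have "\<dots> \<le> ?I (\<lambda>x. (B * D * s n) * (1 - ?low n x * 1))"
    proof (rule integral_mono)
      show "integrable (lebesgue_on T) (\<lambda>x. \<bar>?D x\<bar>)"
        using i\<phi> i\<pi> ilow[OF i\<phi>] ilow[OF i\<pi>] by simp
      show "integrable (lebesgue_on T) (\<lambda>x. (B * D * s n) * (1 - ?low n x * 1))"
        using ilow1 by simp
      fix x assume "x \<in> space (lebesgue_on T)"
      then have x: "x \<in> T" by simp
      show "\<bar>?D x\<bar> \<le> (B * D * s n) * (1 - ?low n x * 1)"
      proof (cases "height x \<le> 1 - s n")
        case False
        have "x - proj x = (p + height x *\<^sub>R (proj x - p)) - proj x"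
          by (subst point_eq_proj[OF x]) simp
        also have "\<dots> = (height x - 1) *\<^sub>R (proj x - p)" by (simp add: algebra_simps)
        finally have "norm (x - proj x) = (1 - height x) * norm (proj x - p)"
          using height_bounds[OF x] by simp
        also have "\<dots> \<le> s n * D"
          using False height_bounds[OF x] D[OF proj_in[OF x]] s[of n] by (intro mult_mono) auto
        finally have "B * norm (x - proj x) \<le> B * (s n * D)" using B0 by (rule mult_left_mono)
        with lip[OF x proj_in[OF x]] False show ?thesis by (simp add: mult_ac)
      qed simp
    qed
    also have "\<dots> = (B * D * s n) * (?I (\<lambda>x. 1) - ?I (\<lambda>x. ?low n x * 1))"
      using ilow1 by simp
    also have "\<dots> = (B * D * measure lebesgue T) * (s n * (1 - (1 - s n) ^ DIM('a)))"
      unfolding e3[symmetric] by (simp add: measure_restrict_space algebra_simps)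
    finally show ?thesis .
  qed
  have E: "R n / s n = Q n" for n
    using s[of n] i\<phi> iS[of n] by (simp add: R_def Q_def q_def field_simps)
  have "Q \<longlonglongrightarrow> ?I (\<lambda>x. G x \<bullet> (x - p)) + ?d * ?I \<phi> - ?d * J"
    unfolding Q_def by (intro tendsto_intros lim1 lim2 q)
  moreover have "Q \<longlonglongrightarrow> 0"
  proof (rule tendsto_rabs_zero_cancel, rule tendsto_sandwich[OF _ _ tendsto_const])
    let ?C = "B * D * measure lebesgue T"
    show "\<forall>\<^sub>F n in sequentially. \<bar>Q n\<bar> \<le> ?C * (1 - (1 - s n) ^ DIM('a))"
    proof (intro always_eventually allI)
      show "\<bar>Q n\<bar> \<le> ?C * (1 - (1 - s n) ^ DIM('a))" for n
        unfolding E[symmetric] using err[of n] s[of n] by (simp add: abs_divide pos_divide_le_eq mult_ac)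
    qed
    have "(\<lambda>n. ?C * (1 - (1 - s n) ^ DIM('a))) \<longlonglongrightarrow> ?C * (1 - (1 - 0) ^ DIM('a))"
      by (intro tendsto_intros s0)
    then show "(\<lambda>n. ?C * (1 - (1 - s n) ^ DIM('a))) \<longlonglongrightarrow> 0" by simp
  qed auto
  ultimately have "?I (\<lambda>x. G x \<bullet> (x - p)) + ?d * ?I \<phi> - ?d * J = 0"
    using LIMSEQ_unique by blast
  moreover have "integrable (lebesgue_on T) (\<lambda>x. G x \<bullet> (x - p))"
    by (intro integrable_continuous_compact compact continuous_intros G)
  ultimately show ?thesis using i\<phi> by (simp add: J_def)
qed

end


section \<open>Cones with a common base\<close>

text \<open>Uniqueness of Lebesgue measure up to a factor: evaluate
  \<open>\<integral>\<integral> 1\<^sub>A(x) 1\<^sub>B(x + y) d\<nu>(x) dy\<close> for the unit box \<open>B\<close> in both orders. Integrating over \<open>y\<close> first gives \<open>\<nu>(A)\<close>;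
  shifting \<open>x\<close> by \<open>-y\<close> first gives \<open>\<nu>(B)\<close> times the volume of \<open>A\<close>.\<close>

lemma translation_invariant_measure:
  fixes \<nu> :: "'a::euclidean_space measure"
  assumes sets[measurable_cong]: "sets \<nu> = sets borel" and "sigma_finite_measure \<nu>"
    and inv: "\<And>a A. A \<in> sets borel \<Longrightarrow> emeasure \<nu> ((+) a -` A) = emeasure \<nu> A"
  shows "\<nu> = density lborel (\<lambda>_. emeasure \<nu> (cbox 0 One))"
proof (rule measure_eqI)
  fix A assume "A \<in> sets \<nu>"
  then have A[measurable]: "A \<in> sets borel" by (simp add: sets)
  interpret pair_sigma_finite \<nu> "lborel :: 'a measure"
    by (intro pair_sigma_finite.intro lborel.sigma_finite_measure_axioms) fact
  have sp: "space \<nu> = UNIV" using sets_eq_imp_space_eq[OF sets] by simp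
  let ?B = "cbox 0 One :: 'a set"
  have dist: "distr \<nu> borel ((+) a) = \<nu>" for a
    by (rule measure_eqI) (auto simp: sets emeasure_distr inv sp)
  have shift: "(\<integral>\<^sup>+x. g (a + x) \<partial>\<nu>) = (\<integral>\<^sup>+x. g x \<partial>\<nu>)"
    if [measurable]: "g \<in> borel_measurable borel" for g and a
    by (subst (2) dist[of a, symmetric], subst nn_integral_distr) auto
  have lshift: "(\<integral>\<^sup>+x. g (a + x) \<partial>lborel) = (\<integral>\<^sup>+x. g x \<partial>lborel)"
    if [measurable]: "g \<in> borel_measurable borel" for g and a :: 'a
    by (subst (2) lborel_distr_plus[of a, symmetric], subst nn_integral_distr) auto
  have lrefl: "(\<integral>\<^sup>+y. g (x - y) \<partial>lborel) = (\<integral>\<^sup>+x. g x \<partial>lborel)"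
    if [measurable]: "g \<in> borel_measurable borel" for g and x :: 'a
    by (subst (2) lborel_affine[of "-1" x]) (simp_all add: nn_integral_density nn_integral_distr)
  have "emeasure \<nu> A = (\<integral>\<^sup>+x. indicator A x * (\<integral>\<^sup>+y. indicator ?B y \<partial>lborel) \<partial>\<nu>)"
    using emeasure_lborel_cbox[of 0 "One::'a"] by (simp add: sets)
  also have "\<dots> = (\<integral>\<^sup>+x. (\<integral>\<^sup>+y. indicator A x * indicator ?B (x + y) \<partial>lborel) \<partial>\<nu>)"
    by (simp add: nn_integral_cmult lshift[of "indicator ?B"])
  also have "\<dots> = (\<integral>\<^sup>+y. (\<integral>\<^sup>+x. indicator A x * indicator ?B (x + y) \<partial>\<nu>) \<partial>lborel)"
    by (rule Fubini'[symmetric]) measurable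
  also have "\<dots> = (\<integral>\<^sup>+y. (\<integral>\<^sup>+x. indicator A (x - y) * indicator ?B x \<partial>\<nu>) \<partial>lborel)"
  proof (rule nn_integral_cong)
    fix y :: 'a
    show "(\<integral>\<^sup>+x. indicator A x * indicator ?B (x + y) \<partial>\<nu>) = (\<integral>\<^sup>+x. indicator A (x - y) * indicator ?B x \<partial>\<nu>)"
      using shift[of "\<lambda>x. indicator A (x - y) * indicator ?B x" y] by (simp add: add.commute)
  qed
  also have "\<dots> = (\<integral>\<^sup>+x. (\<integral>\<^sup>+y. indicator A (x - y) * indicator ?B x \<partial>lborel) \<partial>\<nu>)"
    by (rule Fubini') measurable
  also have "\<dots> = (\<integral>\<^sup>+x. emeasure lborel A * indicator ?B x \<partial>\<nu>)"
    by (simp add: nn_integral_multc lrefl[of "indicator A"])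
  also have "\<dots> = emeasure \<nu> ?B * emeasure lborel A"
    by (simp add: nn_integral_cmult sets mult.commute)
  finally show "emeasure \<nu> A = emeasure (density lborel (\<lambda>_. emeasure \<nu> ?B)) A"
    by (simp add: emeasure_density nn_integral_cmult)
qed (simp add: sets)

text \<open>The affine map \<open>G x = x + (1 - \<beta> \<bullet> (x - p)) (p' - p)\<close> fixes the hyperplane of the base and moves \<open>p\<close>
  to \<open>p'\<close>. The conditions on \<open>\<beta>\<close> and \<open>\<beta>'\<close> say that \<open>G\<close> preserves the height over the respective apex, and
  then it commutes with the radial projections. Being affine and bijective, it multiplies volumes by a constant.
  The constant appears in both the integral and the volume, which explains the symmetric form of the
  conclusion.\<close>

lemma adjacent_cones_eq:
  fixes T T' :: "'a::euclidean_space set" and \<phi> :: "'a \<Rightarrow> real"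
  assumes "cone T p \<beta>" "cone T' p' \<beta>'"
    and lin: "\<And>y. \<beta>' \<bullet> y + (\<beta> \<bullet> y) * (\<beta>' \<bullet> (p - p')) = \<beta> \<bullet> y"
    and lin': "\<And>y. \<beta> \<bullet> y + (\<beta>' \<bullet> y) * (\<beta> \<bullet> (p' - p)) = \<beta>' \<bullet> y"
    and img: "\<And>x. x + (1 - \<beta> \<bullet> (x - p)) *\<^sub>R (p' - p) \<in> T' \<longleftrightarrow> x \<in> T"
    and [measurable]: "\<phi> \<in> borel_measurable borel"
  shows "(LINT x|lebesgue_on T. \<phi> (cone.proj p \<beta> x)) * measure lebesgue T'
    = (LINT x|lebesgue_on T'. \<phi> (cone.proj p' \<beta>' x)) * measure lebesgue T"
proof -
  interpret c: cone T p \<beta> by fact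
  interpret c': cone T' p' \<beta>' by fact
  define G where "G x = x + (1 - \<beta> \<bullet> (x - p)) *\<^sub>R (p' - p)" for x
  define G' where "G' x = x + (1 - \<beta>' \<bullet> (x - p')) *\<^sub>R (p - p')" for x
  have hG: "\<beta>' \<bullet> (G x - p') = \<beta> \<bullet> (x - p)" for x
  proof -
    have "G x - p' = (x - p) + (\<beta> \<bullet> (x - p)) *\<^sub>R (p - p')" by (simp add: G_def algebra_simps)
    then show ?thesis using lin[of "x - p"] by (simp add: inner_add_right)
  qed
  have hG': "\<beta> \<bullet> (G' x - p) = \<beta>' \<bullet> (x - p')" for x
  proof -
    have "G' x - p = (x - p') + (\<beta>' \<bullet> (x - p')) *\<^sub>R (p' - p)" by (simp add: G'_def algebra_simps)
    then show ?thesis using lin'[of "x - p'"] by (simp add: inner_add_right)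
  qed
  have G'G: "G' (G x) = x" for x
    unfolding G'_def hG by (simp add: G_def algebra_simps)
  have GG': "G (G' x) = x" for x
    unfolding G_def hG' by (simp add: G'_def algebra_simps)
  have cont: "continuous_on X G" "continuous_on X G'" for X
    unfolding G_def G'_def by (intro continuous_intros)+
  have [measurable]: "G \<in> borel_measurable borel"
    by (intro borel_measurable_continuous_onI cont)
  define \<nu> where "\<nu> = distr lborel borel G"
  have \<nu>: "emeasure \<nu> A = emeasure lborel (G -` A)" if "A \<in> sets borel" for A
    using that by (simp add: \<nu>_def emeasure_distr)
  have fin: "emeasure \<nu> A < \<infinity>" if "compact A" for A
  proof -
    have "G -` A = G' ` A" using G'G GG' by (auto simp: image_iff) (metis G'G)
    moreover have "compact (G' ` A)" using that cont by (intro compact_continuous_image)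
    ultimately show ?thesis
      using that \<nu>[of A] emeasure_compact_finite[of "G' ` A"] by (simp add: borel_compact)
  qed
  have \<nu>_eq: "\<nu> = density lborel (\<lambda>_. emeasure \<nu> (cbox 0 One))"
  proof (rule translation_invariant_measure)
    show "sigma_finite_measure \<nu>"
    proof
      show "\<exists>A. countable A \<and> A \<subseteq> sets \<nu> \<and> \<Union>A = space \<nu> \<and> (\<forall>a\<in>A. emeasure \<nu> a \<noteq> \<infinity>)"
      proof (intro exI[of _ "range (\<lambda>n::nat. cball 0 (real n))"] conjI ballI)
        have "\<exists>n. norm x \<le> real n" for x :: 'a using real_arch_simple by blast
        then show "(\<Union>n::nat. cball 0 (real n)) = space \<nu>" by (auto simp: \<nu>_def)
        fix a assume "a \<in> range (\<lambda>n::nat. cball (0::'a) (real n))"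
        then have "compact a" by auto
        from fin[OF this] show "emeasure \<nu> a \<noteq> \<infinity>" by simp
      qed (auto simp: \<nu>_def)
    qed
    fix a and A :: "'a set" assume A[measurable]: "A \<in> sets borel"
    define a' where "a' = a + (\<beta>' \<bullet> a) *\<^sub>R (p' - p)"
    have "\<beta> \<bullet> a' = \<beta>' \<bullet> a" using lin'[of a] by (simp add: a'_def inner_add_right)
    then have "1 - \<beta> \<bullet> (a' + x - p) = (1 - \<beta> \<bullet> (x - p)) - \<beta>' \<bullet> a" for x
      by (simp add: inner_add_right inner_diff_right)
    then have "G (a' + x) = a + G x" for x
      unfolding G_def by (simp only: scaleR_left_diff_distrib) (simp add: a'_def)
    then have "G -` ((+) a -` A) = (+) a' -` (G -` A)" by auto
    moreover have [measurable]: "G -` A \<in> sets borel"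
      using measurable_sets[of G borel borel A] by simp
    have "emeasure lborel ((+) a' -` (G -` A)) = emeasure lborel (G -` A)"
      by (subst (2) lborel_distr_plus[of a', symmetric]) (simp add: emeasure_distr)
    moreover have "(+) a -` A \<in> sets borel"
      using measurable_sets[of "(+) a" borel borel A] by simp
    ultimately show "emeasure \<nu> ((+) a -` A) = emeasure \<nu> A" by (simp add: \<nu>)
  qed (simp add: \<nu>_def)
  define m where "m = enn2real (emeasure \<nu> (cbox 0 One))"
  have m: "m \<ge> 0" "emeasure \<nu> (cbox 0 One) = ennreal m"
    using fin[of "cbox 0 One"] by (auto simp: m_def)
  have chv: "(LINT x|lborel. g (G x)) = m * (LINT x|lborel. g x)"
    if [measurable]: "g \<in> borel_measurable borel" for g :: "'a \<Rightarrow> real"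
  proof -
    have "(LINT x|lborel. g (G x)) = (LINT x|\<nu>. g x)"
      by (simp add: \<nu>_def integral_distr)
    also have "\<dots> = (LINT x|density lborel (\<lambda>_. ennreal m). g x)" by (subst \<nu>_eq) (simp add: m)
    also have "\<dots> = m * (LINT x|lborel. g x)" using m by (simp add: integral_density)
    finally show ?thesis .
  qed
  have ind: "indicator T' (G x) = (indicator T x :: real)" for x
    using img[of x] by (simp add: G_def split: split_indicator)
  have pr: "c'.proj (G x) = c.proj x" if "x \<in> T" "x \<noteq> p" for x
  proof -
    have h: "\<beta> \<bullet> (x - p) \<noteq> 0" using c.height_pos[OF that] by simp
    have "G x - p' = (x - p) + (\<beta> \<bullet> (x - p)) *\<^sub>R (p - p')" by (simp add: G_def algebra_simps)
    moreover have "c'.proj (G x) = p' + (G x - p') /\<^sub>R (\<beta> \<bullet> (x - p))"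
      unfolding c'.proj_def c'.height_def hG ..
    ultimately show ?thesis using h
      by (simp add: c.proj_def c.height_def scaleR_add_right)
  qed
  have "(LINT x|lborel. indicator T x * \<phi> (c.proj x)) = (LINT x|lborel. indicator T' (G x) * \<phi> (c'.proj (G x)))"
  proof (rule integral_cong_AE)
    show "AE x in lborel. indicator T x * \<phi> (c.proj x) = indicator T' (G x) * \<phi> (c'.proj (G x))"
      using AE_lborel_singleton[of p] by eventually_elim (use ind pr in \<open>auto split: split_indicator\<close>)
  qed measurable
  also have "\<dots> = m * (LINT x|lborel. indicator T' x * \<phi> (c'.proj x))"
    by (rule chv[of "\<lambda>x. indicator T' x * \<phi> (c'.proj x)"]) measurable
  finally have 1: "(LINT x|lebesgue_on T. \<phi> (c.proj x)) = m * (LINT x|lebesgue_on T'. \<phi> (c'.proj x))"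
    by (simp add: integral_lebesgue_on_borel)
  have "measure lebesgue T = (LINT x|lborel. indicator T' (G x))"
    unfolding ind by simp
  also have "\<dots> = m * (LINT x|lborel. indicator T' x)" by (rule chv) measurable
  finally have "measure lebesgue T = m * measure lebesgue T'" by simp
  with 1 show ?thesis by simp
qed

section \<open>Volume of a cone and Hausdorff measure of its base\<close>

context cone
begin

text \<open>The cone over a set of diameter less than \<open>r\<close> lies in a tube of radius \<open>O(r)\<close> around one segment from
  the apex, and \<open>O(1/r)\<close> balls of radius \<open>O(r)\<close> cover it.\<close>

lemma cone_over_small_set:
  assumes "bounded U" "diameter U < r" "r \<le> 1"
  shows "measure lborel {x \<in> T. x \<noteq> p \<and> proj x \<in> closure U}
    \<le> 3 * unit_ball_vol DIM('a) * (1 + diameter T) ^ DIM('a) * r ^ (DIM('a) - 1)"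
    (is "measure _ ?A \<le> 3 * ?w * ?D ^ _ * _")
proof (cases "?A = {}")
  case True
  have "0 < r" using diameter_ge_0[OF assms(1)] assms(2) by linarith
  then show ?thesis using diameter_ge_0[OF compact_imp_bounded[OF compact]] by (simp only: True) simp
next
  case False
  then obtain x\<^sub>0 where x\<^sub>0: "x\<^sub>0 \<in> T" "proj x\<^sub>0 \<in> closure U" by auto
  define y where "y = proj x\<^sub>0"
  have y: "y \<in> T" "y \<in> closure U" using x\<^sub>0 proj_in by (auto simp: y_def)
  have r: "0 < r" using diameter_ge_0[OF assms(1)] assms(2) by linarith
  have D0: "0 \<le> diameter T" by (intro diameter_ge_0 compact_imp_bounded compact)
  have Ty: "norm (y - p) \<le> diameter T"
    using diameter_bounded_bound[OF compact_imp_bounded[OF compact] y(1) apex] by (simp add: dist_norm)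
  define N where "N = nat \<lceil>1 / r\<rceil>"
  have N: "1 / r \<le> real N" "real N < 1 / r + 1"
    using r ceiling_correct[of "1 / r"] unfolding N_def by (simp_all add: of_nat_ceiling)
  have N0: "0 < real N" using N(1) r by (meson divide_pos_pos less_le_trans zero_less_one)
  have N1: "1 / real N \<le> r" using N(1) N0 r by (simp add: field_simps)
  let ?c = "\<lambda>j::nat. p + (real j / real N) *\<^sub>R (y - p)"
  have sub: "?A \<subseteq> (\<Union>j\<le>N. cball (?c j) (r * ?D))"
  proof
    fix x assume "x \<in> ?A"
    then have x: "x \<in> T" "x \<noteq> p" "proj x \<in> closure U" by auto
    define s where "s = height x"
    have s: "0 \<le> s" "s \<le> 1" using height_bounds[OF x(1)] by (auto simp: s_def)
    define j where "j = nat \<lfloor>s * real N\<rfloor>"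
    have j: "real j \<le> s * real N" "s * real N < real j + 1"
      using s N0 unfolding j_def by (auto simp: of_nat_floor)
    have "real j \<le> real N" using j(1) s N0 by (meson mult_left_le_one_le order_trans less_imp_le)
    then have jN: "j \<le> N" by simp
    have sj: "\<bar>s - real j / real N\<bar> \<le> r"
    proof -
      have "s - real j / real N = (s * real N - real j) / real N"
        using N0 by (simp add: field_simps)
      then have "\<bar>s - real j / real N\<bar> = \<bar>s * real N - real j\<bar> / real N"
        by (simp only: abs_divide)
      also have "\<dots> \<le> 1 / real N" using j N0 by (intro divide_right_mono) auto
      finally show ?thesis using N1 by linarith
    qed
    have "norm (x - ?c j) = norm (s *\<^sub>R (proj x - y) + (s - real j / real N) *\<^sub>R (y - p))"
    proof -
      have "x - ?c j = (p + s *\<^sub>R (proj x - p)) - ?c j"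
        using point_eq_proj[OF x(1)] by (simp add: s_def)
      also have "\<dots> = s *\<^sub>R (proj x - y) + (s - real j / real N) *\<^sub>R (y - p)"
        by (simp add: algebra_simps)
      finally show ?thesis by simp
    qed
    also have "\<dots> \<le> s * norm (proj x - y) + \<bar>s - real j / real N\<bar> * norm (y - p)"
      by (rule norm_triangle_le) (use s in simp)
    also have "\<dots> \<le> 1 * r + r * diameter T"
    proof (intro add_mono mult_mono)
      have "dist (proj x) y \<le> diameter (closure U)"
        by (intro diameter_bounded_bound bounded_closure assms x y)
      then show "norm (proj x - y) \<le> r" using assms by (simp add: dist_norm diameter_closure)
    qed (use s r sj Ty D0 in auto)
    finally have "dist (?c j) x \<le> r * ?D" by (simp add: dist_norm norm_minus_commute algebra_simps)
    with jN show "x \<in> (\<Union>j\<le>N. cball (?c j) (r * ?D))" by auto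
  qed
  have [measurable]: "?A \<in> sets borel"
  proof -
    have "closure U \<in> sets borel" by simp
    then show ?thesis by measurable
  qed
  have "measure lborel ?A \<le> measure lborel (\<Union>j\<le>N. cball (?c j) (r * ?D))"
    using sub by (intro measure_mono_fmeasurable) (auto intro!: fmeasurable_compact compact_UN)
  also have "\<dots> \<le> (\<Sum>j\<le>N. measure lborel (cball (?c j) (r * ?D)))"
    by (intro measure_UNION_le) auto
  also have "\<dots> = (real N + 1) * (?w * (r * ?D) ^ DIM('a))"
    using r D0 by (simp add: content_cball)
  also have "\<dots> \<le> (3 / r) * (?w * (r * ?D) ^ DIM('a))"
  proof (rule mult_right_mono)
    have "2 \<le> 2 / r" using assms(3) r by (simp add: field_simps)
    then show "real N + 1 \<le> 3 / r" using N(2) by (simp add: add_divide_distrib[symmetric])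
  qed (use r D0 in simp)
  also have "\<dots> = 3 * ?w * ?D ^ DIM('a) * r ^ (DIM('a) - 1)"
    using r power_Suc[of r "DIM('a) - 1"] by (simp add: power_mult_distrib)
  finally show ?thesis .
qed

text \<open>Cover \<open>A\<close> by countably many small sets and add the volumes of the cones over them. Letting \<open>r\<close>
  decrease to the diameter also covers sets of diameter zero, in particular in dimension one, where
  \<open>0 ^ 0 = 1\<close>.\<close>

lemma hausdorff_bound:
  obtains c where "c > 0" and "\<And>A. A \<in> sets borel \<Longrightarrow>
    ennreal c * emeasure lborel {x \<in> T. x \<noteq> p \<and> proj x \<in> A} \<le> hausdorff_outer (DIM('a) - 1) A"
proof -
  define k where "k = DIM('a) - 1"
  define K where "K = 3 * unit_ball_vol DIM('a) * (1 + diameter T) ^ DIM('a)"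
  have K: "K > 0"
    using diameter_ge_0[OF compact_imp_bounded[OF compact]] by (simp add: K_def)
  define c where "c = unit_ball_vol (real k) / (2 ^ k * K)"
  have c: "c > 0" using K by (simp add: c_def)
  let ?V = "\<lambda>U. {x \<in> T. x \<noteq> p \<and> proj x \<in> U}"
  have meas[measurable]: "?V U \<in> sets borel" if [measurable]: "U \<in> sets borel" for U by measurable
  have fm: "?V U \<in> fmeasurable lborel" if "U \<in> sets borel" for U
    using meas[OF that] by (intro fmeasurableI2[OF fmeasurable_compact[OF compact]]) auto
  have small: "measure lborel (?V (closure U)) \<le> K * diameter U ^ k"
    if "bounded U" "diameter U \<le> 1/2" for U
  proof (rule LIMSEQ_le_const)
    have "(\<lambda>n. K * (diameter U + inverse (real (Suc (Suc n)))) ^ k) \<longlonglongrightarrow> K * (diameter U + 0) ^ k"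
      by (intro tendsto_intros LIMSEQ_Suc[OF LIMSEQ_inverse_real_of_nat])
    then show "(\<lambda>n. K * (diameter U + inverse (real (Suc (Suc n)))) ^ k) \<longlonglongrightarrow> K * diameter U ^ k" by simp
    show "\<exists>N. \<forall>n\<ge>N. measure lborel (?V (closure U)) \<le> K * (diameter U + inverse (real (Suc (Suc n)))) ^ k"
    proof (intro exI allI impI)
      fix n
      have "inverse (real (Suc (Suc n))) \<le> inverse 2" by (intro le_imp_inverse_le) auto
      then show "measure lborel (?V (closure U)) \<le> K * (diameter U + inverse (real (Suc (Suc n)))) ^ k"
        using cone_over_small_set[OF that(1), of "diameter U + inverse (real (Suc (Suc n)))"] that(2)
        by (simp add: K_def k_def)
    qed
  qed
  show thesis
  proof (rule that[OF c])
    fix A :: "'a set" assume A: "A \<in> sets borel"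
    have "ennreal c * emeasure lborel (?V A) \<le> hausdorff_pre (1/2) k A"
      unfolding hausdorff_pre_def
    proof (rule INF_greatest)
      fix U :: "nat \<Rightarrow> 'a set"
      assume "U \<in> {U. A \<subseteq> (\<Union>i. U i) \<and> (\<forall>i. bounded (U i) \<and> diameter (U i) \<le> 1/2)}"
      then have U: "A \<subseteq> (\<Union>i. U i)" "\<And>i. bounded (U i)" "\<And>i. diameter (U i) \<le> 1/2" by auto
      let ?t = "\<lambda>i. if U i = {} then 0 else ennreal (unit_ball_vol (real k) * (diameter (U i) / 2) ^ k)"
      have "emeasure lborel (?V A) \<le> emeasure lborel (\<Union>i. ?V (closure (U i)))"
      proof (rule emeasure_mono)
        have "A \<subseteq> (\<Union>i. closure (U i))" using U(1) closure_subset[of "U _"] by blast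
        then show "?V A \<subseteq> (\<Union>i. ?V (closure (U i)))" by auto
        show "(\<Union>i. ?V (closure (U i))) \<in> sets lborel" by (simp only: sets_lborel) (intro sets.countable_UN image_subsetI meas borel_closed closed_closure)
      qed
      also have "\<dots> \<le> (\<Sum>i. emeasure lborel (?V (closure (U i))))"
        by (intro emeasure_subadditive_countably) (simp only: sets_lborel, intro image_subsetI meas borel_closed closed_closure)
      finally have "ennreal c * emeasure lborel (?V A) \<le> (\<Sum>i. ennreal c * emeasure lborel (?V (closure (U i))))"
        by (simp add: ennreal_suminf_cmult mult_left_mono)
      also have "\<dots> \<le> (\<Sum>i. ?t i)"
      proof (intro suminf_le)
        fix i
        show "ennreal c * emeasure lborel (?V (closure (U i))) \<le> ?t i"
        proof (cases "U i = {}")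
          case False
          have "ennreal c * emeasure lborel (?V (closure (U i))) = ennreal (c * measure lborel (?V (closure (U i))))"
            using fm[of "closure (U i)"] c by (simp add: emeasure_eq_measure2 ennreal_mult)
          also have "\<dots> \<le> ennreal (c * (K * diameter (U i) ^ k))"
            using small[OF U(2,3)] c by (intro ennreal_leI mult_left_mono) auto
          also have "c * (K * diameter (U i) ^ k) = unit_ball_vol (real k) * (diameter (U i) / 2) ^ k"
            using K by (simp add: c_def power_divide)
          finally show ?thesis using False by simp
        qed simp
      qed auto
      finally show "ennreal c * emeasure lborel (?V A) \<le> (\<Sum>i. ?t i)" .
    qed
    also have "\<dots> \<le> hausdorff_outer k A"
      unfolding hausdorff_outer_def by (rule SUP_upper) simp
    finally show "ennreal c * emeasure lborel (?V A) \<le> hausdorff_outer (DIM('a) - 1) A"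
      by (simp add: k_def)
  qed
qed

end

text \<open>A measure built by \<^const>\<open>measure_of\<close> is either given by the prescribed set function or zero
  throughout. A single set of positive measure therefore shows that Hausdorff measure is the outer measure on
  all Borel sets.\<close>

lemma hausdorff_measure_nontrivial:
  fixes A B :: "'a::euclidean_space set"
  assumes "emeasure (hausdorff_measure k) B > 0" "A \<in> sets borel"
  shows "emeasure (hausdorff_measure k) A = hausdorff_outer k A"
proof -
  have "measure_space UNIV (sigma_sets UNIV (sets borel)) (hausdorff_outer k :: 'a set \<Rightarrow> ennreal)"
    using assms(1) by (auto simp: hausdorff_measure_def emeasure_measure_of_conv split: if_splits)
  then show ?thesis using assms(2)
    by (auto simp: hausdorff_measure_def emeasure_measure_of_conv)
qed

lemma sets_hausdorff_measure: "sets (hausdorff_measure k) = sets borel"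
  using sets.sigma_sets_eq[of borel] by (simp add: hausdorff_measure_def)

lemma (in cone) integral_proj_le_hausdorff:
  assumes pos: "emeasure (hausdorff_measure (DIM('a) - 1) :: 'a measure) B > 0"
    and S: "S \<in> sets borel" "\<And>x. x \<in> T \<Longrightarrow> x \<noteq> p \<Longrightarrow> proj x \<in> S"
  obtains c where "c > 0" and "\<And>f. f \<in> borel_measurable borel \<Longrightarrow>
    ennreal c * (\<integral>\<^sup>+x. f (proj x) \<partial>lebesgue_on T) \<le> (\<integral>\<^sup>+x. f x * indicator S x \<partial>hausdorff_measure (DIM('a) - 1))"
proof -
  let ?H = "hausdorff_measure (DIM('a) - 1) :: 'a measure"
  obtain c where c: "c > 0" and bound: "\<And>A. A \<in> sets borel \<Longrightarrow>
    ennreal c * emeasure lborel {x \<in> T. x \<noteq> p \<and> proj x \<in> A} \<le> hausdorff_outer (DIM('a) - 1) A"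
    using hausdorff_bound by blast
  let ?M = "restrict_space lborel (T - {p})"
  have [measurable]: "T - {p} \<in> sets borel" by measurable
  have pm[measurable]: "proj \<in> ?M \<rightarrow>\<^sub>M borel" by (intro measurable_restrict_space1) simp
  let ?N = "distr ?M borel proj"
  have le: "scale_measure (ennreal c) ?N \<le> ?H"
  proof (subst le_measure)
    show "sets (scale_measure (ennreal c) ?N) = sets ?H" by (simp add: sets_hausdorff_measure)
    show "\<forall>A\<in>sets (scale_measure (ennreal c) ?N). emeasure (scale_measure (ennreal c) ?N) A \<le> emeasure ?H A"
    proof
      fix A assume "A \<in> sets (scale_measure (ennreal c) ?N)"
      then have A[measurable]: "A \<in> sets borel" by simp
      have "proj -` A \<inter> (T - {p}) = {x \<in> T. x \<noteq> p \<and> proj x \<in> A}" by auto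
      moreover have "emeasure ?M {x \<in> T. x \<noteq> p \<and> proj x \<in> A} = emeasure lborel {x \<in> T. x \<noteq> p \<and> proj x \<in> A}"
        by (rule emeasure_restrict_space) auto
      ultimately show "emeasure (scale_measure (ennreal c) ?N) A \<le> emeasure ?H A"
        using bound[OF A] hausdorff_measure_nontrivial[OF pos A]
        by (simp add: emeasure_distr space_restrict_space)
    qed
  qed
  show thesis
  proof (rule that[OF c])
    fix f :: "'a \<Rightarrow> ennreal" assume [measurable]: "f \<in> borel_measurable borel"
    note S(1)[measurable]
    have "(\<integral>\<^sup>+x. f (proj x) \<partial>lebesgue_on T) = (\<integral>\<^sup>+x. f (proj x) * indicator T x \<partial>lborel)"
      by (simp add: nn_integral_restrict_space nn_integral_completion)
    also have "\<dots> = (\<integral>\<^sup>+x. (f (proj x) * indicator S (proj x)) * indicator (T - {p}) x \<partial>lborel)"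
      by (rule nn_integral_cong_AE, use AE_lborel_singleton[of p] in eventually_elim)
        (use S(2) in \<open>auto split: split_indicator\<close>)
    also have "\<dots> = (\<integral>\<^sup>+x. f (proj x) * indicator S (proj x) \<partial>?M)"
      by (simp add: nn_integral_restrict_space)
    also have "\<dots> = (\<integral>\<^sup>+x. f x * indicator S x \<partial>?N)"
      by (simp add: nn_integral_distr)
    finally have "ennreal c * (\<integral>\<^sup>+x. f (proj x) \<partial>lebesgue_on T)
      = (\<integral>\<^sup>+x. f x * indicator S x \<partial>scale_measure (ennreal c) ?N)"
      by (simp add: nn_integral_scale_measure)
    also have "\<dots> \<le> (\<integral>\<^sup>+x. f x * indicator S x \<partial>?H)"
      by (intro nn_integral_mono_measure le) (simp add: sets_hausdorff_measure)
    finally show "ennreal c * (\<integral>\<^sup>+x. f (proj x) \<partial>lebesgue_on T) \<le> (\<integral>\<^sup>+x. f x * indicator S x \<partial>?H)" .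
  qed
qed

section \<open>Means over simplices and their sides\<close>

abbreviation full_simplex :: "'a::euclidean_space set \<Rightarrow> bool" where
  "full_simplex T \<equiv> int DIM('a) simplex T"

definition verts :: "'a::euclidean_space set \<Rightarrow> 'a set" where
  "verts T = {p. p extreme_point_of T}"

definition side :: "'a::euclidean_space set \<Rightarrow> 'a \<Rightarrow> 'a set" where
  "side T p = convex hull (verts T - {p})"

lemma verts_convex_hull:
  "\<not> affine_dependent C \<Longrightarrow> verts (convex hull C) = C"
  by (simp add: verts_def extreme_point_of_convex_hull_affine_independent)

lemma
  fixes T :: "'a::euclidean_space set"
  assumes "full_simplex T"
  shows verts_finite: "finite (verts T)"
    and verts_independent: "\<not> affine_dependent (verts T)"
    and card_verts: "card (verts T) = Suc DIM('a)"
    and hull_verts: "convex hull verts T = T"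
    and simplex_compact: "compact T"
    and simplex_convex: "convex T"
proof -
  obtain C where C: "finite C" "\<not> affine_dependent C" "int (card C) = int DIM('a) + 1" "T = convex hull C"
    using assms simplex by blast
  then have v: "verts T = C" by (simp add: verts_convex_hull)
  show "finite (verts T)" "\<not> affine_dependent (verts T)" "card (verts T) = Suc DIM('a)"
    "convex hull verts T = T" "compact T" "convex T"
    using C v by (auto simp: finite_imp_compact_convex_hull)
qed

lemma verts_subset: "verts T \<subseteq> T"
  by (auto simp: verts_def extreme_point_of_def)

lemma verts_side:
  assumes "full_simplex T"
  shows "verts (side T p) = verts T - {p}"
  unfolding side_def
  using affine_independent_subset[OF verts_independent[OF assms]] by (intro verts_convex_hull) blast

lemma facet_iff_side:
  assumes "full_simplex T"
  shows "S facet_of T \<longleftrightarrow> (\<exists>p\<in>verts T. S = side T p)"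
  using facet_of_convex_hull_affine_independent_alt[OF verts_independent[OF assms], of S]
  by (auto simp: hull_verts[OF assms] card_verts[OF assms] side_def Suc_le_eq)

lemma side_subset:
  assumes "full_simplex T" shows "side T p \<subseteq> T"
  using hull_mono[of "verts T - {p}" "verts T" convex] hull_verts[OF assms] by (auto simp: side_def)

lemma measure_simplex_pos:
  assumes "full_simplex T"
  shows "measure lebesgue T > 0"
proof -
  have "interior T \<noteq> {}"
    using interior_convex_hull_eq_empty[OF card_verts[OF assms]] verts_independent[OF assms] hull_verts[OF assms]
    by simp
  then have "\<not> negligible T"
    using open_not_negligible[OF open_interior] negligible_subset interior_subset by blast
  then have "measure lebesgue T \<noteq> 0"
    using negligible_iff_measure0 lmeasurable_compact[OF simplex_compact[OF assms]] by blast
  then show ?thesis by (simp add: zero_less_measure_iff)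
qed

text \<open>The functional \<open>x \<mapsto> slope T p \<bullet> (x - p)\<close> is one minus the barycentric coordinate of \<open>p\<close>.\<close>

definition slope :: "'a::euclidean_space set \<Rightarrow> 'a \<Rightarrow> 'a" where
  "slope T p = (SOME \<beta>. \<forall>q\<in>verts T - {p}. \<beta> \<bullet> (q - p) = 1)"

context
  fixes T :: "'a::euclidean_space set" and p :: 'a
  assumes T: "full_simplex T" and p: "p \<in> verts T"
begin

lemma edges_independent: "independent ((\<lambda>q. q - p) ` (verts T - {p}))"
  using affine_dependent_iff_dependent2[OF p] verts_independent[OF T] by simp

lemma span_edges: "span ((\<lambda>q. q - p) ` (verts T - {p})) = UNIV"
proof -
  have "card ((\<lambda>q. q - p) ` (verts T - {p})) = DIM('a)"
    using p card_verts[OF T] verts_finite[OF T] by (subst card_image) (auto simp: inj_on_def)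
  then show ?thesis
    using card_ge_dim_independent[OF subset_UNIV edges_independent] by auto
qed

lemma slope_edge:
  assumes "q \<in> verts T" "q \<noteq> p"
  shows "slope T p \<bullet> (q - p) = 1"
proof -
  obtain g :: "'a \<Rightarrow> real" where g: "linear g" "\<And>y. y \<in> (\<lambda>q. q - p) ` (verts T - {p}) \<Longrightarrow> g y = 1"
    using linear_independent_extend[OF edges_independent, of "\<lambda>_. 1"] by blast
  have "adjoint g 1 \<bullet> y = g y" for y
    using adjoint_works[OF g(1), of y 1] by (simp add: inner_commute)
  then have "\<forall>q\<in>verts T - {p}. adjoint g 1 \<bullet> (q - p) = 1" by (auto intro: g(2))
  then have "\<exists>\<beta>. \<forall>q\<in>verts T - {p}. \<beta> \<bullet> (q - p) = 1" by (rule exI)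
  from someI_ex[OF this, folded slope_def] assms show ?thesis by simp
qed

lemma slope_barycentric:
  assumes "sum u (verts T) = 1"
  shows "slope T p \<bullet> ((\<Sum>q\<in>verts T. u q *\<^sub>R q) - p) = 1 - u p"
proof -
  have "(\<Sum>q\<in>verts T. u q *\<^sub>R q) - p = (\<Sum>q\<in>verts T. u q *\<^sub>R (q - p))"
    using assms by (simp add: scaleR_diff_right sum_subtractf scaleR_sum_left[symmetric])
  then have "slope T p \<bullet> ((\<Sum>q\<in>verts T. u q *\<^sub>R q) - p) = (\<Sum>q\<in>verts T. u q * (slope T p \<bullet> (q - p)))"
    by (simp add: inner_sum_right)
  also have "\<dots> = (\<Sum>q\<in>verts T - {p}. u q)"
  proof -
    have "(\<Sum>q\<in>verts T - {p}. u q * (slope T p \<bullet> (q - p))) = (\<Sum>q\<in>verts T - {p}. u q)"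
      using slope_edge by (intro sum.cong) auto
    then show ?thesis
      using sum.remove[OF verts_finite[OF T] p, of "\<lambda>q. u q * (slope T p \<bullet> (q - p))"] by simp
  qed
  also have "\<dots> = 1 - u p"
    using sum.remove[OF verts_finite[OF T] p, of u] assms by simp
  finally show ?thesis .
qed

end

lemma simplex_barycentric:
  assumes "full_simplex T" "x \<in> T"
  obtains u where "\<And>q. q \<in> verts T \<Longrightarrow> 0 \<le> u q" "sum u (verts T) = 1" "x = (\<Sum>q\<in>verts T. u q *\<^sub>R q)"
proof -
  have "x \<in> {y. \<exists>u. (\<forall>q\<in>verts T. 0 \<le> u q) \<and> sum u (verts T) = 1 \<and> (\<Sum>q\<in>verts T. u q *\<^sub>R q) = y}"
    unfolding convex_hull_finite[OF verts_finite[OF assms(1)], symmetric] hull_verts[OF assms(1)] by fact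
  then show ?thesis using that by blast
qed

lemma proj_in_side:
  assumes T: "full_simplex T" and p: "p \<in> verts T" and x: "x \<in> T" "x \<noteq> p"
  shows "0 < slope T p \<bullet> (x - p)" "p + (x - p) /\<^sub>R (slope T p \<bullet> (x - p)) \<in> side T p"
proof -
  obtain u where u: "\<And>q. q \<in> verts T \<Longrightarrow> 0 \<le> u q" "sum u (verts T) = 1" "x = (\<Sum>q\<in>verts T. u q *\<^sub>R q)"
    using simplex_barycentric[OF T x(1)] by blast
  have h: "slope T p \<bullet> (x - p) = 1 - u p" using slope_barycentric[OF T p u(2)] u(3) by simp
  note rm = sum.remove[OF verts_finite[OF T] p]
  have s: "sum u (verts T - {p}) = 1 - u p" using rm[of u] u(2) by simp
  have "u p \<noteq> 1"
  proof
    assume "u p = 1"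
    then have "sum u (verts T - {p}) = 0" using s by simp
    then have "\<forall>q\<in>verts T - {p}. u q = 0"
      using u(1) verts_finite[OF T] sum_nonneg_eq_0_iff[of "verts T - {p}" u] by simp
    then have "(\<Sum>q\<in>verts T - {p}. u q *\<^sub>R q) = 0" by (intro sum.neutral) simp
    then have "x = p" using u(3) rm[of "\<lambda>q. u q *\<^sub>R q"] \<open>u p = 1\<close> by simp
    with x show False by simp
  qed
  moreover have "0 \<le> sum u (verts T - {p})" using u(1) by (intro sum_nonneg) auto
  ultimately have pos: "1 - u p > 0" using s by simp
  then show "0 < slope T p \<bullet> (x - p)" using h by simp
  have "x - p = (\<Sum>q\<in>verts T - {p}. u q *\<^sub>R q) - (1 - u p) *\<^sub>R p"
    using u(3) rm[of "\<lambda>q. u q *\<^sub>R q"] by (simp add: algebra_simps)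
  then have "p + (x - p) /\<^sub>R (1 - u p) = (\<Sum>q\<in>verts T - {p}. u q *\<^sub>R q) /\<^sub>R (1 - u p)"
    using pos by (simp add: scaleR_diff_right)
  also have "\<dots> = (\<Sum>q\<in>verts T - {p}. (u q / (1 - u p)) *\<^sub>R q)"
    by (simp add: scaleR_sum_right divide_inverse mult.commute)
  also have "\<dots> \<in> side T p"
    unfolding side_def
  proof (rule convex_sum)
    show "(\<Sum>q\<in>verts T - {p}. u q / (1 - u p)) = 1"
      using s pos by (simp add: sum_divide_distrib[symmetric])
  qed (use verts_finite[OF T] u(1) pos in \<open>auto simp: hull_inc\<close>)
  finally show "p + (x - p) /\<^sub>R (slope T p \<bullet> (x - p)) \<in> side T p" by (simp add: h)
qed

lemma simplex_cone:
  assumes T: "full_simplex T" and p: "p \<in> verts T"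
  shows "cone T p (slope T p)"
proof
  show "slope T p \<bullet> (x - p) \<le> 1" if x: "x \<in> T" for x
  proof -
    obtain u where u: "\<And>q. q \<in> verts T \<Longrightarrow> 0 \<le> u q" "sum u (verts T) = 1" "x = (\<Sum>q\<in>verts T. u q *\<^sub>R q)"
      using simplex_barycentric[OF T x] by blast
    then show ?thesis using slope_barycentric[OF T p u(2)] u(1)[OF p] by simp
  qed
  show "0 < slope T p \<bullet> (x - p)" "p + (x - p) /\<^sub>R (slope T p \<bullet> (x - p)) \<in> T" if "x \<in> T" "x \<noteq> p" for x
    using proj_in_side[OF T p that] side_subset[OF T] by auto
qed (use T p simplex_compact simplex_convex verts_subset in auto)

definition mean :: "'a::euclidean_space set \<Rightarrow> ('a \<Rightarrow> 'b::euclidean_space) \<Rightarrow> 'b" where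
  "mean T f = (LINT x|lebesgue_on T. f x) /\<^sub>R measure lebesgue T"

text \<open>The mean of \<open>\<phi>\<close> over the side opposite \<open>p\<close>, written as an integral over \<open>T\<close>: under the radial
  projection, normalized volume on \<open>T\<close> becomes normalized surface measure on the side.\<close>

definition side_mean :: "'a::euclidean_space set \<Rightarrow> 'a \<Rightarrow> ('a \<Rightarrow> real) \<Rightarrow> real" where
  "side_mean T p \<phi> = mean T (\<lambda>x. \<phi> (cone.proj p (slope T p) x))"

definition centroid :: "'a::euclidean_space set \<Rightarrow> 'a" where
  "centroid T = (\<Sum>q\<in>verts T. q) /\<^sub>R real (Suc DIM('a))"

lemma mean_add:
  assumes "integrable (lebesgue_on T) f" "integrable (lebesgue_on T) g"
  shows "mean T (\<lambda>x. f x + g x) = mean T f + mean T g"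
  using assms by (simp add: mean_def scaleR_add_right)

lemma mean_diff:
  assumes "integrable (lebesgue_on T) f" "integrable (lebesgue_on T) g"
  shows "mean T (\<lambda>x. f x - g x) = mean T f - mean T g"
  using assms by (simp add: mean_def scaleR_diff_right)

lemma mean_mult: "mean T (\<lambda>x. c * f x) = c * mean T f" for f :: "_ \<Rightarrow> real"
  by (simp add: mean_def)

lemma mean_sum:
  "(\<And>i. i \<in> I \<Longrightarrow> integrable (lebesgue_on T) (f i)) \<Longrightarrow> mean T (\<lambda>x. \<Sum>i\<in>I. f i x) = (\<Sum>i\<in>I. mean T (f i))"
  by (simp add: mean_def scaleR_sum_right)

lemma mean_inner:
  "integrable (lebesgue_on T) f \<Longrightarrow> mean T (\<lambda>x. f x \<bullet> a) = mean T f \<bullet> a"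
  by (simp add: mean_def)

lemma mean_const: "full_simplex T \<Longrightarrow> mean T (\<lambda>x. c) = c"
  using measure_simplex_pos[of T] fmeasurableD[OF lmeasurable_compact[OF simplex_compact[of T]]]
  by (simp add: mean_def measure_restrict_space)

lemma integral_eq_mean: "full_simplex T \<Longrightarrow> (LINT x|lebesgue_on T. f x) = measure lebesgue T *\<^sub>R mean T f"
  using measure_simplex_pos[of T] by (simp add: mean_def)

lemma mean_cong: "(\<And>x. x \<in> T \<Longrightarrow> f x = g x) \<Longrightarrow> mean T f = mean T g"
  unfolding mean_def by (metis (mono_tags, lifting) Bochner_Integration.integral_cong space_lebesgue_on)

text \<open>Side means are expressed by volume integrals of \<open>\<phi>\<close> and its gradient; this replaces the divergence
  theorem on the simplex.\<close>

lemma side_mean_eq: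
  fixes \<phi> :: "'a::euclidean_space \<Rightarrow> real"
  assumes T: "full_simplex T" and p: "p \<in> verts T"
    and der: "\<And>x. (\<phi> has_derivative (\<lambda>h. G x \<bullet> h)) (at x)" and G: "continuous_on UNIV G"
  shows "side_mean T p \<phi> = mean T (\<lambda>x. \<phi> x + (G x \<bullet> (x - p)) / real DIM('a))"
proof -
  have "mean T (\<lambda>x. real DIM('a) * (\<phi> x + (G x \<bullet> (x - p)) / real DIM('a))) = real DIM('a) * side_mean T p \<phi>"
    using cone.integral_proj[OF simplex_cone[OF T p] der G]
    by (simp add: mean_def side_mean_def distrib_left)
  then show ?thesis by (simp add: mean_mult del: times_divide_eq_right)
qed

text \<open>The barycentric coordinate of \<open>p\<close> vanishes on the side opposite \<open>p\<close>, so its side mean is zero, and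
  \<open>side_mean_eq\<close> becomes a linear equation for its mean.\<close>

lemma mean_slope:
  fixes T :: "'a::euclidean_space set"
  assumes T: "full_simplex T" and p: "p \<in> verts T"
  shows "mean T (\<lambda>x. 1 - slope T p \<bullet> (x - p)) = 1 / real (Suc DIM('a))"
proof -
  let ?l = "\<lambda>x. 1 - slope T p \<bullet> (x - p)" and ?d = "real DIM('a)"
  interpret c: cone T p "slope T p" using simplex_cone[OF T p] .
  have il: "integrable (lebesgue_on T) ?l"
    by (intro integrable_continuous_compact simplex_compact T continuous_intros)
  have "side_mean T p ?l = mean T (\<lambda>x. ?l x + ((- slope T p) \<bullet> (x - p)) / ?d)"
    by (rule side_mean_eq[OF T p]) (auto intro!: derivative_eq_intros continuous_intros)
  also have "\<dots> = mean T (\<lambda>x. (1 + 1 / ?d) * ?l x - 1 / ?d)"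
    by (rule arg_cong[where f="mean T"]) (auto simp: field_simps)
  also have "\<dots> = (1 + 1 / ?d) * mean T ?l - 1 / ?d"
    using il by (simp add: mean_diff mean_mult mean_const[OF T] integrable_continuous_compact[OF simplex_compact[OF T]])
  finally have 1: "side_mean T p ?l = (1 + 1 / ?d) * mean T ?l - 1 / ?d" .
  have "side_mean T p ?l = mean T (\<lambda>x. 0)"
    unfolding side_mean_def mean_def
  proof (intro arg_cong[where f="\<lambda>z. z /\<^sub>R _"] integral_cong_AE)
    have n: "AE x in lebesgue_on T. x \<noteq> p"
      using AE_completion[OF AE_lborel_singleton[of p]] c.T_lmeasurable
      by (subst AE_restrict_space_iff) auto
    show "AE x in lebesgue_on T. ?l (c.proj x) = 0"
      using n AE_space by eventually_elim (use c.height_proj in \<open>simp add: c.height_def\<close>)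
  qed (auto intro!: measurable_restrict_space1 measurable_completion)
  with 1 have "?d * ((1 + ?d) * mean T ?l) = ?d * 1" by (simp add: mean_const[OF T] field_simps)
  then have "(1 + ?d) * mean T ?l = 1" by (subst (asm) mult_cancel_left) simp
  then show ?thesis by (simp add: field_simps)
qed

text \<open>Expand the affine function in barycentric coordinates, which all have the same mean.\<close>

lemma mean_affine:
  fixes T :: "'a::euclidean_space set" and a :: 'a
  assumes T: "full_simplex T"
  shows "mean T (\<lambda>x. a \<bullet> x + c) = a \<bullet> centroid T + c"
proof -
  have "a \<bullet> x + c = (\<Sum>p\<in>verts T. (a \<bullet> p + c) * (1 - slope T p \<bullet> (x - p)))" if x: "x \<in> T" for x
  proof -
    obtain u where u: "sum u (verts T) = 1" "x = (\<Sum>q\<in>verts T. u q *\<^sub>R q)"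
      using simplex_barycentric[OF T x] by blast
    have "(\<Sum>p\<in>verts T. (a \<bullet> p + c) * (1 - slope T p \<bullet> (x - p))) = (\<Sum>p\<in>verts T. (a \<bullet> p + c) * u p)"
      using slope_barycentric[OF T _ u(1)] u(2) by (intro sum.cong) auto
    also have "\<dots> = a \<bullet> x + c"
      using u by (simp add: inner_sum_right distrib_right distrib_left sum.distrib mult.commute sum_distrib_left[symmetric])
    finally show ?thesis by simp
  qed
  then have "mean T (\<lambda>x. a \<bullet> x + c) = mean T (\<lambda>x. \<Sum>p\<in>verts T. (a \<bullet> p + c) * (1 - slope T p \<bullet> (x - p)))"
    by (rule mean_cong)
  also have "\<dots> = (\<Sum>p\<in>verts T. (a \<bullet> p + c) * (1 / real (Suc DIM('a))))"
    using mean_slope[OF T]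
    by (subst mean_sum) (auto intro!: integrable_continuous_compact simplex_compact T continuous_intros simp: mean_mult)
  also have "\<dots> = a \<bullet> centroid T + c"
    using card_verts[OF T] by (simp add: centroid_def inner_sum_right sum.distrib
        sum_divide_distrib[symmetric] field_simps del: of_nat_Suc)
  finally show ?thesis .
qed

lemma mean_id:
  fixes T :: "'a::euclidean_space set"
  assumes T: "full_simplex T" shows "mean T (\<lambda>x. x) = centroid T"
proof (rule euclidean_eqI)
  fix b :: 'a
  have "mean T (\<lambda>x. x) \<bullet> b = mean T (\<lambda>x. x \<bullet> b)"
    by (rule mean_inner[symmetric]) (intro integrable_continuous_compact simplex_compact T continuous_intros)
  then show "mean T (\<lambda>x. x) \<bullet> b = centroid T \<bullet> b"
    using mean_affine[OF T, of b 0] by (simp add: inner_commute)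
qed

lemma centroid_in: "full_simplex T \<Longrightarrow> centroid T \<in> T"
proof -
  assume T: "full_simplex T"
  have "(\<Sum>q\<in>verts T. inverse (real (Suc DIM('a))) *\<^sub>R q) \<in> T"
    using verts_subset card_verts[OF T] by (intro convex_sum simplex_convex verts_finite T) auto
  then show "centroid T \<in> T" by (simp add: centroid_def scaleR_sum_right)
qed

lemma barycenter_side:
  fixes T :: "'a::euclidean_space set"
  assumes T: "full_simplex T" and p: "p \<in> verts T"
  shows "barycenter (side T p) = (\<Sum>q\<in>verts T - {p}. q) /\<^sub>R real DIM('a)"
proof -
  have "{q. q extreme_point_of side T p} = verts T - {p}" using verts_side[OF T] by (simp add: verts_def)
  then show ?thesis using p card_verts[OF T] verts_finite[OF T] by (simp add: barycenter_def)
qed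

lemma barycenter_side_centroid:
  fixes T :: "'a::euclidean_space set"
  assumes T: "full_simplex T" and p: "p \<in> verts T"
  shows "barycenter (side T p) - centroid T = (centroid T - p) /\<^sub>R real DIM('a)"
proof -
  let ?d = "real DIM('a)"
  have s: "(\<Sum>q\<in>verts T. q) = (?d + 1) *\<^sub>R centroid T"
  proof -
    have "(?d + 1) * inverse (real (Suc DIM('a))) = 1" by (simp add: field_simps)
    then show ?thesis by (simp only: centroid_def scaleR_scaleR scaleR_one)
  qed
  have "(\<Sum>q\<in>verts T - {p}. q) = (?d + 1) *\<^sub>R centroid T - p"
    using sum.remove[OF verts_finite[OF T] p, of "\<lambda>q. q"] s by simp
  then have "?d *\<^sub>R (barycenter (side T p) - centroid T) = centroid T - p"
    by (simp add: barycenter_side[OF T p] algebra_simps)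
  then show ?thesis by (metis DIM_positive inverse_eq_divide of_nat_0_less_iff real_vector.scale_right_imp_eq scaleR_one scaleR_scaleR left_inverse less_irrefl)
qed

text \<open>The barycenter of the side opposite \<open>p\<close> is \<open>x\<^sub>T + (x\<^sub>T - p) / d\<close>, where \<open>x\<^sub>T\<close> is the centroid, so that
  the multiples of \<open>x\<^sub>T\<close> in the two means cancel and leave the formula for the side mean. The affine function
  on the left is the Crouzeix--Raviart interpolant of \<open>\<phi>\<close> on \<open>T\<close>.\<close>

lemma affine_interpolant_at_barycenter:
  fixes \<phi> :: "'a::euclidean_space \<Rightarrow> real"
  assumes T: "full_simplex T" and p: "p \<in> verts T"
    and der: "\<And>x. (\<phi> has_derivative (\<lambda>h. G x \<bullet> h)) (at x)" and G: "continuous_on UNIV G"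
  shows "mean T G \<bullet> (barycenter (side T p) - centroid T)
      + mean T (\<lambda>x. \<phi> x + (G x \<bullet> (x - centroid T)) / real DIM('a)) = side_mean T p \<phi>"
proof -
  let ?d = "real DIM('a)"
  have c\<phi>: "continuous_on UNIV \<phi>"
    by (intro continuous_at_imp_continuous_on ballI has_derivative_continuous[OF der])
  note int = integrable_continuous_compact[OF simplex_compact[OF T]]
  have "mean T G \<bullet> (barycenter (side T p) - centroid T) = mean T (\<lambda>x. (G x \<bullet> (centroid T - p)) / ?d)"
    unfolding barycenter_side_centroid[OF T p]
    by (subst mean_inner[symmetric]) (auto intro: int G simp: divide_inverse mult.commute)
  moreover have "mean T (\<lambda>x. (G x \<bullet> (centroid T - p)) / ?d) + mean T (\<lambda>x. \<phi> x + (G x \<bullet> (x - centroid T)) / ?d)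
    = mean T (\<lambda>x. (G x \<bullet> (centroid T - p)) / ?d + (\<phi> x + (G x \<bullet> (x - centroid T)) / ?d))"
    by (intro mean_add[symmetric] int continuous_intros G c\<phi>) auto
  moreover have "(\<lambda>x. (G x \<bullet> (centroid T - p)) / ?d + (\<phi> x + (G x \<bullet> (x - centroid T)) / ?d))
    = (\<lambda>x. \<phi> x + (G x \<bullet> (x - p)) / ?d)"
    by (auto simp: inner_diff_right diff_divide_distrib)
  ultimately show ?thesis using side_mean_eq[OF T p der G] by simp
qed

text \<open>The local Crouzeix--Raviart basis function \<open>1 - d \<lambda>\<^sub>p\<close>, where \<open>\<lambda>\<^sub>p\<close> is the barycentric coordinate of
  \<open>p\<close>.\<close>

definition side_hat :: "'a::euclidean_space set \<Rightarrow> 'a \<Rightarrow> 'a \<Rightarrow> real" where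
  "side_hat T p x = 1 - real DIM('a) + real DIM('a) * (slope T p \<bullet> (x - p))"

lemma side_hat_barycenter:
  fixes T :: "'a::euclidean_space set"
  assumes T: "full_simplex T" and p: "p \<in> verts T" and q: "q \<in> verts T"
  shows "side_hat T p (barycenter (side T q)) = (if q = p then 1 else 0)"
proof -
  let ?d = "real DIM('a)"
  define u where "u r = (if r = q then 0 else 1 / ?d)" for r
  have "sum u (verts T - {q}) = (\<Sum>r\<in>verts T - {q}. 1 / ?d)"
    by (rule sum.cong) (auto simp: u_def)
  then have "sum u (verts T) = (\<Sum>r\<in>verts T - {q}. 1 / ?d)"
    using sum.remove[OF verts_finite[OF T] q, of u] by (simp add: u_def)
  then have u: "sum u (verts T) = 1"
    using q card_verts[OF T] verts_finite[OF T] by simp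
  have "barycenter (side T q) = (\<Sum>r\<in>verts T - {q}. (1 / ?d) *\<^sub>R r)"
    unfolding barycenter_side[OF T q] scaleR_sum_right by (simp add: inverse_eq_divide)
  also have "\<dots> = (\<Sum>r\<in>verts T. u r *\<^sub>R r)"
  proof -
    have "(\<Sum>r\<in>verts T - {q}. u r *\<^sub>R r) = (\<Sum>r\<in>verts T - {q}. (1 / ?d) *\<^sub>R r)"
      by (rule sum.cong) (auto simp: u_def)
    moreover have "u q = 0" by (simp add: u_def)
    ultimately show ?thesis
      using sum.remove[OF verts_finite[OF T] q, of "\<lambda>r. u r *\<^sub>R r"] by simp
  qed
  finally have "slope T p \<bullet> (barycenter (side T q) - p) = 1 - u p"
    using slope_barycentric[OF T p u] by simp
  then show ?thesis by (auto simp: side_hat_def u_def right_diff_distrib)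
qed

text \<open>Both simplices are cones over the same side, and the height conditions of \<open>adjacent_cones_eq\<close> are
  identities between linear functionals that can be checked on the edges emanating from one apex.\<close>

lemma side_mean_adjacent:
  fixes T T' :: "'a::euclidean_space set"
  assumes T: "full_simplex T" and p: "p \<in> verts T"
    and T': "full_simplex T'" and p': "p' \<in> verts T'"
    and eq: "side T p = side T' p'" and \<phi>: "continuous_on UNIV \<phi>"
  shows "side_mean T p \<phi> = side_mean T' p' \<phi>"
proof -
  have v: "verts T - {p} = verts T' - {p'}" using verts_side[OF T, of p] verts_side[OF T', of p'] eq by simp
  have *: "slope T' p' \<bullet> y + (slope T p \<bullet> y) * (slope T' p' \<bullet> (p - p')) = slope T p \<bullet> y"
    if T: "full_simplex T" and p: "p \<in> verts T" and T': "full_simplex T'" and p': "p' \<in> verts T'"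
      and v: "verts T - {p} = verts T' - {p'}" for T T' :: "'a set" and p p' y
  proof (rule linear_eq_on[where B="(\<lambda>q. q - p) ` (verts T - {p})"])
    show "linear (\<lambda>y. slope T' p' \<bullet> y + (slope T p \<bullet> y) * (slope T' p' \<bullet> (p - p')))"
      by (rule linearI) (simp_all add: inner_add_right algebra_simps)
    show "linear (\<lambda>y. slope T p \<bullet> y)" by (rule linearI) (simp_all add: inner_add_right)
    show "y \<in> span ((\<lambda>q. q - p) ` (verts T - {p}))" using span_edges[OF T p] by simp
    fix y assume "y \<in> (\<lambda>q. q - p) ` (verts T - {p})"
    then obtain q where q: "q \<in> verts T" "q \<noteq> p" "y = q - p" by auto
    have "q \<in> verts T' - {p'}" using q v by auto
    then have "slope T' p' \<bullet> (q - p') = 1" using slope_edge[OF T' p'] by auto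
    moreover have "slope T p \<bullet> y = 1" using slope_edge[OF T p] q by simp
    ultimately show "slope T' p' \<bullet> y + (slope T p \<bullet> y) * (slope T' p' \<bullet> (p - p')) = slope T p \<bullet> y"
      by (simp add: q(3) inner_diff_right)
  qed
  have maps: "x + (1 - slope T p \<bullet> (x - p)) *\<^sub>R (p' - p) \<in> T'"
    if T: "full_simplex T" and p: "p \<in> verts T" and T': "full_simplex T'" and p': "p' \<in> verts T'"
      and v: "verts T - {p} = verts T' - {p'}" and x: "x \<in> T" for T T' :: "'a set" and p p' x
  proof -
    obtain u where u: "\<And>q. q \<in> verts T \<Longrightarrow> 0 \<le> u q" "sum u (verts T) = 1" "x = (\<Sum>q\<in>verts T. u q *\<^sub>R q)"
      using simplex_barycentric[OF T x] by blast
    define w where "w q = (if q = p then p' else q)" for q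
    have "x + (1 - slope T p \<bullet> (x - p)) *\<^sub>R (p' - p) = x + u p *\<^sub>R (p' - p)"
      using slope_barycentric[OF T p u(2)] u(3) by simp
    also have "\<dots> = (\<Sum>q\<in>verts T. u q *\<^sub>R w q)"
    proof -
      have "(\<Sum>q\<in>verts T - {p}. u q *\<^sub>R w q) = (\<Sum>q\<in>verts T - {p}. u q *\<^sub>R q)"
        by (rule sum.cong) (auto simp: w_def)
      moreover have "w p = p'" by (simp add: w_def)
      ultimately show ?thesis
        unfolding u(3) using sum.remove[OF verts_finite[OF T] p, of "\<lambda>q. u q *\<^sub>R q"]
          sum.remove[OF verts_finite[OF T] p, of "\<lambda>q. u q *\<^sub>R w q"]
        by (simp add: algebra_simps)
    qed
    also have "\<dots> \<in> T'"
      using u v p' verts_subset[of T'] by (intro convex_sum simplex_convex T' verts_finite T) (auto simp: w_def)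
    finally show ?thesis .
  qed
  have img: "x + (1 - slope T p \<bullet> (x - p)) *\<^sub>R (p' - p) \<in> T' \<longleftrightarrow> x \<in> T" for x
  proof
    let ?y = "x + (1 - slope T p \<bullet> (x - p)) *\<^sub>R (p' - p)"
    assume "?y \<in> T'"
    from maps[OF T' p' T p v[symmetric] this]
    have "?y + (1 - slope T' p' \<bullet> (?y - p')) *\<^sub>R (p - p') \<in> T" .
    moreover have "slope T' p' \<bullet> (?y - p') = slope T p \<bullet> (x - p)"
    proof -
      have "?y - p' = (x - p) + (slope T p \<bullet> (x - p)) *\<^sub>R (p - p')" by (simp add: algebra_simps)
      then show ?thesis using *[OF T p T' p' v, of "x - p"] by (simp only: inner_add_right inner_scaleR_right)
    qed
    moreover have "x + k *\<^sub>R (p' - p) + k *\<^sub>R (p - p') = x" for k by (simp add: scaleR_diff_right)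
    ultimately show "x \<in> T" by simp
  qed (rule maps[OF T p T' p' v])
  have "(LINT x|lebesgue_on T. \<phi> (cone.proj p (slope T p) x)) * measure lebesgue T'
    = (LINT x|lebesgue_on T'. \<phi> (cone.proj p' (slope T' p') x)) * measure lebesgue T"
    by (rule adjacent_cones_eq[OF simplex_cone[OF T p] simplex_cone[OF T' p'] *[OF T p T' p' v]
        *[OF T' p' T p v[symmetric]] img borel_measurable_continuous_onI[OF \<phi>]])
  then show ?thesis
    using measure_simplex_pos[OF T] measure_simplex_pos[OF T']
    by (simp add: side_mean_def mean_def field_simps)
qed

text \<open>By the Cauchy--Schwarz inequality the square of a side mean is at most the mean of \<open>\<phi>\<^sup>2\<close> composed with
  the projection, which the Hausdorff measure of the side controls.\<close>

lemma side_mean_tendsto_0: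
  fixes T :: "'a::euclidean_space set"
  assumes T: "full_simplex T" and p: "p \<in> verts T"
    and pos: "emeasure (hausdorff_measure (DIM('a) - 1) :: 'a measure) B > 0"
    and \<phi>: "\<And>n. continuous_on UNIV (\<phi> n)"
    and lim: "(\<lambda>n. \<integral>\<^sup>+x. ennreal ((\<phi> n x)\<^sup>2) * indicator (side T p) x \<partial>hausdorff_measure (DIM('a) - 1)) \<longlonglongrightarrow> 0"
  shows "(\<lambda>n. side_mean T p (\<phi> n)) \<longlonglongrightarrow> 0"
proof -
  let ?N = "\<lambda>n. \<integral>\<^sup>+x. ennreal ((\<phi> n x)\<^sup>2) * indicator (side T p) x \<partial>hausdorff_measure (DIM('a) - 1)"
  interpret c: cone T p "slope T p" using simplex_cone[OF T p] .
  have S: "side T p \<in> sets borel"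
    unfolding side_def using verts_finite[OF T]
    by (intro borel_compact finite_imp_compact_convex_hull) auto
  obtain k where k: "k > 0" and bound: "\<And>f. f \<in> borel_measurable borel \<Longrightarrow>
    ennreal k * (\<integral>\<^sup>+x. f (c.proj x) \<partial>lebesgue_on T) \<le> (\<integral>\<^sup>+x. f x * indicator (side T p) x \<partial>hausdorff_measure (DIM('a) - 1))"
    using c.integral_proj_le_hausdorff[OF pos S] proj_in_side(2)[OF T p] unfolding c.proj_def c.height_def by blast
  let ?f = "\<lambda>n x. \<phi> n (c.proj x)"
  have [measurable]: "\<phi> n \<in> borel_measurable borel" for n by (rule borel_measurable_continuous_onI[OF \<phi>])
  have f2: "?f n \<in> L2 T" for n
  proof -
    obtain M where "\<And>x. x \<in> T \<Longrightarrow> norm (\<phi> n x) \<le> M" using continuous_bounded_on_compact[OF c.compact \<phi>] by blast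
    then show ?thesis using c.proj_in
      by (intro L2_bounded[where B=M] c.T_lmeasurable AE_I2) (auto intro!: measurable_restrict_space1 measurable_completion)
  qed
  define V where "V = measure lebesgue T"
  have V: "V > 0" using measure_simplex_pos[OF T] by (simp add: V_def)
  have le: "ennreal (k * V * (side_mean T p (\<phi> n))\<^sup>2) \<le> ?N n" for n
  proof -
    have one: "(\<lambda>x. 1::real) \<in> L2 T" by (rule L2_const[OF c.T_lmeasurable])
    have "(V * side_mean T p (\<phi> n))\<^sup>2 = (L2_inner T (\<lambda>x. 1) (?f n))\<^sup>2"
      using integral_eq_mean[OF T, of "?f n"] by (simp add: side_mean_def L2_inner_def V_def)
    also have "\<dots> \<le> L2_inner T (\<lambda>x. 1) (\<lambda>x. 1::real) * L2_inner T (?f n) (?f n)"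
      by (rule L2_inner_Cauchy_Schwarz[OF one f2])
    also have "\<dots> = V * L2_inner T (?f n) (?f n)"
      by (simp add: L2_inner_def V_def measure_restrict_space)
    finally have "V * (side_mean T p (\<phi> n))\<^sup>2 \<le> L2_inner T (?f n) (?f n)"
      using V by (simp add: power2_eq_square mult.left_commute)
    then have "ennreal (k * (V * (side_mean T p (\<phi> n))\<^sup>2)) \<le> ennreal (k * L2_inner T (?f n) (?f n))"
      using k by (intro ennreal_leI mult_left_mono) auto
    also have "\<dots> = ennreal k * (\<integral>\<^sup>+x. ennreal ((?f n x)\<^sup>2) \<partial>lebesgue_on T)"
      using k f2[of n] by (simp add: L2_inner_def ennreal_mult nn_integral_eq_integral L2_def power2_eq_square)
    also have "\<dots> \<le> ?N n"
      by (rule bound[of "\<lambda>x. ennreal ((\<phi> n x)\<^sup>2)"]) measurable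
    finally show ?thesis by (simp add: mult.assoc)
  qed
  have "(\<lambda>n. ennreal (k * V * (side_mean T p (\<phi> n))\<^sup>2)) \<longlonglongrightarrow> ennreal 0"
  proof (rule tendsto_sandwich)
    show "\<forall>\<^sub>F n in sequentially. ennreal (k * V * (side_mean T p (\<phi> n))\<^sup>2) \<le> ?N n"
      using le by simp
    show "\<forall>\<^sub>F n in sequentially. ennreal 0 \<le> ennreal (k * V * (side_mean T p (\<phi> n))\<^sup>2)" by simp
  qed (use lim in simp_all)
  then have "(\<lambda>n. k * V * (side_mean T p (\<phi> n))\<^sup>2) \<longlonglongrightarrow> 0"
    using k V by (subst (asm) tendsto_ennreal_iff) auto
  from tendsto_mult_left[OF this, of "1 / (k * V)"]
  have "(\<lambda>n. (side_mean T p (\<phi> n))\<^sup>2) \<longlonglongrightarrow> 0" using k V by simp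
  then show ?thesis
    using tendsto_real_sqrt[of "\<lambda>n. (side_mean T p (\<phi> n))\<^sup>2" 0] by (simp add: tendsto_rabs_zero_iff)
qed

section \<open>Element-wise functions on a triangulated domain\<close>

lemma borel_measurable_lebesgue_on_AE:
  fixes f g :: "'a::euclidean_space \<Rightarrow> 'b::euclidean_space"
  assumes \<Omega>: "\<Omega> \<in> sets lebesgue" and f: "f \<in> borel_measurable (lebesgue_on \<Omega>)"
    and eq: "AE x in lebesgue_on \<Omega>. f x = g x"
  shows "g \<in> borel_measurable (lebesgue_on \<Omega>)"
proof -
  have "(\<lambda>x. indicator \<Omega> x *\<^sub>R f x) \<in> borel_measurable lebesgue"
    using f \<Omega> by (simp add: borel_measurable_restrict_space_iff)
  moreover have "AE x in lebesgue. indicator \<Omega> x *\<^sub>R f x = indicator \<Omega> x *\<^sub>R g x"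
    using eq \<Omega> by (auto simp: AE_restrict_space_iff elim!: eventually_mono split: split_indicator)
  ultimately have "(\<lambda>x. indicator \<Omega> x *\<^sub>R g x) \<in> borel_measurable lebesgue"
    by (rule borel_measurable_AE)
  then show ?thesis using \<Omega> by (simp add: borel_measurable_restrict_space_iff)
qed

lemma integrable_lebesgue_on_AE:
  fixes f g :: "'a::euclidean_space \<Rightarrow> 'b::euclidean_space"
  assumes "\<Omega> \<in> sets lebesgue" "integrable (lebesgue_on \<Omega>) f" "AE x in lebesgue_on \<Omega>. f x = g x"
  shows "integrable (lebesgue_on \<Omega>) g"
  using integrable_cong_AE_imp[OF assms(2) borel_measurable_lebesgue_on_AE[OF assms(1) borel_measurable_integrable[OF assms(2)] assms(3)]]
    assms(3) by (simp add: AE_symmetric)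

lemma L2_AE:
  assumes "\<Omega> \<in> sets lebesgue" "v \<in> L2 \<Omega>" "AE x in lebesgue_on \<Omega>. v x = w x"
  shows "w \<in> L2 \<Omega>"
proof -
  have "AE x in lebesgue_on \<Omega>. (norm (v x))\<^sup>2 = (norm (w x))\<^sup>2"
    using assms(3) by eventually_elim simp
  from integrable_lebesgue_on_AE[OF assms(1) _ this] borel_measurable_lebesgue_on_AE[OF assms(1) _ assms(3)]
  show ?thesis using assms(2) by (simp add: L2_def)
qed

locale simplicial_mesh =
  fixes \<Omega> :: "'a::euclidean_space set" and \<T> :: "'a set set"
  assumes bounded: "bounded \<Omega>" and lipschitz: "lipschitz_domain \<Omega>"
    and triangulation: "conforming_triangulation \<Omega> \<T>"
begin

lemma open_domain: "open \<Omega>" using lipschitz by (simp add: lipschitz_domain_def)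

lemma domain_lmeasurable: "\<Omega> \<in> lmeasurable" using bounded open_domain by (rule lmeasurable_open)
lemma domain_sets: "\<Omega> \<in> sets lebesgue" using domain_lmeasurable by (rule fmeasurableD)

lemma finite_mesh: "finite \<T>"
  using triangulation by (simp add: conforming_triangulation_def triangulation_def)

lemma element_simplex: "T \<in> \<T> \<Longrightarrow> full_simplex T"
  using triangulation by (simp add: conforming_triangulation_def)

lemma Int_face: "T \<in> \<T> \<Longrightarrow> T' \<in> \<T> \<Longrightarrow> T \<inter> T' face_of T"
  using triangulation by (simp add: conforming_triangulation_def triangulation_def)

lemma cover: "closure \<Omega> = \<Union>\<T>"
  using triangulation by (simp add: conforming_triangulation_def)

lemma interiors_disjoint:
  assumes "T \<in> \<T>" "T' \<in> \<T>" "T \<noteq> T'"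
  shows "interior T \<inter> interior T' = {}"
proof (cases "T \<inter> T' = T")
  case False
  from face_of_disjoint_interior[OF Int_face[OF assms(1,2)] False] show ?thesis
    using interior_subset[of T] interior_subset[of T'] by blast
next
  case True
  then have "T' \<inter> T \<noteq> T'" using assms(3) by auto
  from face_of_disjoint_interior[OF Int_face[OF assms(2,1)] this] show ?thesis
    using interior_subset[of T] interior_subset[of T'] by blast
qed

text \<open>Just below a boundary point, in the direction of the local epigraph, there is an open set of points
  outside \<open>\<Omega>\<close>. Hence no boundary point is interior to the closure of \<open>\<Omega>\<close>.\<close>

lemma interior_subset_domain:
  assumes "T \<in> \<T>" shows "interior T \<subseteq> \<Omega>"
proof
  fix x assume x: "x \<in> interior T"
  have sub: "interior T \<subseteq> closure \<Omega>" using assms cover interior_subset by blast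
  show "x \<in> \<Omega>"
  proof (rule ccontr)
    assume "x \<notin> \<Omega>"
    with x sub open_domain have "x \<in> frontier \<Omega>" by (auto simp: frontier_def interior_open)
    then obtain r e \<gamma> L where r: "r > 0" and e: "norm e = 1" and \<gamma>: "L-lipschitz_on {y. y \<bullet> e = 0} \<gamma>"
      and epi: "\<Omega> \<inter> ball x r = {y \<in> ball x r. \<gamma> (y - (y \<bullet> e) *\<^sub>R e) < y \<bullet> e}"
      using lipschitz unfolding lipschitz_domain_def by blast
    let ?g = "\<lambda>y. \<gamma> (y - (y \<bullet> e) *\<^sub>R e) - y \<bullet> e"
    have ee: "e \<bullet> e = 1" using e by (simp add: dot_square_norm)
    have cont: "continuous_on UNIV ?g"
    proof (intro continuous_intros continuous_on_compose2[OF lipschitz_on_continuous_on[OF \<gamma>]])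
      show "(\<lambda>y. y - (y \<bullet> e) *\<^sub>R e) ` UNIV \<subseteq> {y. y \<bullet> e = 0}"
        by (auto simp: inner_diff_left ee)
    qed
    have gx: "?g x \<ge> 0" using \<open>x \<notin> \<Omega>\<close> epi r by force
    obtain s where s: "s > 0" "ball x s \<subseteq> interior T" using x open_interior open_contains_ball by blast
    define t where "t = min r s / 2"
    have t: "0 < t" "t < r" "t < s" using r s by (auto simp: t_def)
    let ?y = "x - t *\<^sub>R e"
    have d: "dist x ?y = t" using t e by (simp add: dist_norm)
    have e1: "?y - (?y \<bullet> e) *\<^sub>R e = x - (x \<bullet> e) *\<^sub>R e"
      by (simp add: inner_diff_left ee algebra_simps)
    have "?g ?y = ?g x + t" unfolding e1 by (simp add: inner_diff_left ee)
    then have "?g ?y > 0" using gx t by linarith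
    moreover have "open {y. ?g y > 0}" using cont by (rule open_Collect_less[OF continuous_on_const])
    ultimately have o: "open ({y. ?g y > 0} \<inter> ball x r)" "?y \<in> {y. ?g y > 0} \<inter> ball x r"
      using d t by auto
    have "?y \<in> ball x s" using d t(3) by simp
    then have "?y \<in> closure \<Omega>" using s(2) sub by blast
    with o have "({y. ?g y > 0} \<inter> ball x r) \<inter> \<Omega> \<noteq> {}"
      using open_Int_closure_eq_empty[OF o(1), of \<Omega>] by blast
    then show False using epi by force
  qed
qed

lemma skeleton_negligible: "negligible (\<Omega> - element_interiors \<T>)"
proof (rule negligible_subset)
  show "negligible (\<Union>(frontier ` \<T>))"
    using finite_mesh element_simplex
    by (intro negligible_Union) (auto intro: negligible_convex_frontier simplex_convex)
  show "\<Omega> - element_interiors \<T> \<subseteq> \<Union>(frontier ` \<T>)"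
  proof
    fix x assume "x \<in> \<Omega> - element_interiors \<T>"
    then obtain T where "T \<in> \<T>" "x \<in> T" "x \<notin> interior T"
      using cover closure_subset[of \<Omega>] by (auto simp: element_interiors_def)
    then show "x \<in> \<Union>(frontier ` \<T>)"
      using closure_subset[of T] by (auto simp: frontier_def)
  qed
qed

lemma AE_element:
  assumes "\<And>T x. T \<in> \<T> \<Longrightarrow> x \<in> interior T \<Longrightarrow> P x"
  shows "AE x in lebesgue_on \<Omega>. P x"
proof -
  have "AE x in lebesgue. x \<notin> \<Omega> - element_interiors \<T>"
    using skeleton_negligible negligible_iff_null_sets AE_not_in by blast
  then show ?thesis using domain_sets assms
    by (auto simp: AE_restrict_space_iff element_interiors_def elim!: eventually_mono)
qed

text \<open>The default value on the skeleton is zero.\<close>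

definition glue :: "('a set \<Rightarrow> 'a \<Rightarrow> 'b::real_vector) \<Rightarrow> 'a \<Rightarrow> 'b" where
  "glue F x = (\<Sum>T\<in>\<T>. indicator (interior T) x *\<^sub>R F T x)"

lemma glue_eq:
  assumes "T \<in> \<T>" "x \<in> interior T"
  shows "glue F x = F T x"
proof -
  have "glue F x = (\<Sum>T'\<in>\<T>. if T' = T then F T x else 0)"
    unfolding glue_def using assms interiors_disjoint
    by (intro sum.cong) (auto split: split_indicator)
  then show ?thesis using finite_mesh assms by simp
qed

lemma indicator_domain_AE:
  fixes F :: "'a \<Rightarrow> 'b::real_vector"
  shows "AE x in lebesgue. indicator \<Omega> x *\<^sub>R F x = (\<Sum>T\<in>\<T>. indicator (interior T) x *\<^sub>R F x)"
proof -
  have "AE x in lebesgue. x \<notin> \<Omega> - element_interiors \<T>"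
    using skeleton_negligible negligible_iff_null_sets AE_not_in by blast
  then show ?thesis
  proof eventually_elim
    case (elim x)
    show ?case
    proof (cases "x \<in> \<Omega>")
      case True
      then obtain T where T: "T \<in> \<T>" "x \<in> interior T" using elim by (auto simp: element_interiors_def)
      from glue_eq[OF this, of "\<lambda>_. F"] True show ?thesis by (simp add: glue_def)
    next
      case False
      then have "x \<notin> interior T" if "T \<in> \<T>" for T using interior_subset_domain[OF that] by blast
      with False show ?thesis by simp
    qed
  qed
qed

lemma integrable_pieces:
  fixes F :: "'a \<Rightarrow> 'b::euclidean_space"
  assumes "\<And>T. T \<in> \<T> \<Longrightarrow> integrable (lebesgue_on (interior T)) F"
  shows "integrable (lebesgue_on \<Omega>) F"
proof -
  have "integrable lebesgue (\<lambda>x. \<Sum>T\<in>\<T>. indicator (interior T) x *\<^sub>R F x)"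
    using assms by (intro Bochner_Integration.integrable_sum) (simp add: integrable_restrict_space)
  from integrable_lebesgue_on_AE[of UNIV, unfolded lebesgue_on_UNIV_eq, OF _ this AE_symmetric[OF indicator_domain_AE]]
  show ?thesis using domain_sets by (simp add: integrable_restrict_space)
qed

lemma integral_pieces:
  fixes F :: "'a \<Rightarrow> 'b::euclidean_space"
  assumes F: "integrable (lebesgue_on \<Omega>) F"
  shows "T \<in> \<T> \<Longrightarrow> integrable (lebesgue_on (interior T)) F"
    and "(LINT x|lebesgue_on \<Omega>. F x) = (\<Sum>T\<in>\<T>. LINT x|lebesgue_on (interior T). F x)" (is "?L = ?R")
proof -
  have iO: "integrable lebesgue (\<lambda>x. indicator \<Omega> x *\<^sub>R F x)"
    using F domain_sets by (simp add: integrable_restrict_space)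
  have *: "integrable lebesgue (\<lambda>x. indicator (interior T) x *\<^sub>R F x)" if T: "T \<in> \<T>" for T
  proof -
    have "integrable lebesgue (\<lambda>x. indicator (interior T) x *\<^sub>R (indicator \<Omega> x *\<^sub>R F x))"
      by (rule integrable_mult_indicator[OF _ iO]) simp
    moreover have "indicator (interior T) x *\<^sub>R (indicator \<Omega> x *\<^sub>R F x) = indicator (interior T) x *\<^sub>R F x" for x
      using interior_subset_domain[OF T] by (auto split: split_indicator)
    ultimately show ?thesis by (simp only:)
  qed
  then show "T \<in> \<T> \<Longrightarrow> integrable (lebesgue_on (interior T)) F" by (simp add: integrable_restrict_space)
  have "(LINT x|lebesgue_on \<Omega>. F x) = (LINT x|lebesgue. indicator \<Omega> x *\<^sub>R F x)"
    using domain_sets by (simp add: integral_restrict_space)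
  also have "\<dots> = (LINT x|lebesgue. (\<Sum>T\<in>\<T>. indicator (interior T) x *\<^sub>R F x))"
    using * by (intro integral_cong_AE indicator_domain_AE borel_measurable_integrable iO Bochner_Integration.integrable_sum)
  also have "\<dots> = (\<Sum>T\<in>\<T>. (LINT x|lebesgue. indicator (interior T) x *\<^sub>R F x))"
    using * by (intro Bochner_Integration.integral_sum)
  also have "\<dots> = (\<Sum>T\<in>\<T>. LINT x|lebesgue_on (interior T). F x)"
    by (simp add: integral_restrict_space)
  finally show "?L = ?R" .
qed

lemma AE_interior: "T \<in> \<T> \<Longrightarrow> AE x in lborel. x \<in> interior T \<longleftrightarrow> x \<in> T"
proof -
  assume T: "T \<in> \<T>"
  have "frontier T \<in> null_sets lborel"
    using negligible_convex_frontier[OF simplex_convex[OF element_simplex[OF T]]]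
    by (simp add: negligible_iff_null_sets null_sets_completion_iff)
  from AE_not_in[OF this] show ?thesis
    using interior_subset[of T] closure_subset[of T] by (auto simp: frontier_def elim!: eventually_mono)
qed

lemma integral_interior:
  fixes F F' :: "'a \<Rightarrow> 'b::euclidean_space"
  assumes T: "T \<in> \<T>" and F: "\<And>x. x \<in> interior T \<Longrightarrow> F x = F' x" and c: "continuous_on UNIV F'"
  shows "integrable (lebesgue_on (interior T)) F"
    and "(LINT x|lebesgue_on (interior T). F x) = (LINT x|lebesgue_on T. F' x)"
proof -
  have [measurable]: "F' \<in> borel_measurable borel" by (rule borel_measurable_continuous_onI[OF c])
  have [measurable]: "T \<in> sets borel" using simplex_compact[OF element_simplex[OF T]] by (rule borel_compact)
  have cong: "integrable (lebesgue_on (interior T)) F \<longleftrightarrow> integrable (lebesgue_on (interior T)) F'"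
    "(LINT x|lebesgue_on (interior T). F x) = (LINT x|lebesgue_on (interior T). F' x)"
    using F by (auto intro!: Bochner_Integration.integrable_cong Bochner_Integration.integral_cong)
  obtain B where "\<And>x. x \<in> T \<Longrightarrow> norm (F' x) \<le> B"
    using continuous_bounded_on_compact[OF simplex_compact[OF element_simplex[OF T]] c] by blast
  then have "integrable (lebesgue_on (interior T)) F'"
    using interior_subset[of T] compact_imp_bounded[OF simplex_compact[OF element_simplex[OF T]]]
    by (intro integrable_lebesgue_on_bounded[where B=B] lmeasurable_interior) auto
  with cong show "integrable (lebesgue_on (interior T)) F" by simp
  have "(LINT x|lborel. indicator (interior T) x *\<^sub>R F' x) = (LINT x|lborel. indicator T x *\<^sub>R F' x)"
  proof (rule integral_cong_AE)
    show "AE x in lborel. indicator (interior T) x *\<^sub>R F' x = indicator T x *\<^sub>R F' x"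
      using AE_interior[OF T] by eventually_elim (auto split: split_indicator)
  qed measurable
  with cong show "(LINT x|lebesgue_on (interior T). F x) = (LINT x|lebesgue_on T. F' x)"
    by (simp add: integral_lebesgue_on_borel)
qed

definition piecewise_continuous :: "('a \<Rightarrow> 'b::euclidean_space) \<Rightarrow> bool" where
  "piecewise_continuous v \<longleftrightarrow> (\<forall>T\<in>\<T>. \<exists>F. continuous_on UNIV F \<and> (\<forall>x\<in>interior T. v x = F x))"

lemma piecewise_continuous_integrable:
  "piecewise_continuous v \<Longrightarrow> integrable (lebesgue_on \<Omega>) v"
  unfolding piecewise_continuous_def by (intro integrable_pieces) (meson integral_interior(1))

lemma piecewise_continuous_L2:
  fixes v :: "'a \<Rightarrow> 'b::euclidean_space"
  assumes "piecewise_continuous v" shows "v \<in> L2 \<Omega>"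
proof -
  have "piecewise_continuous (\<lambda>x. (norm (v x))\<^sup>2)"
    unfolding piecewise_continuous_def
  proof
    fix T assume "T \<in> \<T>"
    then obtain F where F: "continuous_on UNIV F" "\<forall>x\<in>interior T. v x = F x"
      using assms unfolding piecewise_continuous_def by blast
    show "\<exists>F. continuous_on UNIV F \<and> (\<forall>x\<in>interior T. (norm (v x))\<^sup>2 = F x)"
      by (rule exI[of _ "\<lambda>x. (norm (F x))\<^sup>2"]) (use F in \<open>auto intro!: continuous_intros\<close>)
  qed
  then show ?thesis
    using piecewise_continuous_integrable borel_measurable_integrable[OF piecewise_continuous_integrable[OF assms]]
    by (simp add: L2_def)
qed

lemma P0_piecewise_continuous: "q \<in> P0 \<T> \<Longrightarrow> piecewise_continuous q"
  unfolding piecewise_continuous_def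
proof
  fix T assume "q \<in> P0 \<T>" "T \<in> \<T>"
  then obtain c where "\<forall>x\<in>interior T. q x = c" unfolding P0_def by blast
  then show "\<exists>F. continuous_on UNIV F \<and> (\<forall>x\<in>interior T. q x = F x)"
    by (intro exI[of _ "\<lambda>x. c"]) auto
qed

lemma P0_L2: "q \<in> P0 \<T> \<Longrightarrow> q \<in> L2 \<Omega>"
  by (rule piecewise_continuous_L2[OF P0_piecewise_continuous])

lemma P1_piecewise_continuous:
  assumes "v \<in> P1 \<T>" shows "piecewise_continuous v"
  unfolding piecewise_continuous_def
proof
  fix T assume "T \<in> \<T>"
  then obtain a c where "\<forall>x\<in>interior T. v x = a \<bullet> x + c" using assms unfolding P1_def by blast
  then show "\<exists>F. continuous_on UNIV F \<and> (\<forall>x\<in>interior T. v x = F x)"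
    by (intro exI[of _ "\<lambda>x. a \<bullet> x + c"]) (auto intro!: continuous_intros)
qed

lemma P1_L2: "v \<in> P1 \<T> \<Longrightarrow> v \<in> L2 \<Omega>"
  by (rule piecewise_continuous_L2[OF P1_piecewise_continuous])

lemma L2_inner_pieces:
  assumes "v \<in> L2 \<Omega>" "w \<in> L2 \<Omega>"
  shows "L2_inner \<Omega> v w = (\<Sum>T\<in>\<T>. LINT x|lebesgue_on (interior T). v x \<bullet> w x)"
  unfolding L2_inner_def by (rule integral_pieces(2)[OF L2_inner_integrable[OF assms]])

lemma measure_interior: "T \<in> \<T> \<Longrightarrow> measure lebesgue (interior T) = measure lebesgue T"
  using integral_interior(2)[of T "\<lambda>x. 1::real" "\<lambda>x. 1"] simplex_compact[OF element_simplex[of T]]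
    fmeasurableD[OF lmeasurable_compact[of T]]
  by (simp add: measure_restrict_space)

text \<open>The element means satisfy the orthogonality relation, so a projection exists; conversely, testing with
  element-wise constants determines the projection on the interiors of the elements.\<close>

lemma
  fixes v :: "'a \<Rightarrow> 'b::euclidean_space"
  assumes v: "v \<in> L2 \<Omega>"
  shows L2_proj_P0: "L2_proj \<Omega> \<T> v \<in> P0 \<T>"
    and L2_proj_orth: "q \<in> P0 \<T> \<Longrightarrow> L2_inner \<Omega> (\<lambda>x. v x - L2_proj \<Omega> \<T> v x) q = 0"
    and L2_proj_element: "T \<in> \<T> \<Longrightarrow> x \<in> interior T \<Longrightarrow>
      L2_proj \<Omega> \<T> v x = (LINT x|lebesgue_on (interior T). v x) /\<^sub>R measure lebesgue T"
proof -
  define m where "m T = (LINT x|lebesgue_on (interior T). v x) /\<^sub>R measure lebesgue T" for T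
  have iv: "integrable (lebesgue_on (interior T)) v" if "T \<in> \<T>" for T
    using integral_pieces(1)[OF L2_integrable[OF domain_lmeasurable v] that] .
  have inner: "L2_inner \<Omega> (\<lambda>x. v x - w x) q = (\<Sum>T\<in>\<T>. measure lebesgue T * ((m T - c T) \<bullet> k T))"
    if w: "w \<in> P0 \<T>" "\<And>T x. T \<in> \<T> \<Longrightarrow> x \<in> interior T \<Longrightarrow> w x = c T"
      and q: "q \<in> P0 \<T>" "\<And>T x. T \<in> \<T> \<Longrightarrow> x \<in> interior T \<Longrightarrow> q x = k T" for w q :: "'a \<Rightarrow> 'b" and c k
  proof -
    have L: "w \<in> L2 \<Omega>" "q \<in> L2 \<Omega>" using w q P0_L2 by blast+
    show ?thesis
      unfolding L2_inner_pieces[OF L2_diff[OF v L(1)] L(2)]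
    proof (rule sum.cong[OF refl])
      fix T assume T: "T \<in> \<T>"
      interpret finite_measure "lebesgue_on (interior T)"
        using compact_imp_bounded[OF simplex_compact[OF element_simplex[OF T]]]
        by (intro finite_measure_lebesgue_on lmeasurable_interior)
      have "(LINT x|lebesgue_on (interior T). (v x - w x) \<bullet> q x) = (LINT x|lebesgue_on (interior T). (v x - c T) \<bullet> k T)"
        using w(2)[OF T] q(2)[OF T] by (intro Bochner_Integration.integral_cong) auto
      also have "\<dots> = (LINT x|lebesgue_on (interior T). v x - c T) \<bullet> k T"
        using iv[OF T] by (intro integral_inner_left) auto
      also have "(LINT x|lebesgue_on (interior T). v x - c T) = (LINT x|lebesgue_on (interior T). v x) - measure lebesgue T *\<^sub>R c T"
        using iv[OF T] measure_interior[OF T] by (simp add: measure_restrict_space)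
      also have "(LINT x|lebesgue_on (interior T). v x) = measure lebesgue T *\<^sub>R m T"
        using measure_simplex_pos[OF element_simplex[OF T]] by (simp add: m_def)
      finally show "(LINT x|lebesgue_on (interior T). (v x - w x) \<bullet> q x) = measure lebesgue T * ((m T - c T) \<bullet> k T)"
        by (simp add: inner_diff_left algebra_simps)
    qed
  qed
  have P0_ex: "\<exists>k. \<forall>T\<in>\<T>. \<forall>x\<in>interior T. q x = k T" if "q \<in> P0 \<T>" for q :: "'a \<Rightarrow> 'b"
    using bchoice[of \<T> "\<lambda>T c. \<forall>x\<in>interior T. q x = c"] that by (simp add: P0_def)
  let ?w = "glue (\<lambda>T x. m T)"
  have gP0: "glue (\<lambda>T x. k T) \<in> P0 \<T>" for k :: "'a set \<Rightarrow> 'b"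
    unfolding P0_def
  proof (rule CollectI, rule ballI)
    fix T assume T: "T \<in> \<T>"
    show "\<exists>c. \<forall>x\<in>interior T. glue (\<lambda>T x. k T) x = c"
      by (intro exI ballI) (rule glue_eq[OF T])
  qed
  have w0: "?w \<in> P0 \<T>" by (rule gP0)
  have "\<forall>q\<in>P0 \<T>. L2_inner \<Omega> (\<lambda>x. v x - ?w x) q = 0"
  proof
    fix q :: "'a \<Rightarrow> 'b" assume q: "q \<in> P0 \<T>"
    obtain k where "\<forall>T\<in>\<T>. \<forall>x\<in>interior T. q x = k T" using P0_ex[OF q] by blast
    then have "L2_inner \<Omega> (\<lambda>x. v x - ?w x) q = (\<Sum>T\<in>\<T>. measure lebesgue T * ((m T - m T) \<bullet> k T))"
      by (intro inner w0 q) (simp_all add: glue_eq)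
    then show "L2_inner \<Omega> (\<lambda>x. v x - ?w x) q = 0" by simp
  qed
  with w0 have "\<exists>w. w \<in> P0 \<T> \<and> (\<forall>q\<in>P0 \<T>. L2_inner \<Omega> (\<lambda>x. v x - w x) q = 0)" by blast
  from someI_ex[OF this, folded L2_proj_def]
  have P: "L2_proj \<Omega> \<T> v \<in> P0 \<T>" "\<And>q. q \<in> P0 \<T> \<Longrightarrow> L2_inner \<Omega> (\<lambda>x. v x - L2_proj \<Omega> \<T> v x) q = 0"
    by auto
  then show "L2_proj \<Omega> \<T> v \<in> P0 \<T>" "q \<in> P0 \<T> \<Longrightarrow> L2_inner \<Omega> (\<lambda>x. v x - L2_proj \<Omega> \<T> v x) q = 0" by auto
  obtain c where c: "\<forall>T\<in>\<T>. \<forall>x\<in>interior T. L2_proj \<Omega> \<T> v x = c T" using P0_ex[OF P(1)] by blast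
  show "L2_proj \<Omega> \<T> v x = (LINT x|lebesgue_on (interior T). v x) /\<^sub>R measure lebesgue T"
    if T: "T \<in> \<T>" and x: "x \<in> interior T"
  proof -
    \<comment> \<open>Testing with \<open>m T - c T\<close> on the single element \<open>T\<close> shows that it vanishes.\<close>
    define k where "k T' = (if T' = T then m T - c T else 0)" for T'
    have q: "glue (\<lambda>T x. k T) \<in> P0 \<T>" by (rule gP0)
    have "L2_inner \<Omega> (\<lambda>x. v x - L2_proj \<Omega> \<T> v x) (glue (\<lambda>T x. k T))
      = (\<Sum>T'\<in>\<T>. measure lebesgue T' * ((m T' - c T') \<bullet> k T'))"
      using c by (intro inner P(1) q) (simp_all add: glue_eq)
    then have "0 = (\<Sum>T'\<in>\<T>. measure lebesgue T' * ((m T' - c T') \<bullet> k T'))"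
      using P(2)[OF q] by simp
    also have "\<dots> = (\<Sum>T'\<in>\<T>. if T' = T then measure lebesgue T * ((m T - c T) \<bullet> (m T - c T)) else 0)"
      by (intro sum.cong) (auto simp: k_def)
    also have "\<dots> = measure lebesgue T * ((m T - c T) \<bullet> (m T - c T))"
      using finite_mesh T by simp
    finally have "m T = c T" using measure_simplex_pos[OF element_simplex[OF T]] by simp
    then show ?thesis using c T x by (simp add: m_def)
  qed
qed

lemma L2_proj_continuous_element:
  fixes v F :: "'a \<Rightarrow> 'b::euclidean_space"
  assumes "v \<in> L2 \<Omega>" and T: "T \<in> \<T>" "x \<in> interior T"
    and "\<And>x. x \<in> interior T \<Longrightarrow> v x = F x" "continuous_on UNIV F"
  shows "L2_proj \<Omega> \<T> v x = mean T F"
  using L2_proj_element[OF assms(1) T] integral_interior(2)[OF T(1) assms(4,5)] by (simp add: mean_def)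

lemma L2_inner_proj:
  assumes "v \<in> L2 \<Omega>" "q \<in> P0 \<T>"
  shows "L2_inner \<Omega> q (L2_proj \<Omega> \<T> v) = L2_inner \<Omega> q v"
proof -
  have "L2_proj \<Omega> \<T> v \<in> L2 \<Omega>" "q \<in> L2 \<Omega>"
    using P0_L2 L2_proj_P0 assms by blast+
  then have "L2_inner \<Omega> v q - L2_inner \<Omega> (L2_proj \<Omega> \<T> v) q = 0"
    using L2_proj_orth[OF assms] assms(1) by (simp add: L2_inner_diff_left)
  then show ?thesis by (simp add: L2_inner_commute)
qed

lemma broken_grad_element:
  assumes T: "T \<in> \<T>" and v: "\<And>x. x \<in> interior T \<Longrightarrow> v x = a \<bullet> x + c" and x: "x \<in> interior T"
  shows "broken_grad \<T> v x = a"
proof -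
  have "((\<lambda>x. a \<bullet> x + c) has_derivative (\<lambda>h. a \<bullet> h)) (at x)"
    by (auto intro!: derivative_eq_intros)
  then have "(v has_derivative (\<lambda>h. a \<bullet> h)) (at x)"
    by (rule has_derivative_transform_within_open[OF _ open_interior x]) (use v in auto)
  then have "partial_deriv b v x = a \<bullet> b" for b by (rule partial_deriv_eqI)
  then show ?thesis
    using T x by (auto simp: broken_grad_def grad_def element_interiors_def euclidean_representation)
qed

lemma mesh_size_element: "T \<in> \<T> \<Longrightarrow> x \<in> interior T \<Longrightarrow> mesh_size \<T> x = diameter T"
  using glue_eq[of T x "\<lambda>T x. diameter T"] by (simp add: mesh_size_def glue_def mult.commute)

text \<open>The barycenter is a relative interior point of the side. By conformity the two elements meet in a
  common face; as this face contains such a point, it contains the whole side, and a dimension count makes the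
  side a facet of the other element.\<close>

lemma side_of_two:
  assumes T: "T \<in> \<T>" "p \<in> verts T" and T': "T' \<in> \<T>" and b: "barycenter (side T p) \<in> T'"
  obtains p' where "p' \<in> verts T'" "side T' p' = side T p"
proof -
  let ?S = "side T p" and ?F = "verts T - {p}" and ?d = "real DIM('a)"
  note sT = element_simplex[OF T(1)] and sT' = element_simplex[OF T']
  have card: "card ?F = DIM('a)" using T(2) card_verts[OF sT] verts_finite[OF sT] by simp
  have ind: "\<not> affine_dependent ?F"
    using affine_independent_subset[OF verts_independent[OF sT], of ?F] by blast
  have "barycenter ?S = (\<Sum>q\<in>?F. (1 / ?d) *\<^sub>R q)"
    unfolding barycenter_side[OF sT T(2)] scaleR_sum_right by (simp add: inverse_eq_divide)
  then have rel: "barycenter ?S \<in> rel_interior ?S"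
    unfolding side_def rel_interior_convex_hull_explicit[OF ind]
    using card by (intro CollectI exI[of _ "\<lambda>_. 1 / ?d"]) auto
  have face: "?S face_of T"
    using facet_iff_side[OF sT] T(2) facet_of_imp_face_of by blast
  have bS: "barycenter ?S \<in> T \<inter> T'"
    using rel rel_interior_subset side_subset[OF sT] b by blast
  have S_sub: "?S \<subseteq> T \<inter> T'"
    by (rule subset_of_face_of[OF Int_face[OF T(1) T']]) (use side_subset[OF sT] rel bS in auto)
  have "?S face_of T \<inter> T'" by (rule face_of_subset[OF face S_sub]) auto
  moreover have "T \<inter> T' face_of T'" using Int_face[OF T' T(1)] by (simp add: Int_commute)
  ultimately have face': "?S face_of T'" by (rule face_of_trans)
  have ad: "aff_dim T'' = int DIM('a)" if "full_simplex T''" for T'' :: "'a set"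
    using aff_dim_affine_independent[OF verts_independent[OF that]] card_verts[OF that]
      aff_dim_convex_hull[of "verts T''"] hull_verts[OF that] by simp
  have "?S facet_of T" using facet_iff_side[OF sT] T(2) by blast
  then have "?S facet_of T'" using face' ad[OF sT] ad[OF sT'] by (simp add: facet_of_def)
  then show thesis using facet_iff_side[OF sT'] that by auto
qed

text \<open>Near the barycenter of a side only the elements that have this side are present, and by \<open>match\<close>
  their affine functions all have the same limit there.\<close>

lemma CR\<^sub>D_from_elements:
  assumes aff: "\<And>T x. T \<in> \<T> \<Longrightarrow> l T x = A T \<bullet> x + B T"
    and match: "\<And>T T' p p'. T \<in> \<T> \<Longrightarrow> T' \<in> \<T> \<Longrightarrow> p \<in> verts T \<Longrightarrow> p' \<in> verts T' \<Longrightarrow> side T p = side T' p' \<Longrightarrow>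
      l T (barycenter (side T p)) = l T' (barycenter (side T p))"
    and zero: "\<And>T p. T \<in> \<T> \<Longrightarrow> p \<in> verts T \<Longrightarrow> side T p \<subseteq> \<Gamma> \<Longrightarrow> l T (barycenter (side T p)) = 0"
  shows "glue l \<in> CR\<^sub>D \<Omega> \<Gamma> \<T>"
proof -
  have lim: "(glue l \<longlongrightarrow> l T (barycenter (side T p))) (at (barycenter (side T p)) within element_interiors \<T>)"
    if T: "T \<in> \<T>" "p \<in> verts T" for T p
  proof -
    let ?b = "barycenter (side T p)"
    have one: "(glue l \<longlongrightarrow> l T ?b) (at ?b within interior T')" if T': "T' \<in> \<T>" for T'
    proof (cases "?b \<in> T'")
      case True
      obtain p' where p': "p' \<in> verts T'" "side T' p' = side T p"
        using side_of_two[OF T T' True] by blast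
      then have e: "l T' ?b = l T ?b" using match[OF T(1) T' T(2) p'(1)] by simp
      have "(l T' \<longlongrightarrow> l T' ?b) (at ?b within interior T')"
        unfolding aff[OF T', abs_def] by (intro tendsto_intros)
      then show ?thesis unfolding e
        by (rule Lim_transform_eventually) (auto simp: eventually_at_filter glue_eq[OF T'])
    next
      case False
      have "closed T'" using simplex_compact[OF element_simplex[OF T']] by (rule compact_imp_closed)
      then have "\<not> ?b islimpt interior T'"
        using False interior_subset[of T'] by (meson closed_limpt islimpt_subset)
      then have "at ?b within interior T' = bot" using trivial_limit_within by blast
      then show ?thesis by simp
    qed
    have "(glue l \<longlongrightarrow> l T ?b) (at ?b within (\<Union>T'\<in>M. interior T'))" if "finite M" "M \<subseteq> \<T>" for M
      using that
    proof (induction M rule: finite_induct)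
      case (insert T' M)
      then show ?case using one[of T'] by (simp add: at_within_union filterlim_sup)
    qed simp
    then show ?thesis using finite_mesh by (simp add: element_interiors_def)
  qed
  have sides: "\<exists>T\<in>\<T>. \<exists>p\<in>verts T. S = side T p" if "S \<in> sides \<T>" for S
    using that facet_iff_side[OF element_simplex] unfolding sides_def by blast
  have "glue l \<in> P1 \<T>"
    unfolding P1_def
  proof (rule CollectI, rule ballI)
    fix T assume T: "T \<in> \<T>"
    show "\<exists>a c. \<forall>x\<in>interior T. glue l x = a \<bullet> x + c"
      by (intro exI[of _ "A T"] exI[of _ "B T"] ballI) (simp add: glue_eq[OF T] aff[OF T])
  qed
  moreover have "\<exists>c. (glue l \<longlongrightarrow> c) (at (barycenter S) within element_interiors \<T>)" if "S \<in> interior_sides \<Omega> \<T>" for S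
    using sides[of S] that lim unfolding interior_sides_def by blast
  moreover have "(glue l \<longlongrightarrow> 0) (at (barycenter S) within element_interiors \<T>)" if S: "S \<in> sides \<T>" "S \<subseteq> \<Gamma>" for S
  proof -
    obtain T p where Tp: "T \<in> \<T>" "p \<in> verts T" "S = side T p" using sides[OF S(1)] by blast
    with lim[OF Tp(1,2)] zero[OF Tp(1,2)] S(2) show ?thesis by simp
  qed
  ultimately show ?thesis unfolding CR\<^sub>D_def by blast
qed

end

section \<open>Green's formula for the discrete flux\<close>

lemma C_infinity_grad:
  assumes "\<phi> \<in> C_infinity"
  shows "(\<phi> has_derivative (\<lambda>h. grad \<phi> x \<bullet> h)) (at x)"
    and "continuous_on UNIV (grad \<phi>)" and "continuous_on UNIV \<phi>"
proof -
  have 1: "C_k (Suc 0) \<phi>" "C_k 0 \<phi>" using assms by (simp_all add: C_infinity_def del: C_k.simps)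
  then have d: "(\<phi> has_derivative frechet_derivative \<phi> (at x)) (at x)" for x
    by (intro frechet_derivative_at_UNIV) simp
  have "frechet_derivative \<phi> (at x) h = grad \<phi> x \<bullet> h" for h
  proof -
    have lin: "linear (frechet_derivative \<phi> (at x))" using d has_derivative_linear by blast
    have "frechet_derivative \<phi> (at x) h = frechet_derivative \<phi> (at x) (\<Sum>b\<in>Basis. (h \<bullet> b) *\<^sub>R b)"
      by (simp add: euclidean_representation)
    also have "\<dots> = (\<Sum>b\<in>Basis. (h \<bullet> b) * frechet_derivative \<phi> (at x) b)"
      by (simp add: linear_sum[OF lin] linear_scale[OF lin])
    also have "\<dots> = h \<bullet> grad \<phi> x"
      by (simp add: grad_def partial_deriv_def inner_sum_right mult.commute)
    finally show ?thesis by (simp add: inner_commute)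
  qed
  then have "frechet_derivative \<phi> (at x) = (\<lambda>h. grad \<phi> x \<bullet> h)" by blast
  with d[of x] show "(\<phi> has_derivative (\<lambda>h. grad \<phi> x \<bullet> h)) (at x)" by simp
  show "continuous_on UNIV (grad \<phi>)"
    unfolding grad_def[abs_def] using 1 by (intro continuous_intros) auto
  show "continuous_on UNIV \<phi>" using 1 by simp
qed

context simplicial_mesh
begin

lemma
  fixes A B and l :: "'a set \<Rightarrow> 'a \<Rightarrow> real"
  assumes v: "v \<in> L2 \<Omega>" "\<And>T x. T \<in> \<T> \<Longrightarrow> x \<in> interior T \<Longrightarrow> v x = A T \<bullet> (x - centroid T) + B T"
    and T: "T \<in> \<T>" "x \<in> interior T"
  shows L2_proj_affine: "L2_proj \<Omega> \<T> v x = B T"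
    and broken_grad_affine: "broken_grad \<T> v x = A T"
proof -
  have e: "A T \<bullet> (x - centroid T) + B T = A T \<bullet> x + (B T - A T \<bullet> centroid T)" for x
    by (simp add: inner_diff_right)
  have "L2_proj \<Omega> \<T> v x = mean T (\<lambda>x. A T \<bullet> x + (B T - A T \<bullet> centroid T))"
    using v T e by (intro L2_proj_continuous_element) (auto intro!: continuous_intros)
  then show "L2_proj \<Omega> \<T> v x = B T" by (simp add: mean_affine[OF element_simplex[OF T(1)]])
  show "broken_grad \<T> v x = A T"
    using v(2)[OF T(1)] e by (intro broken_grad_element[OF T(1) _ T(2), where c="B T - A T \<bullet> centroid T"]) auto
qed

lemma integral_interior_const:
  fixes F :: "'a \<Rightarrow> real"
  assumes T: "T \<in> \<T>" and F: "\<And>x. x \<in> interior T \<Longrightarrow> F x = c"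
  shows "(LINT x|lebesgue_on (interior T). F x) = measure lebesgue T * c"
  using integral_interior(2)[OF T F continuous_on_const] fmeasurableD[OF lmeasurable_compact[OF simplex_compact[OF element_simplex[OF T]]]]
  by (simp add: measure_restrict_space)

end

text \<open>The data of the discrete problem that determine the flux: \<open>g T\<close> and \<open>k T\<close> are the values of the
  discrete gradient and of \<open>f\<^sub>h - l\<close> on the element \<open>T\<close>, and \<open>l\<close> is an element-wise constant representative of the
  multiplier.\<close>

locale discrete_obstacle_solution = simplicial_mesh \<Omega> \<T>
  for \<Omega> :: "'a::euclidean_space set" and \<T> +
  fixes \<Gamma> :: "'a set" and u\<^sub>h f\<^sub>h l :: "'a \<Rightarrow> real" and g :: "'a set \<Rightarrow> 'a" and k :: "'a set \<Rightarrow> real"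
  assumes u\<^sub>h: "\<And>T x. T \<in> \<T> \<Longrightarrow> x \<in> interior T \<Longrightarrow> broken_grad \<T> u\<^sub>h x = g T"
    and f\<^sub>h: "f\<^sub>h \<in> P0 \<T>" and l: "l \<in> P0 \<T>"
    and k: "\<And>T x. T \<in> \<T> \<Longrightarrow> x \<in> interior T \<Longrightarrow> f\<^sub>h x - l x = k T"
    and eq: "\<And>v. v \<in> CR\<^sub>D \<Omega> \<Gamma> \<T> \<Longrightarrow> L2_inner \<Omega> l (L2_proj \<Omega> \<T> v) =
      L2_inner \<Omega> f\<^sub>h (L2_proj \<Omega> \<T> v) - L2_inner \<Omega> (broken_grad \<T> u\<^sub>h) (broken_grad \<T> v)"
begin

text \<open>The contribution of an element to the discrete equation, if the test function on \<open>T\<close> is affine with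
  gradient \<open>A\<close> and value \<open>B\<close> at the centroid.\<close>

definition weight :: "'a set \<Rightarrow> 'a \<Rightarrow> real \<Rightarrow> real" where
  "weight T A B = measure lebesgue T * (g T \<bullet> A - k T * B)"

lemma flux_element:
  assumes T: "T \<in> \<T>" "x \<in> interior T"
  shows "discrete_flux \<Omega> \<T> f\<^sub>h u\<^sub>h l x = g T - (k T / real DIM('a)) *\<^sub>R (x - centroid T)"
proof -
  have "(\<lambda>y::'a. y) \<in> L2 \<Omega>" by (intro L2_continuous bounded domain_sets continuous_intros)
  then have "L2_proj \<Omega> \<T> (\<lambda>y. y) x = centroid T"
    using L2_proj_continuous_element[OF _ T, of "\<lambda>y. y" "\<lambda>y. y"] mean_id[OF element_simplex[OF T(1)]]
    by (auto intro!: continuous_intros)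
  moreover have "l x - f\<^sub>h x = - k T" using k[OF T] by simp
  ultimately show ?thesis using u\<^sub>h[OF T] by (simp add: discrete_flux_def)
qed

lemma flux_L2: "discrete_flux \<Omega> \<T> f\<^sub>h u\<^sub>h l \<in> L2 \<Omega>"
proof (rule piecewise_continuous_L2, unfold piecewise_continuous_def, rule ballI)
  fix T assume "T \<in> \<T>"
  then show "\<exists>F. continuous_on UNIV F \<and> (\<forall>x\<in>interior T. discrete_flux \<Omega> \<T> f\<^sub>h u\<^sub>h l x = F x)"
    using flux_element by (intro exI[of _ "\<lambda>x. g T - (k T / real DIM('a)) *\<^sub>R (x - centroid T)"])
      (auto intro!: continuous_intros)
qed

lemma broken_grad_L2: "broken_grad \<T> u\<^sub>h \<in> L2 \<Omega>"
proof (rule P0_L2)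
  show "broken_grad \<T> u\<^sub>h \<in> P0 \<T>" using u\<^sub>h unfolding P0_def by blast
qed

lemma fl_L2: "f\<^sub>h \<in> L2 \<Omega>" "l \<in> L2 \<Omega>"
  using P0_L2 f\<^sub>h l by blast+

lemma discrete_equation_elements:
  assumes aff: "\<And>T x. T \<in> \<T> \<Longrightarrow> m T x = A T \<bullet> (x - centroid T) + B T"
    and match: "\<And>T T' p p'. T \<in> \<T> \<Longrightarrow> T' \<in> \<T> \<Longrightarrow> p \<in> verts T \<Longrightarrow> p' \<in> verts T' \<Longrightarrow> side T p = side T' p' \<Longrightarrow>
      m T (barycenter (side T p)) = m T' (barycenter (side T p))"
    and zero: "\<And>T p. T \<in> \<T> \<Longrightarrow> p \<in> verts T \<Longrightarrow> side T p \<subseteq> \<Gamma> \<Longrightarrow> m T (barycenter (side T p)) = 0"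
  shows "(\<Sum>T\<in>\<T>. weight T (A T) (B T)) = 0"
proof -
  have v: "glue m \<in> CR\<^sub>D \<Omega> \<Gamma> \<T>"
  proof (rule CR\<^sub>D_from_elements[where l=m and A=A and B="\<lambda>T. B T - A T \<bullet> centroid T"])
    show "m T x = A T \<bullet> x + (B T - A T \<bullet> centroid T)" if "T \<in> \<T>" for T x
      using aff[OF that, of x] by (simp add: inner_diff_right)
  qed (fact match zero)+
  then have "glue m \<in> P1 \<T>" by (simp add: CR\<^sub>D_def)
  then have vL: "glue m \<in> L2 \<Omega>" by (rule P1_L2)
  have ve: "glue m x = A T \<bullet> (x - centroid T) + B T" if "T \<in> \<T>" "x \<in> interior T" for T x
    using glue_eq[OF that, of m] aff[OF that(1)] by simp
  note P = L2_proj_affine[OF vL ve] and G = broken_grad_affine[OF vL ve]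
  have PL: "L2_proj \<Omega> \<T> (glue m) \<in> L2 \<Omega>"
    by (intro P0_L2 L2_proj_P0 vL)
  have GL: "broken_grad \<T> (glue m) \<in> L2 \<Omega>"
    by (rule P0_L2) (use G in \<open>auto simp: P0_def\<close>)
  have "(\<Sum>T\<in>\<T>. weight T (A T) (B T))
    = L2_inner \<Omega> (broken_grad \<T> u\<^sub>h) (broken_grad \<T> (glue m)) - L2_inner \<Omega> (\<lambda>x. f\<^sub>h x - l x) (L2_proj \<Omega> \<T> (glue m))"
    unfolding L2_inner_pieces[OF broken_grad_L2 GL] L2_inner_pieces[OF L2_diff[OF fl_L2] PL] sum_subtractf[symmetric]
  proof (rule sum.cong[OF refl])
    fix T assume T: "T \<in> \<T>"
    let ?G = "LINT x|lebesgue_on (interior T). broken_grad \<T> u\<^sub>h x \<bullet> broken_grad \<T> (glue m) x"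
      and ?F = "LINT x|lebesgue_on (interior T). (f\<^sub>h x - l x) \<bullet> L2_proj \<Omega> \<T> (glue m) x"
    have "?G = measure lebesgue T * (g T \<bullet> A T)"
      using u\<^sub>h[OF T] G[OF _ _ T] by (intro integral_interior_const T) simp
    moreover have "?F = measure lebesgue T * (k T * B T)"
      using k[OF T] P[OF _ _ T] by (intro integral_interior_const T) simp
    ultimately show "weight T (A T) (B T) = ?G - ?F"
      by (simp add: weight_def right_diff_distrib)
  qed
  also have "\<dots> = 0" using eq[OF v] by (simp add: L2_inner_commute[of _ _ "L2_proj \<Omega> \<T> (glue m)"] L2_inner_diff_right fl_L2 PL)
  finally show ?thesis .
qed

text \<open>The second summand of the flux contributes the term with \<open>x - x\<^sub>T\<close>, and together with the mean of
  \<open>\<phi>\<close> it is the centroid value of the Crouzeix--Raviart interpolant. This explains the form of the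
  flux.\<close>

lemma flux_residual_elements:
  assumes \<phi>: "\<phi> \<in> C_infinity"
  shows "L2_inner \<Omega> (discrete_flux \<Omega> \<T> f\<^sub>h u\<^sub>h l) (grad \<phi>) - L2_inner \<Omega> (\<lambda>x. f\<^sub>h x - l x) \<phi>
    = (\<Sum>T\<in>\<T>. weight T (mean T (grad \<phi>)) (mean T (\<lambda>x. \<phi> x + (grad \<phi> x \<bullet> (x - centroid T)) / real DIM('a))))"
proof -
  let ?z = "discrete_flux \<Omega> \<T> f\<^sub>h u\<^sub>h l" and ?d = "real DIM('a)"
  note c = C_infinity_grad[OF \<phi>]
  have GL: "grad \<phi> \<in> L2 \<Omega>" "\<phi> \<in> L2 \<Omega>"
    by (intro L2_continuous bounded domain_sets c)+
  show ?thesis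
    unfolding L2_inner_pieces[OF flux_L2 GL(1)] L2_inner_pieces[OF L2_diff[OF fl_L2] GL(2)] sum_subtractf[symmetric]
  proof (rule sum.cong[OF refl])
    fix T assume T: "T \<in> \<T>"
    note sT = element_simplex[OF T]
    note int = integrable_continuous_compact[OF simplex_compact[OF sT]]
    let ?V = "measure lebesgue T" and ?Z = "LINT x|lebesgue_on (interior T). ?z x \<bullet> grad \<phi> x"
      and ?F = "LINT x|lebesgue_on (interior T). (f\<^sub>h x - l x) \<bullet> \<phi> x"
    let ?q = "\<lambda>x. grad \<phi> x \<bullet> (x - centroid T)"
    have i: "integrable (lebesgue_on T) (\<lambda>x. grad \<phi> x \<bullet> g T)" "integrable (lebesgue_on T) ?q"
      "integrable (lebesgue_on T) \<phi>" "integrable (lebesgue_on T) (grad \<phi>)"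
      by (intro int continuous_intros c)+
    have "?Z = (LINT x|lebesgue_on T. (g T - (k T / ?d) *\<^sub>R (x - centroid T)) \<bullet> grad \<phi> x)"
      using flux_element[OF T] by (intro integral_interior T continuous_intros c) simp
    also have "(\<lambda>x. (g T - (k T / ?d) *\<^sub>R (x - centroid T)) \<bullet> grad \<phi> x) = (\<lambda>x. grad \<phi> x \<bullet> g T - (k T / ?d) * ?q x)"
      by (rule ext, subst inner_commute) (simp add: inner_diff_right algebra_simps)
    also have "(LINT x|lebesgue_on T. grad \<phi> x \<bullet> g T - (k T / ?d) * ?q x)
      = ?V * mean T (\<lambda>x. grad \<phi> x \<bullet> g T - (k T / ?d) * ?q x)"
      unfolding integral_eq_mean[OF sT] by simp
    also have "\<dots> = ?V * (mean T (grad \<phi>) \<bullet> g T - (k T / ?d) * mean T ?q)"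
      using i mean_mult[of T "k T / ?d" ?q] by (subst mean_diff) (auto simp: mean_inner)
    finally have 1: "?Z = ?V * (mean T (grad \<phi>) \<bullet> g T - (k T / ?d) * mean T ?q)" .
    have "?F = (LINT x|lebesgue_on T. k T * \<phi> x)"
      using k[OF T] by (intro integral_interior T continuous_intros c) simp
    also have "\<dots> = ?V * (k T * mean T \<phi>)"
      unfolding integral_eq_mean[OF sT] by (simp add: mean_mult)
    finally have 2: "?F = ?V * (k T * mean T \<phi>)" .
    have 3: "mean T (\<lambda>x. \<phi> x + ?q x / ?d) = mean T \<phi> + mean T ?q / ?d"
      using mean_add[OF i(3), of "\<lambda>x. (1 / ?d) * ?q x"] mean_mult[of T "1 / ?d" ?q] i(2) by simp
    show "?Z - ?F = weight T (mean T (grad \<phi>)) (mean T (\<lambda>x. \<phi> x + ?q x / ?d))"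
      unfolding 1 2 3 weight_def by (simp add: inner_commute algebra_simps)
  qed
qed

text \<open>By \<open>flux_residual_elements\<close> the residual is the sum of the weights of the Crouzeix--Raviart
  interpolant of \<open>\<phi>\<close>. That interpolant need not vanish on the Dirichlet sides; subtracting there the side means
  times the local basis functions gives an admissible test function, for which the sum of the weights is zero.\<close>

lemma flux_residual_boundary:
  assumes \<phi>: "\<phi> \<in> C_infinity"
  shows "L2_inner \<Omega> (discrete_flux \<Omega> \<T> f\<^sub>h u\<^sub>h l) (grad \<phi>) - L2_inner \<Omega> (\<lambda>x. f\<^sub>h x - l x) \<phi>
    = (\<Sum>T\<in>\<T>. \<Sum>p\<in>{p\<in>verts T. side T p \<subseteq> \<Gamma>}.
        side_mean T p \<phi> * weight T (real DIM('a) *\<^sub>R slope T p) (side_hat T p (centroid T)))"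
proof -
  let ?d = "real DIM('a)"
  note c = C_infinity_grad[OF \<phi>]
  define A where "A T = mean T (grad \<phi>)" for T
  define B where "B T = mean T (\<lambda>x. \<phi> x + (grad \<phi> x \<bullet> (x - centroid T)) / ?d)" for T
  define D where "D T = {p\<in>verts T. side T p \<subseteq> \<Gamma>}" for T
  define a where "a T p = side_mean T p \<phi>" for T p
  define A' where "A' T = A T - (\<Sum>p\<in>D T. a T p *\<^sub>R (?d *\<^sub>R slope T p))" for T
  define B' where "B' T = B T - (\<Sum>p\<in>D T. a T p * side_hat T p (centroid T))" for T
  define m where "m T x = A' T \<bullet> (x - centroid T) + B' T" for T x
  have hat: "side_hat T p x = (?d *\<^sub>R slope T p) \<bullet> (x - centroid T) + side_hat T p (centroid T)" for T :: "'a set" and p x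
    by (simp add: side_hat_def inner_diff_right algebra_simps)
  have m: "m T x = A T \<bullet> (x - centroid T) + B T - (\<Sum>p\<in>D T. a T p * side_hat T p x)" for T x
    unfolding m_def A'_def B'_def hat[of _ _ x]
    by (simp add: inner_diff_left inner_sum_left sum.distrib distrib_left mult.assoc)
  have val: "m T (barycenter (side T q)) = (if side T q \<subseteq> \<Gamma> then 0 else side_mean T q \<phi>)"
    if T: "T \<in> \<T>" and q: "q \<in> verts T" for T q
  proof -
    note sT = element_simplex[OF T]
    have "(\<Sum>p\<in>D T. a T p * side_hat T p (barycenter (side T q))) = (\<Sum>p\<in>D T. if p = q then a T q else 0)"
      using side_hat_barycenter[OF sT _ q] by (intro sum.cong) (auto simp: D_def)
    also have "\<dots> = (if q \<in> D T then a T q else 0)"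
      using verts_finite[OF sT] by (simp add: D_def)
    finally show ?thesis
      using affine_interpolant_at_barycenter[OF sT q c(1,2)] q
      by (simp add: m A_def B_def a_def D_def)
  qed
  have "(\<Sum>T\<in>\<T>. weight T (A' T) (B' T)) = 0"
  proof (rule discrete_equation_elements[where m=m])
    fix T T' p p' assume *: "T \<in> \<T>" "T' \<in> \<T>" "p \<in> verts T" "p' \<in> verts T'" "side T p = side T' p'"
    have "side_mean T p \<phi> = side_mean T' p' \<phi>"
      by (rule side_mean_adjacent[OF element_simplex[OF *(1)] *(3) element_simplex[OF *(2)] *(4,5) c(3)])
    then show "m T (barycenter (side T p)) = m T' (barycenter (side T p))"
      using val[OF *(1,3)] val[OF *(2,4)] *(5) by simp
  qed (use val in \<open>auto simp: m_def\<close>)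
  moreover have "weight T (A' T) (B' T) = weight T (A T) (B T)
      - (\<Sum>p\<in>D T. a T p * weight T (?d *\<^sub>R slope T p) (side_hat T p (centroid T)))" for T
    unfolding weight_def A'_def B'_def
    by (simp add: inner_diff_right inner_sum_right sum_distrib_left sum_subtractf algebra_simps)
  ultimately show ?thesis
    unfolding flux_residual_elements[OF \<phi>] by (simp add: sum_subtractf A_def B_def D_def a_def)
qed

text \<open>Along smooth functions that converge to \<open>w\<close>, the residual converges because it is continuous in
  \<open>L\<^sup>2\<close>, and the Dirichlet side means tend to zero because the trace of \<open>w\<close> vanishes on \<open>\<Gamma>\<close>.\<close>

lemma flux_Green:
  assumes w: "w \<in> H1\<^sub>D \<Omega> \<Gamma>" and \<Gamma>: "\<Gamma> \<subseteq> frontier \<Omega>"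
    and pos: "emeasure (hausdorff_measure (DIM('a) - 1) :: 'a measure) \<Gamma> > 0"
  shows "L2_inner \<Omega> (discrete_flux \<Omega> \<T> f\<^sub>h u\<^sub>h l) (weak_grad \<Omega> w) = L2_inner \<Omega> (\<lambda>x. f\<^sub>h x - l x) w"
proof -
  let ?z = "discrete_flux \<Omega> \<T> f\<^sub>h u\<^sub>h l" and ?H = "hausdorff_measure (DIM('a) - 1) :: 'a measure"
  have wH: "w \<in> H1 \<Omega>" and wL: "w \<in> L2 \<Omega>" using w by (auto simp: H1\<^sub>D_def H1_def)
  note wgL = weak_grad_works(1)[OF wH]
  obtain b where tr: "has_trace \<Omega> w b" and b0: "AE x in surface_measure \<Omega>. x \<in> \<Gamma> \<longrightarrow> b x = 0"
    using w by (auto simp: H1\<^sub>D_def)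
  then obtain \<phi> where \<phi>: "\<And>n. \<phi> n \<in> C_infinity" "L2_tendsto (lebesgue_on \<Omega>) \<phi> w"
    "L2_tendsto (lebesgue_on \<Omega>) (\<lambda>n. grad (\<phi> n)) (weak_grad \<Omega> w)" "L2_tendsto (surface_measure \<Omega>) \<phi> b"
    by (auto simp: has_trace_def)
  have L: "\<phi> n \<in> L2 \<Omega>" "grad (\<phi> n) \<in> L2 \<Omega>" for n
    by (intro L2_continuous bounded domain_sets C_infinity_grad \<phi>)+
  have lim: "(\<lambda>n. L2_inner \<Omega> ?z (grad (\<phi> n)) - L2_inner \<Omega> (\<lambda>x. f\<^sub>h x - l x) (\<phi> n))
    \<longlonglongrightarrow> L2_inner \<Omega> ?z (weak_grad \<Omega> w) - L2_inner \<Omega> (\<lambda>x. f\<^sub>h x - l x) w"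
    by (intro tendsto_diff L2_inner_tendsto[OF flux_L2 wgL L(2) \<phi>(3)]
        L2_inner_tendsto[OF L2_diff[OF fl_L2] wL L(1) \<phi>(2)])
  have side0: "(\<lambda>n. side_mean T p (\<phi> n)) \<longlonglongrightarrow> 0"
    if T: "T \<in> \<T>" "p \<in> verts T" "side T p \<subseteq> \<Gamma>" for T p
  proof (rule side_mean_tendsto_0[OF element_simplex[OF T(1)] T(2) pos])
    show "continuous_on UNIV (\<phi> n)" for n by (rule C_infinity_grad(3)[OF \<phi>(1)])
    have fr: "frontier \<Omega> \<inter> space ?H \<in> sets ?H"
      using sets_eq_imp_space_eq[OF sets_hausdorff_measure] by (simp add: sets_hausdorff_measure)
    have le: "(\<integral>\<^sup>+x. ennreal ((\<phi> n x)\<^sup>2) * indicator (side T p) x \<partial>?H)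
      \<le> (\<integral>\<^sup>+x. ennreal ((norm (\<phi> n x - b x))\<^sup>2) \<partial>surface_measure \<Omega>)" (is "?N \<le> ?S") for n
    proof -
      have "?N = (\<integral>\<^sup>+x. (ennreal ((\<phi> n x)\<^sup>2) * indicator (side T p) x) * indicator (frontier \<Omega>) x \<partial>?H)"
        using T(3) \<Gamma> by (intro nn_integral_cong) (auto split: split_indicator)
      also have "\<dots> = (\<integral>\<^sup>+x. ennreal ((\<phi> n x)\<^sup>2) * indicator (side T p) x \<partial>surface_measure \<Omega>)"
        unfolding surface_measure_def by (rule nn_integral_restrict_space[OF fr, symmetric])
      also have "\<dots> \<le> ?S"
        by (rule nn_integral_mono_AE, use b0 in eventually_elim) (use T(3) in \<open>auto split: split_indicator\<close>)
      finally show ?thesis .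
    qed
    show "(\<lambda>n. \<integral>\<^sup>+x. ennreal ((\<phi> n x)\<^sup>2) * indicator (side T p) x \<partial>?H) \<longlonglongrightarrow> 0"
      by (rule tendsto_sandwich[OF _ _ tendsto_const \<phi>(4)[unfolded L2_tendsto_def]])
        (use le in auto)
  qed
  have "(\<lambda>n. \<Sum>T\<in>\<T>. \<Sum>p\<in>{p\<in>verts T. side T p \<subseteq> \<Gamma>}.
        side_mean T p (\<phi> n) * weight T (real DIM('a) *\<^sub>R slope T p) (side_hat T p (centroid T))) \<longlonglongrightarrow> 0"
    by (intro tendsto_null_sum tendsto_mult_left_zero side0) auto
  then have "(\<lambda>n. L2_inner \<Omega> ?z (grad (\<phi> n)) - L2_inner \<Omega> (\<lambda>x. f\<^sub>h x - l x) (\<phi> n)) \<longlonglongrightarrow> 0"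
    unfolding flux_residual_boundary[OF \<phi>(1)] .
  from LIMSEQ_unique[OF this lim] show ?thesis by simp
qed

lemma flux_correction_bound:
  assumes T: "T \<in> \<T>" "x \<in> interior T"
  shows "(norm (discrete_flux \<Omega> \<T> f\<^sub>h u\<^sub>h l x - broken_grad \<T> u\<^sub>h x))\<^sup>2
    \<le> 1 / (real DIM('a))\<^sup>2 * (mesh_size \<T> x * (f\<^sub>h x - l x))\<^sup>2"
proof -
  have "norm (x - centroid T) \<le> diameter T"
    using diameter_bounded_bound[OF compact_imp_bounded[OF simplex_compact] _ centroid_in, of T x]
      element_simplex[OF T(1)] T(2) interior_subset[of T] by (auto simp: dist_norm)
  then have "(\<bar>k T\<bar> / real DIM('a) * norm (x - centroid T))\<^sup>2 \<le> (\<bar>k T\<bar> / real DIM('a) * diameter T)\<^sup>2"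
    by (intro power_mono mult_left_mono) auto
  then show ?thesis
    using flux_element[OF T] u\<^sub>h[OF T] k[OF T] mesh_size_element[OF T]
    by (simp add: power_mult_distrib power_divide mult_ac)
qed

end

section \<open>The error estimate\<close>

theorem lemma5p2:
  fixes \<Omega> \<Gamma>\<^sub>D \<Gamma>\<^sub>N :: "(real ^ 'n) set"
    and \<F> :: "(real ^ 'n) set set set"
    and \<T> :: "(real ^ 'n) set set"
    and f chi u :: "real ^ 'n \<Rightarrow> real"
    and z :: "real ^ 'n \<Rightarrow> real ^ 'n"
    and \<Lambda> :: "(real ^ 'n \<Rightarrow> real) \<Rightarrow> real"
    and f\<^sub>h chi\<^sub>h u\<^sub>h lam\<^sub>h :: "real ^ 'n \<Rightarrow> real"
    and z\<^sub>h :: "real ^ 'n \<Rightarrow> real ^ 'n"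
  assumes domain: "bounded \<Omega>" "lipschitz_domain \<Omega>" "polyhedral \<Omega>"
    and boundary: "frontier \<Omega> = \<Gamma>\<^sub>D \<union> \<Gamma>\<^sub>N" "\<Gamma>\<^sub>D \<inter> \<Gamma>\<^sub>N = {}" "closed \<Gamma>\<^sub>D"
      "emeasure (hausdorff_measure (CARD('n) - 1)) \<Gamma>\<^sub>D > 0"
    and mesh: "shape_regular_family \<Omega> \<F>" "\<T> \<in> \<F>"
      "\<forall>S\<in>boundary_sides \<Omega> \<T>. S \<subseteq> \<Gamma>\<^sub>D \<or> S \<subseteq> closure \<Gamma>\<^sub>N"
    and f: "f \<in> L2 \<Omega>"
    and chi: "chi \<in> H1 \<Omega>"
      "\<exists>g. has_trace \<Omega> chi g \<and> (AE x in surface_measure \<Omega>. x \<in> \<Gamma>\<^sub>D \<longrightarrow> g x \<le> 0)"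
    and u: "is_arg_min (energy \<Omega> f) (\<lambda>v. v \<in> admissible \<Omega> \<Gamma>\<^sub>D chi) u"
    and z: "z = weak_grad \<Omega> u"
    and \<Lambda>: "\<Lambda> \<in> dual_H1\<^sub>D \<Omega> \<Gamma>\<^sub>D"
      "\<forall>v\<in>H1\<^sub>D \<Omega> \<Gamma>\<^sub>D. \<Lambda> v = L2_inner \<Omega> f v - L2_inner \<Omega> (weak_grad \<Omega> u) (weak_grad \<Omega> v)"
    and f\<^sub>h: "f\<^sub>h = L2_proj \<Omega> \<T> f"
    and chi\<^sub>h: "chi\<^sub>h \<in> P0 \<T>"
    and u\<^sub>h: "is_arg_min (energy_cr \<Omega> \<T> f\<^sub>h) (\<lambda>v. v \<in> admissible_cr \<Omega> \<Gamma>\<^sub>D \<T> chi\<^sub>h) u\<^sub>h"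
    and lam\<^sub>h: "lam\<^sub>h \<in> proj_CR\<^sub>D \<Omega> \<Gamma>\<^sub>D \<T>"
      "AE x in lebesgue_on \<Omega>. lam\<^sub>h x \<le> 0"
      "\<forall>v\<in>CR\<^sub>D \<Omega> \<Gamma>\<^sub>D \<T>. L2_inner \<Omega> lam\<^sub>h (L2_proj \<Omega> \<T> v) =
         L2_inner \<Omega> f\<^sub>h (L2_proj \<Omega> \<T> v) - L2_inner \<Omega> (broken_grad \<T> u\<^sub>h) (broken_grad \<T> v)"
    and z\<^sub>h: "z\<^sub>h = discrete_flux \<Omega> \<T> f\<^sub>h u\<^sub>h lam\<^sub>h"
    and f_eq: "AE x in lebesgue_on \<Omega>. f x = f\<^sub>h x" "f\<^sub>h \<in> P0 \<T>"
  shows "\<forall>v\<in>admissible \<Omega> \<Gamma>\<^sub>D chi.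
      1/2 * (L2_norm \<Omega> (\<lambda>x. weak_grad \<Omega> v x - weak_grad \<Omega> u x))\<^sup>2
        + (- \<Lambda> (\<lambda>x. v x - u x))
        + 1/2 * (L2_norm \<Omega> (\<lambda>x. z\<^sub>h x - z x))\<^sup>2
      \<le> 1/2 * (L2_norm \<Omega> (\<lambda>x. weak_grad \<Omega> v x - z\<^sub>h x))\<^sup>2 + eta_B_sq \<Omega> \<T> chi lam\<^sub>h v
    \<and> 1/2 * (L2_norm \<Omega> (\<lambda>x. weak_grad \<Omega> v x - z\<^sub>h x))\<^sup>2 + eta_B_sq \<Omega> \<T> chi lam\<^sub>h v
      \<le> eta_A_sq \<Omega> \<T> u\<^sub>h v + eta_B_sq \<Omega> \<T> chi lam\<^sub>h v + eta_C_sq \<Omega> \<T> f\<^sub>h lam\<^sub>h"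
proof
  fix v assume vK: "v \<in> admissible \<Omega> \<Gamma>\<^sub>D chi"
  interpret simplicial_mesh \<Omega> \<T>
    using domain mesh by unfold_locales (auto simp: shape_regular_family_def)
  let ?d = "real DIM(real ^ 'n)"
  have \<Gamma>: "\<Gamma>\<^sub>D \<subseteq> frontier \<Omega>" using boundary(1) by auto
  have pos: "emeasure (hausdorff_measure (DIM(real ^ 'n) - 1)) \<Gamma>\<^sub>D > 0" using boundary(4) by simp
  have uK: "u \<in> admissible \<Omega> \<Gamma>\<^sub>D chi" using u by (simp add: is_arg_min_def)
  have H: "v \<in> H1\<^sub>D \<Omega> \<Gamma>\<^sub>D" "u \<in> H1\<^sub>D \<Omega> \<Gamma>\<^sub>D" using vK uK by (auto simp: admissible_def)
  then have H': "v \<in> H1 \<Omega>" "u \<in> H1 \<Omega>" by (auto simp: H1\<^sub>D_def)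
  then have vL: "v \<in> L2 \<Omega>" and uL: "u \<in> L2 \<Omega>" and cL: "chi \<in> L2 \<Omega>" using chi(1) by (auto simp: H1_def)
  note gvL = weak_grad_works(1)[OF H'(1)] and guL = weak_grad_works(1)[OF H'(2)]
  \<comment> \<open>The multiplier is element-wise constant only almost everywhere; \<open>l\<close> is a genuine representative.\<close>
  obtain w where w: "w \<in> CR\<^sub>D \<Omega> \<Gamma>\<^sub>D \<T>" and lw: "AE x in lebesgue_on \<Omega>. lam\<^sub>h x = L2_proj \<Omega> \<T> w x"
    using lam\<^sub>h(1) by (auto simp: proj_CR\<^sub>D_def)
  define l where "l = L2_proj \<Omega> \<T> w"
  have "w \<in> P1 \<T>" using w by (simp add: CR\<^sub>D_def)
  then have l: "l \<in> P0 \<T>"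
    unfolding l_def by (intro L2_proj_P0[OF P1_L2])
  have ll: "AE x in lebesgue_on \<Omega>. lam\<^sub>h x = l x" using lw by (simp add: l_def)
  have lL: "l \<in> L2 \<Omega>" by (intro P0_L2 l)
  have lamL: "lam\<^sub>h \<in> L2 \<Omega>" by (rule L2_AE[OF domain_sets lL]) (use ll in \<open>auto elim: eventually_mono\<close>)
  have fhL: "f\<^sub>h \<in> L2 \<Omega>" by (intro P0_L2 f_eq(2))
  have lam_inner: "L2_inner \<Omega> lam\<^sub>h q = L2_inner \<Omega> l q" if "q \<in> L2 \<Omega>" for q
    by (rule L2_inner_cong_AE[OF _ lamL that lL that]) (use ll in \<open>auto elim: eventually_mono\<close>)
  have "u\<^sub>h \<in> CR\<^sub>D \<Omega> \<Gamma>\<^sub>D \<T>" using u\<^sub>h by (simp add: is_arg_min_def admissible_cr_def)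
  then have uP1: "u\<^sub>h \<in> P1 \<T>" by (simp add: CR\<^sub>D_def)
  have "\<forall>T\<in>\<T>. \<exists>a. \<forall>x\<in>interior T. broken_grad \<T> u\<^sub>h x = a"
  proof
    fix T assume T: "T \<in> \<T>"
    then obtain a c where "\<forall>x\<in>interior T. u\<^sub>h x = a \<bullet> x + c" using uP1 unfolding P1_def by blast
    then show "\<exists>a. \<forall>x\<in>interior T. broken_grad \<T> u\<^sub>h x = a"
      by (intro exI[of _ a] ballI broken_grad_element[OF T]) auto
  qed
  from bchoice[OF this] obtain g where g: "\<And>T x. T \<in> \<T> \<Longrightarrow> x \<in> interior T \<Longrightarrow> broken_grad \<T> u\<^sub>h x = g T" by auto
  have "\<forall>T\<in>\<T>. \<exists>c. \<forall>x\<in>interior T. f\<^sub>h x - l x = c"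
  proof
    fix T assume T: "T \<in> \<T>"
    obtain c c' where "\<forall>x\<in>interior T. f\<^sub>h x = c" "\<forall>x\<in>interior T. l x = c'"
      using f_eq(2) l T unfolding P0_def by blast
    then show "\<exists>c. \<forall>x\<in>interior T. f\<^sub>h x - l x = c" by (intro exI[of _ "c - c'"]) auto
  qed
  from bchoice[OF this] obtain k where k: "\<And>T x. T \<in> \<T> \<Longrightarrow> x \<in> interior T \<Longrightarrow> f\<^sub>h x - l x = k T" by auto
  have eq: "L2_inner \<Omega> l (L2_proj \<Omega> \<T> q) =
      L2_inner \<Omega> f\<^sub>h (L2_proj \<Omega> \<T> q) - L2_inner \<Omega> (broken_grad \<T> u\<^sub>h) (broken_grad \<T> q)"
    if q: "q \<in> CR\<^sub>D \<Omega> \<Gamma>\<^sub>D \<T>" for q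
  proof -
    have "q \<in> P1 \<T>" using q by (simp add: CR\<^sub>D_def)
    then have "L2_proj \<Omega> \<T> q \<in> L2 \<Omega>"
      by (intro P0_L2 L2_proj_P0[OF P1_L2])
    then show ?thesis using bspec[OF lam\<^sub>h(3) q] by (simp add: lam_inner)
  qed
  let ?y = "discrete_flux \<Omega> \<T> f\<^sub>h u\<^sub>h l"
  interpret discrete_obstacle_solution \<Omega> \<T> \<Gamma>\<^sub>D u\<^sub>h f\<^sub>h l g k
    by unfold_locales (fact g f_eq(2) l k eq)+
  note Green = flux_Green[OF _ \<Gamma> pos]
  have zy: "AE x in lebesgue_on \<Omega>. z\<^sub>h x = ?y x"
    using ll by eventually_elim (simp add: z\<^sub>h discrete_flux_def)
  have zL: "z\<^sub>h \<in> L2 \<Omega>" by (rule L2_AE[OF domain_sets flux_L2]) (use zy in \<open>auto elim: eventually_mono\<close>)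
  have z_inner: "L2_inner \<Omega> z\<^sub>h q = L2_inner \<Omega> ?y q" if "q \<in> L2 \<Omega>" for q
    by (rule L2_inner_cong_AE[OF _ zL that flux_L2 that]) (use zy in \<open>auto elim: eventually_mono\<close>)
  have f_inner: "L2_inner \<Omega> f q = L2_inner \<Omega> f\<^sub>h q" if "q \<in> L2 \<Omega>" for q
    by (rule L2_inner_cong_AE[OF _ f that fhL that]) (use f_eq(1) in \<open>auto elim: eventually_mono\<close>)
  let ?gv = "weak_grad \<Omega> v" and ?gu = "weak_grad \<Omega> u"
  \<comment> \<open>Applied to \<open>v\<close> and \<open>u\<close> separately, the formula needs no weak gradient of \<open>v - u\<close>.\<close>
  have green: "L2_inner \<Omega> z\<^sub>h ?gv = L2_inner \<Omega> f\<^sub>h v - L2_inner \<Omega> l v"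
    "L2_inner \<Omega> z\<^sub>h ?gu = L2_inner \<Omega> f\<^sub>h u - L2_inner \<Omega> l u"
    using Green[OF H(1)] Green[OF H(2)] z_inner[OF gvL] z_inner[OF guL]
    by (simp_all add: L2_inner_diff_left fhL lL vL uL)
  have Lam: "\<Lambda> (\<lambda>x. v x - u x) = (L2_inner \<Omega> f\<^sub>h v - L2_inner \<Omega> ?gu ?gv) - (L2_inner \<Omega> f\<^sub>h u - L2_inner \<Omega> ?gu ?gu)"
    using dual_H1\<^sub>D_diff[OF open_domain bounded \<Lambda>(1) H] \<Lambda>(2) H by (simp add: f_inner vL uL)
  have etaB: "eta_B_sq \<Omega> \<T> chi lam\<^sub>h v = L2_inner \<Omega> l chi - L2_inner \<Omega> l v"
  proof -
    have d: "(\<lambda>x. v x - chi x) \<in> L2 \<Omega>" by (intro L2_diff vL cL)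
    have P: "L2_proj \<Omega> \<T> (\<lambda>x. v x - chi x) \<in> L2 \<Omega>"
      by (intro P0_L2 L2_proj_P0 d)
    have "eta_B_sq \<Omega> \<T> chi lam\<^sub>h v = - L2_inner \<Omega> lam\<^sub>h (L2_proj \<Omega> \<T> (\<lambda>x. v x - chi x))"
      by (simp add: eta_B_sq_def L2_inner_def)
    also have "\<dots> = - L2_inner \<Omega> l (\<lambda>x. v x - chi x)"
      by (simp add: lam_inner P L2_inner_proj[OF d l])
    finally show ?thesis by (simp add: L2_inner_diff_right lL vL cL)
  qed
  have compl: "L2_inner \<Omega> l u - L2_inner \<Omega> l chi \<le> 0"
  proof -
    have "L2_inner \<Omega> l (\<lambda>x. u x - chi x) \<le> L2_inner \<Omega> l (\<lambda>x. 0)"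
      unfolding L2_inner_def
    proof (rule integral_mono_AE)
      show "integrable (lebesgue_on \<Omega>) (\<lambda>x. l x \<bullet> (u x - chi x))"
        by (intro L2_inner_integrable L2_diff lL uL cL)
      have "AE x in lebesgue_on \<Omega>. chi x \<le> u x" using uK by (simp add: admissible_def)
      then show "AE x in lebesgue_on \<Omega>. l x \<bullet> (u x - chi x) \<le> l x \<bullet> 0"
        using lam\<^sub>h(2) ll by eventually_elim (simp add: mult_nonpos_nonneg)
    qed simp
    then show ?thesis by (simp add: L2_inner_diff_right lL uL cL) (simp add: L2_inner_def)
  qed
  have sq: "(L2_norm \<Omega> (\<lambda>x. p x - q x))\<^sup>2 = L2_inner \<Omega> p p - 2 * L2_inner \<Omega> p q + L2_inner \<Omega> q q"
    if "p \<in> L2 \<Omega>" "q \<in> L2 \<Omega>" for p q :: "real ^ 'n \<Rightarrow> real ^ 'n"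
    using that by (simp add: L2_norm_sq L2_inner_diff_left L2_inner_diff_right L2_diff L2_inner_commute[of \<Omega> q p])
  let ?lhs = "1/2 * (L2_norm \<Omega> (\<lambda>x. ?gv x - ?gu x))\<^sup>2 + (- \<Lambda> (\<lambda>x. v x - u x))
      + 1/2 * (L2_norm \<Omega> (\<lambda>x. z\<^sub>h x - z x))\<^sup>2"
    and ?mid = "1/2 * (L2_norm \<Omega> (\<lambda>x. ?gv x - z\<^sub>h x))\<^sup>2" and ?B = "eta_B_sq \<Omega> \<T> chi lam\<^sub>h v"
  have first: "?lhs \<le> ?mid + ?B"
    unfolding z sq[OF gvL guL] sq[OF zL guL] sq[OF gvL zL] Lam etaB
    using green compl L2_inner_commute[of \<Omega> ?gv z\<^sub>h] L2_inner_commute[of \<Omega> ?gv ?gu]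
    by argo
  have second: "?mid \<le> eta_A_sq \<Omega> \<T> u\<^sub>h v + eta_C_sq \<Omega> \<T> f\<^sub>h lam\<^sub>h"
  proof -
    let ?a = "\<lambda>x. ?gv x - broken_grad \<T> u\<^sub>h x" and ?e = "\<lambda>x. z\<^sub>h x - broken_grad \<T> u\<^sub>h x"
      and ?m = "\<lambda>x. mesh_size \<T> x * (f\<^sub>h x - lam\<^sub>h x)"
    have aL: "?a \<in> L2 \<Omega>" "?e \<in> L2 \<Omega>" "(\<lambda>x. ?gv x - z\<^sub>h x) \<in> L2 \<Omega>" by (intro L2_diff gvL zL broken_grad_L2)+
    have mL: "?m \<in> L2 \<Omega>"
    proof (rule L2_AE[OF domain_sets])
      have "(\<lambda>x. mesh_size \<T> x * (f\<^sub>h x - l x)) \<in> P0 \<T>"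
        unfolding P0_def
      proof (rule CollectI, rule ballI)
        fix T assume T: "T \<in> \<T>"
        show "\<exists>c. \<forall>x\<in>interior T. mesh_size \<T> x * (f\<^sub>h x - l x) = c"
          using k[OF T] mesh_size_element[OF T] by auto
      qed
      then show "(\<lambda>x. mesh_size \<T> x * (f\<^sub>h x - l x)) \<in> L2 \<Omega>"
        by (intro P0_L2)
      show "AE x in lebesgue_on \<Omega>. mesh_size \<T> x * (f\<^sub>h x - l x) = ?m x"
        using ll by eventually_elim simp
    qed
    have ce: "AE x in lebesgue_on \<Omega>. (norm (?e x))\<^sup>2 \<le> 1 / ?d\<^sup>2 * (?m x)\<^sup>2"
    proof -
      have "AE x in lebesgue_on \<Omega>. (norm (?y x - broken_grad \<T> u\<^sub>h x))\<^sup>2 \<le> 1 / ?d\<^sup>2 * (mesh_size \<T> x * (f\<^sub>h x - l x))\<^sup>2"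
        by (rule AE_element) (rule flux_correction_bound)
      then show ?thesis using ll zy by eventually_elim simp
    qed
    have par: "(norm (p - q))\<^sup>2 \<le> 2 * (norm p)\<^sup>2 + 2 * (norm q)\<^sup>2" for p q :: "real ^ 'n"
    proof -
      have "0 \<le> (norm (p + q))\<^sup>2" by simp
      then show ?thesis
        by (simp add: power2_norm_eq_inner inner_add_left inner_add_right inner_diff_left inner_diff_right inner_commute)
    qed
    have "L2_inner \<Omega> (\<lambda>x. ?gv x - z\<^sub>h x) (\<lambda>x. ?gv x - z\<^sub>h x)
      \<le> (LINT x|lebesgue_on \<Omega>. 2 * (?a x \<bullet> ?a x) + 2 * (1 / ?d\<^sup>2 * (?m x \<bullet> ?m x)))"
      unfolding L2_inner_def
    proof (rule integral_mono_AE)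
      show "AE x in lebesgue_on \<Omega>. (?gv x - z\<^sub>h x) \<bullet> (?gv x - z\<^sub>h x)
          \<le> 2 * (?a x \<bullet> ?a x) + 2 * (1 / ?d\<^sup>2 * (?m x \<bullet> ?m x))"
        using ce
      proof eventually_elim
        case (elim x)
        have "(norm (?gv x - z\<^sub>h x))\<^sup>2 \<le> 2 * (norm (?a x))\<^sup>2 + 2 * (norm (?e x))\<^sup>2"
          using par[of "?a x" "?e x"] by simp
        also have "\<dots> \<le> 2 * (norm (?a x))\<^sup>2 + 2 * (1 / ?d\<^sup>2 * (?m x)\<^sup>2)" using elim by linarith
        finally show ?case by (simp only: power2_norm_eq_inner) (simp add: power2_eq_square)
      qed
    qed (intro Bochner_Integration.integrable_add integrable_mult_right L2_inner_integrable aL mL)+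
    also have "\<dots> = 2 * L2_inner \<Omega> ?a ?a + 2 * (1 / ?d\<^sup>2 * L2_inner \<Omega> ?m ?m)"
      unfolding L2_inner_def using L2_inner_integrable[OF aL(1,1)] L2_inner_integrable[OF mL mL] by simp
    finally show ?thesis
      unfolding eta_A_sq_def eta_C_sq_def L2_norm_sq by linarith
  qed
  from first second show "?lhs \<le> ?mid + ?B
    \<and> ?mid + ?B \<le> eta_A_sq \<Omega> \<T> u\<^sub>h v + ?B + eta_C_sq \<Omega> \<T> f\<^sub>h lam\<^sub>h"
    by linarith
qed

end
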